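(* Let $Q$ be an infinite finitely generated group such that (a) every action of $Q$ on any $X\in\mathcal{X}_{ac}$ has a global fixed point, and (b) for every prime $p$ and every $X\in\mathcal{X}_{ac}$ that is mod-$p$ acyclic, the fixed point set of any action of $Q$ on $X$ is mod-$p$ acyclic. Then $Q$ admits no non-trivial isometric action on any proper metric space $X\in\mathcal{X}_{ac}$.
   Context: For a prime $p$, a space is mod-$p$ acyclic if it has the same mod-$p$ Čech cohomology as a point. $\mathcal{X}_{ac}$ is the class of all Hausdorff spaces $X$ of finite covering dimension such that $X$ is mod-$p$ acyclic for at least one prime $p$. Actions on topological spaces are by homeomorphisms (the group is discrete); an action is non-trivial if some group element acts as a non-identity map. A metric space is proper if its closed balls are compact. *)

theory Defs
  imports
    "HOL-Analysis.Abstract_Metric_Spaces"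
    "HOL-Algebra.FiniteProduct"
    "HOL-Algebra.Product_Groups"
    "HOL-Algebra.Elementary_Groups"
    "HOL-Algebra.Group_Action"
    "HOL-Computational_Algebra.Primes"
begin

section \<open>Open covers and covering dimension\<close>

definition open_cover :: "'a topology \<Rightarrow> 'a set set \<Rightarrow> bool" where
  "open_cover X U \<longleftrightarrow> (\<forall>u\<in>U. openin X u) \<and> \<Union>U = topspace X"

definition cover_refines :: "'a set set \<Rightarrow> 'a set set \<Rightarrow> bool" where
  "cover_refines V U \<longleftrightarrow> (\<forall>v\<in>V. \<exists>u\<in>U. v \<subseteq> u)"

text \<open>Arbitrary open covers are refined, not only finite ones; for paracompact Hausdorff spaces
  the two conventions agree.\<close>

definition covering_dim_le :: "'a topology \<Rightarrow> nat \<Rightarrow> bool" where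
  "covering_dim_le X n \<longleftrightarrow>
     (\<forall>U. open_cover X U \<longrightarrow>
       (\<exists>V. open_cover X V \<and> cover_refines V U \<and>
         (\<forall>x\<in>topspace X. finite {v \<in> V. x \<in> v} \<and> card {v \<in> V. x \<in> v} \<le> n + 1)))"

definition finite_covering_dim :: "'a topology \<Rightarrow> bool" where
  "finite_covering_dim X \<longleftrightarrow> (\<exists>n. covering_dim_le X n)"


section \<open>Cech cohomology\<close>

text \<open>The coefficient group \<open>A\<close> is an abelian group, written multiplicatively as everywhere in
  HOL-Algebra. We use the complex of all (not only alternating) Cech cochains: an \<open>n\<close>-simplex of a
  cover is an ordered tuple of \<open>n + 1\<close> members, repetitions allowed, with nonempty intersection,
  and an \<open>n\<close>-cochain is an arbitrary \<open>A\<close>-valued function on these.\<close>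

definition cech_simplices :: "'a set set \<Rightarrow> nat \<Rightarrow> 'a set list set" where
  "cech_simplices U n = {s. length s = n + 1 \<and> set s \<subseteq> U \<and> \<Inter>(set s) \<noteq> {}}"

definition cech_cochain_group ::
  "('c, 'd) monoid_scheme \<Rightarrow> 'a set set \<Rightarrow> nat \<Rightarrow> ('a set list \<Rightarrow> 'c) monoid" where
  "cech_cochain_group A U n = product_group (cech_simplices U n) (\<lambda>_. A)"

definition cech_face :: "nat \<Rightarrow> 'b list \<Rightarrow> 'b list" where
  "cech_face i s = take i s @ drop (Suc i) s"

definition cech_coboundary ::
  "('c, 'd) monoid_scheme \<Rightarrow> 'a set set \<Rightarrow> nat \<Rightarrow> ('a set list \<Rightarrow> 'c) \<Rightarrow> ('a set list \<Rightarrow> 'c)" where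
  "cech_coboundary A U n f =
     (\<lambda>s \<in> cech_simplices U (Suc n).
        finprod A (\<lambda>i. f (cech_face i s) [^]\<^bsub>A\<^esub> ((- 1) ^ i :: int)) {..Suc n})"

definition cech_cocycles ::
  "('c, 'd) monoid_scheme \<Rightarrow> 'a set set \<Rightarrow> nat \<Rightarrow> ('a set list \<Rightarrow> 'c) set" where
  "cech_cocycles A U n =
     kernel (cech_cochain_group A U n) (cech_cochain_group A U (Suc n)) (cech_coboundary A U n)"

definition cech_coboundaries ::
  "('c, 'd) monoid_scheme \<Rightarrow> 'a set set \<Rightarrow> nat \<Rightarrow> ('a set list \<Rightarrow> 'c) set" where
  "cech_coboundaries A U n =
     (case n of
        0 \<Rightarrow> {\<one>\<^bsub>cech_cochain_group A U 0\<^esub>}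
      | Suc m \<Rightarrow> cech_coboundary A U m ` carrier (cech_cochain_group A U m))"

definition cech_cocycle_group ::
  "('c, 'd) monoid_scheme \<Rightarrow> 'a set set \<Rightarrow> nat \<Rightarrow> ('a set list \<Rightarrow> 'c) monoid" where
  "cech_cocycle_group A U n = subgroup_generated (cech_cochain_group A U n) (cech_cocycles A U n)"

definition cover_cohomology ::
  "('c, 'd) monoid_scheme \<Rightarrow> 'a set set \<Rightarrow> nat \<Rightarrow> ('a set list \<Rightarrow> 'c) set monoid" where
  "cover_cohomology A U n = cech_cocycle_group A U n Mod cech_coboundaries A U n"

definition cocycle_class ::
  "('c, 'd) monoid_scheme \<Rightarrow> 'a set set \<Rightarrow> nat \<Rightarrow> ('a set list \<Rightarrow> 'c) \<Rightarrow> ('a set list \<Rightarrow> 'c) set" where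
  "cocycle_class A U n f = cech_coboundaries A U n #>\<^bsub>cech_cocycle_group A U n\<^esub> f"

definition refinement_map :: "'a set set \<Rightarrow> 'a set set \<Rightarrow> ('a set \<Rightarrow> 'a set) \<Rightarrow> bool" where
  "refinement_map V U r \<longleftrightarrow> (\<forall>v\<in>V. r v \<in> U \<and> v \<subseteq> r v)"

definition cochain_pullback ::
  "'a set set \<Rightarrow> ('a set \<Rightarrow> 'a set) \<Rightarrow> nat \<Rightarrow> ('a set list \<Rightarrow> 'c) \<Rightarrow> ('a set list \<Rightarrow> 'c)" where
  "cochain_pullback V r n f = (\<lambda>s \<in> cech_simplices V n. f (map r s))"

text \<open>The direct limit of the groups \<open>cover_cohomology A U n\<close> over all open covers \<open>U\<close>, ordered by
  refinement, is presented in the usual way: the direct sum of these groups modulo the subgroup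
  generated by all \<open>\<iota>\<^sub>U [f] - \<iota>\<^sub>V [r\<^sup>* f]\<close>, where \<open>r\<close> is a refinement map from \<open>V\<close> to \<open>U\<close>.\<close>

definition cech_sum ::
  "('c, 'd) monoid_scheme \<Rightarrow> 'a topology \<Rightarrow> nat
     \<Rightarrow> ('a set set \<Rightarrow> ('a set list \<Rightarrow> 'c) set) monoid" where
  "cech_sum A X n = sum_group {U. open_cover X U} (\<lambda>U. cover_cohomology A U n)"

definition cech_incl ::
  "('c, 'd) monoid_scheme \<Rightarrow> 'a topology \<Rightarrow> nat \<Rightarrow> 'a set set \<Rightarrow> ('a set list \<Rightarrow> 'c) set
     \<Rightarrow> ('a set set \<Rightarrow> ('a set list \<Rightarrow> 'c) set)" where
  "cech_incl A X n U c =
     (\<lambda>W \<in> {W. open_cover X W}. if W = U then c else \<one>\<^bsub>cover_cohomology A W n\<^esub>)"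

definition cech_relators ::
  "('c, 'd) monoid_scheme \<Rightarrow> 'a topology \<Rightarrow> nat
     \<Rightarrow> ('a set set \<Rightarrow> ('a set list \<Rightarrow> 'c) set) set" where
  "cech_relators A X n =
     {cech_incl A X n U (cocycle_class A U n f) \<otimes>\<^bsub>cech_sum A X n\<^esub>
        inv\<^bsub>cech_sum A X n\<^esub> cech_incl A X n V (cocycle_class A V n (cochain_pullback V r n f))
      | U V r f. open_cover X U \<and> open_cover X V \<and> refinement_map V U r \<and> f \<in> cech_cocycles A U n}"

definition cech_cohomology ::
  "('c, 'd) monoid_scheme \<Rightarrow> 'a topology \<Rightarrow> nat
     \<Rightarrow> ('a set set \<Rightarrow> ('a set list \<Rightarrow> 'c) set) set monoid" where
  "cech_cohomology A X n = cech_sum A X n Mod generate (cech_sum A X n) (cech_relators A X n)"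


section \<open>Acyclic spaces\<close>

definition mod_acyclic :: "nat \<Rightarrow> 'a topology \<Rightarrow> bool" where
  "mod_acyclic p X \<longleftrightarrow>
     (\<forall>n. cech_cohomology (integer_mod_group p) X n \<cong>
          cech_cohomology (integer_mod_group p) (discrete_topology {()}) n)"

definition X_ac :: "'a topology \<Rightarrow> bool" where
  "X_ac X \<longleftrightarrow> Hausdorff_space X \<and> finite_covering_dim X \<and> (\<exists>p. prime p \<and> mod_acyclic p X)"


section \<open>Groups and actions\<close>

definition finitely_generated_group :: "('g, 'h) monoid_scheme \<Rightarrow> bool" where
  "finitely_generated_group G \<longleftrightarrow>
     (\<exists>S. finite S \<and> S \<subseteq> carrier G \<and> generate G S = carrier G)"

definition top_action ::
  "('g, 'h) monoid_scheme \<Rightarrow> 'a topology \<Rightarrow> ('g \<Rightarrow> 'a \<Rightarrow> 'a) \<Rightarrow> bool" where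
  "top_action G X \<phi> \<longleftrightarrow>
     group_action G (topspace X) \<phi> \<and> (\<forall>g\<in>carrier G. homeomorphic_map X X (\<phi> g))"

definition isometric_action ::
  "('g, 'h) monoid_scheme \<Rightarrow> 'a set \<Rightarrow> ('a \<Rightarrow> 'a \<Rightarrow> real) \<Rightarrow> ('g \<Rightarrow> 'a \<Rightarrow> 'a) \<Rightarrow> bool" where
  "isometric_action G M d \<phi> \<longleftrightarrow>
     group_action G M \<phi> \<and> (\<forall>g\<in>carrier G. \<forall>x\<in>M. \<forall>y\<in>M. d (\<phi> g x) (\<phi> g y) = d x y)"

definition nontrivial_action ::
  "('g, 'h) monoid_scheme \<Rightarrow> 'a set \<Rightarrow> ('g \<Rightarrow> 'a \<Rightarrow> 'a) \<Rightarrow> bool" where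
  "nontrivial_action G E \<phi> \<longleftrightarrow> (\<exists>g\<in>carrier G. \<exists>x\<in>E. \<phi> g x \<noteq> x)"

definition fixed_points ::
  "('g, 'h) monoid_scheme \<Rightarrow> 'a set \<Rightarrow> ('g \<Rightarrow> 'a \<Rightarrow> 'a) \<Rightarrow> 'a set" where
  "fixed_points G E \<phi> = {x \<in> E. \<forall>g\<in>carrier G. \<phi> g x = x}"

definition proper_metric :: "'a set \<Rightarrow> ('a \<Rightarrow> 'a \<Rightarrow> real) \<Rightarrow> bool" where
  "proper_metric M d \<longleftrightarrow>
     Metric_space M d \<and>
     (\<forall>x\<in>M. \<forall>r. compactin (Metric_space.mtopology M d) (Metric_space.mcball M d x r))"

end

theory Submission
imports
  Defs
  "HOL-Number_Theory.Cong"
  "HOL-Library.Diagonal_Subsequence"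
  "HOL-Computational_Algebra.Polynomial"
  "HOL-Analysis.Urysohn"
begin

text \<open>
  Suppose that \<open>Q\<close> acts non-trivially by isometries on a proper metric space \<open>M\<close> of the class. By
  hypothesis (a) it fixes a point \<open>x0\<close>, so it preserves every closed ball about \<open>x0\<close>. These balls are
  compact, and on one of them the action is non-trivial. The largest displacement
  \<open>D g h = sup d (g y) (h y)\<close> over this ball is a totally bounded pseudometric on \<open>Q\<close>, invariant under
  left and right translations and not identically zero; that is, \<open>Q\<close> has a non-trivial homomorphism
  into a compact group (\<open>isometric_action_precompact\<close>). Three classical steps now lead to a
  contradiction with hypothesis (b).

  Peter and Weyl: \<open>Q\<close> has a non-trivial finite-dimensional real representation
  (\<open>nontrivial_matrix_representation\<close>). Completion and Haar measure are bypassed: functions on \<open>Q\<close> that are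
  Lipschitz for \<open>D\<close> have a two-sided invariant mean, obtained from finite averages of translates.
  The operator with kernel \<open>D x h - const\<close> is compact, symmetric and commutes with right translations,
  and an extremal eigenspace of its square is finite-dimensional and invariant.

  Malcev: the entries of the matrices lie in a finitely generated ring of real numbers, because \<open>Q\<close> is
  finitely generated. In such a ring every nonzero element becomes a unit in some finite quotient, by
  induction on the number of generators, so reduction of the matrices gives a proper normal
  subgroup \<open>H\<close> of finite index (\<open>linear_group_finite_quotient\<close>).

  Acyclic spaces with a disconnected fixed point set: the finite group \<open>F = Q / H\<close> acts on the graph with
  two vertices that are joined by one edge for each element of \<open>F\<close>. This graph has a large first
  cohomology. It is removed by passing to the inverse limit along an equivariant self-map
  under which all edges have the same image in the group of one-chains modulo a suitable prime \<open>p\<close>. The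
  limit is compact, one-dimensional and mod-\<open>p\<close> acyclic, but \<open>F\<close> fixes only the two
  points above the vertices (\<open>finite_quotient_moves_acyclic_space\<close>). A mod-\<open>p\<close> acyclic space is
  connected, so this contradicts (b).

  The hypotheses only speak of spaces whose points are elements of one type, so
  the limit has to be realised there. This is possible because \<open>M\<close> is connected and has more than one
  point, hence at least as many points as the real line.
\<close>

section \<open>Cech cochains with coefficients modulo a prime\<close>

definition alt_face_sum :: "nat \<Rightarrow> ('b list \<Rightarrow> int) \<Rightarrow> 'b list \<Rightarrow> int" where
  "alt_face_sum n f s = (\<Sum>i\<le>Suc n. (- 1) ^ i * f (cech_face i s))"

lemma length_cech_face [simp]: "i < length s \<Longrightarrow> length (cech_face i s) = length s - 1"
  by (simp add: cech_face_def)

lemma nth_cech_face: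
  assumes "i < length s" "k < length s - 1"
  shows "cech_face i s ! k = s ! (if k < i then k else Suc k)"
  using assms by (auto simp: cech_face_def nth_append)

lemma set_cech_face_subset: "set (cech_face i s) \<subseteq> set s"
  unfolding cech_face_def using set_take_subset set_drop_subset by fastforce

lemma map_cech_face: "map r (cech_face i s) = cech_face i (map r s)"
  by (simp add: cech_face_def take_map drop_map)

lemma cech_face_Cons_0 [simp]: "cech_face 0 (a # s) = s"
  by (simp add: cech_face_def)

lemma cech_face_Cons_Suc [simp]: "cech_face (Suc i) (a # s) = a # cech_face i s"
  by (simp add: cech_face_def)

lemma cech_face_replicate: "i < n \<Longrightarrow> cech_face i (replicate n v) = replicate (n - 1) v"
  by (simp add: cech_face_def min_def flip: replicate_add)

lemma cech_face_commute:
  assumes "j < i" "i < length s"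
  shows "cech_face j (cech_face i s) = cech_face (i - 1) (cech_face j s)"
proof (rule nth_equalityI)
  show "length (cech_face j (cech_face i s)) = length (cech_face (i - 1) (cech_face j s))"
    using assms by simp
  fix k assume "k < length (cech_face j (cech_face i s))"
  then have k: "k < length s - 2" using assms by simp
  show "cech_face j (cech_face i s) ! k = cech_face (i - 1) (cech_face j s) ! k"
    using assms k by (auto simp: nth_cech_face)
qed

text \<open>The terms cancel in pairs: removing entry \<open>i\<close> and then entry \<open>j < i\<close>
  is the same as removing \<open>j\<close> and then \<open>i - 1\<close>, with the opposite sign.\<close>
lemma alt_face_sum_twice:
  assumes "length s = n + 3"
  shows "alt_face_sum (Suc n) (alt_face_sum n f) s = 0"
proof -
  define h where "h = (\<lambda>(i, j). (- 1) ^ (i + j) * f (cech_face j (cech_face i s)))"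
  define A where "A = {(i, j). i \<le> n + 2 \<and> j < i}"
  define B where "B = {(i, j). i \<le> j \<and> j \<le> n + 1}"
  have split: "{..Suc (Suc n)} \<times> {..Suc n} = A \<union> B" "A \<inter> B = {}"
    by (auto simp: A_def B_def)
  have fin: "finite A" "finite B"
    by (metis finite_SigmaI finite_Un finite_atMost split(1))+
  have "alt_face_sum (Suc n) (alt_face_sum n f) s
        = (\<Sum>i\<le>Suc (Suc n). \<Sum>j\<le>Suc n. h (i, j))"
    by (simp add: alt_face_sum_def h_def sum_distrib_left power_add mult.assoc del: sum.atMost_Suc)
  also have "\<dots> = sum h ({..Suc (Suc n)} \<times> {..Suc n})"
    by (simp only: sum.cartesian_product) (simp add: case_prod_unfold)
  also have "\<dots> = sum h A + sum h B"
    using split fin by (simp add: sum.union_disjoint)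
  also have "sum h A = sum (\<lambda>q. - h q) B"
  proof (rule sum.reindex_bij_witness[where i = "\<lambda>(i, j). (Suc j, i)" and j = "\<lambda>(i, j). (j, i - 1)"])
    fix q assume "q \<in> A"
    then obtain i j where q: "q = (i, j)" "j < i" "i \<le> n + 2" by (auto simp: A_def)
    have "cech_face j (cech_face i s) = cech_face (i - 1) (cech_face j s)"
      using q assms by (intro cech_face_commute) auto
    moreover have "(- 1 :: int) ^ (i + j) = - ((- 1) ^ (j + (i - 1)))"
      using q by (cases i) (auto simp: power_add)
    ultimately show "- h (case q of (i, j) \<Rightarrow> (j, i - 1)) = h q"
      by (simp add: q h_def)
  qed (auto simp: A_def B_def)
  also have "sum (\<lambda>q. - h q) B + sum h B = 0" by (simp add: sum_negf)
  finally show ?thesis .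
qed

lemma alt_face_sum_Cons:
  "alt_face_sum (Suc n) f (a # s) = f s - alt_face_sum n (\<lambda>t. f (a # t)) s"
  unfolding alt_face_sum_def
  by (subst sum.atMost_Suc_shift) (simp add: sum_negf del: sum.atMost_Suc)

lemma cech_face_simplices:
  assumes "s \<in> cech_simplices U (Suc n)" "i \<le> Suc n"
  shows "cech_face i s \<in> cech_simplices U n"
proof -
  have "\<Inter> (set s) \<subseteq> \<Inter> (set (cech_face i s))" using set_cech_face_subset by (rule Inter_anti_mono)
  then show ?thesis
    using assms set_cech_face_subset[of i s] unfolding cech_simplices_def by auto
qed

lemma alt_face_sum_cong:
  assumes "\<And>i. i \<le> Suc n \<Longrightarrow> [f (cech_face i s) = g (cech_face i s)] (mod m)"
  shows "[alt_face_sum n f s = alt_face_sum n g s] (mod m)"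
  unfolding alt_face_sum_def using assms by (intro cong_sum cong_scalar_left) auto

lemma map_refinement_simplices:
  assumes "refinement_map V U r" "s \<in> cech_simplices V n"
  shows "map r s \<in> cech_simplices U n"
proof -
  obtain x where x: "x \<in> \<Inter> (set s)" using assms(2) by (auto simp: cech_simplices_def)
  have sub: "set s \<subseteq> V" using assms(2) by (simp add: cech_simplices_def)
  have "x \<in> \<Inter> (set (map r s))"
  proof
    fix u assume "u \<in> set (map r s)"
    then obtain v where "v \<in> set s" "u = r v" by auto
    then show "x \<in> u" using x sub assms(1) unfolding refinement_map_def by blast
  qed
  moreover have "set (map r s) \<subseteq> U" using sub assms(1) unfolding refinement_map_def by auto
  ultimately show ?thesis using assms(2) by (auto simp: cech_simplices_def)
qed

text \<open>Cochains take values in \<open>{0..<p}\<close>. All computations are done with arbitrary integer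
  valued functions and congruences, and \<open>reduce\<close> turns such a function into a cochain.\<close>
locale mod_p_coefficients =
  fixes p :: nat
  assumes prime_p: "prime p"
begin

abbreviation "A \<equiv> integer_mod_group p"

lemma p_pos: "p > 0" using prime_p prime_gt_0_nat by blast

lemma carrier_A: "carrier A = {0..<int p}"
  using p_pos by (simp add: carrier_integer_mod_group)

lemma mod_in_A [simp]: "x mod int p \<in> carrier A"
  using p_pos by (simp add: carrier_A)

sublocale A: comm_group A by simp

lemma finprod_A:
  assumes "finite I" "\<And>i. i \<in> I \<Longrightarrow> g i \<in> carrier A"
  shows "finprod A g I = (\<Sum>i\<in>I. g i) mod int p"
  using assms
proof (induction I rule: finite_induct)
  case (insert x F)
  then have "finprod A g (insert x F) = g x \<otimes>\<^bsub>A\<^esub> finprod A g F"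
    by (subst A.finprod_insert) auto
  with insert show ?case by (simp add: mod_simps)
qed (use p_pos in simp)

abbreviation "C \<equiv> cech_cochain_group A"

lemma carrier_C: "carrier (C U n) = (\<Pi>\<^sub>E s\<in>cech_simplices U n. {0..<int p})"
  by (simp add: cech_cochain_group_def carrier_A)

lemma comm_group_C: "comm_group (C U n)"
proof -
  interpret group "C U n" by (simp add: cech_cochain_group_def)
  show ?thesis
    by (rule group_comm_groupI) (auto simp: cech_cochain_group_def add.commute)
qed

definition reduce :: "'a set set \<Rightarrow> nat \<Rightarrow> ('a set list \<Rightarrow> int) \<Rightarrow> 'a set list \<Rightarrow> int" where
  "reduce U n g = (\<lambda>s\<in>cech_simplices U n. g s mod int p)"

lemma reduce_in_C [simp]: "reduce U n g \<in> carrier (C U n)"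
  using p_pos by (auto simp: reduce_def carrier_C)

lemma C_mod: "f \<in> carrier (C U n) \<Longrightarrow> s \<in> cech_simplices U n \<Longrightarrow> f s mod int p = f s"
  by (auto simp: carrier_C PiE_iff)

lemma coboundary_eq:
  assumes "f \<in> carrier (C U n)"
  shows "cech_coboundary A U n f = reduce U (Suc n) (alt_face_sum n f)"
proof (unfold cech_coboundary_def reduce_def, rule restrict_ext)
  fix s assume s: "s \<in> cech_simplices U (Suc n)"
  have "finprod A (\<lambda>i. f (cech_face i s) [^]\<^bsub>A\<^esub> ((- 1) ^ i :: int)) {..Suc n}
      = (\<Sum>i\<le>Suc n. f (cech_face i s) [^]\<^bsub>A\<^esub> ((- 1) ^ i :: int)) mod int p"
    by (rule finprod_A) (auto simp: int_pow_integer_mod_group)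
  also have "\<dots> = alt_face_sum n f s mod int p"
    unfolding alt_face_sum_def int_pow_integer_mod_group by (simp add: mod_sum_eq del: sum.atMost_Suc)
  finally show "finprod A (\<lambda>i. f (cech_face i s) [^]\<^bsub>A\<^esub> ((- 1) ^ i :: int)) {..Suc n}
    = alt_face_sum n f s mod int p" .
qed

lemma reduce_cong:
  assumes "\<And>s. s \<in> cech_simplices U n \<Longrightarrow> [f s = g s] (mod int p)"
  shows "reduce U n f = reduce U n g"
  unfolding reduce_def using assms by (intro restrict_ext) (auto simp: cong_def)

lemma reduce_C: "f \<in> carrier (C U n) \<Longrightarrow> reduce U n f = f"
  by (rule ext) (auto simp: reduce_def C_mod carrier_C PiE_iff extensional_def)

lemma C_mult: "f \<otimes>\<^bsub>C U n\<^esub> g = reduce U n (\<lambda>s. f s + g s)"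
  by (simp add: cech_cochain_group_def reduce_def)

lemma C_one: "\<one>\<^bsub>C U n\<^esub> = reduce U n (\<lambda>s. 0)"
  using p_pos by (simp add: cech_cochain_group_def reduce_def)

lemma reduce_apply: "s \<in> cech_simplices U n \<Longrightarrow> [reduce U n f s = f s] (mod int p)"
  by (simp add: reduce_def)

lemma coboundary_reduce:
  "cech_coboundary A U n (reduce U n g) = reduce U (Suc n) (alt_face_sum n g)"
  unfolding coboundary_eq[OF reduce_in_C]
  by (intro reduce_cong alt_face_sum_cong reduce_apply cech_face_simplices)

lemma alt_face_sum_add: "alt_face_sum n (\<lambda>s. f s + g s) s = alt_face_sum n f s + alt_face_sum n g s"
  by (simp add: alt_face_sum_def ring_distribs sum.distrib del: sum.atMost_Suc)

lemma coboundary_hom: "cech_coboundary A U n \<in> hom (C U n) (C U (Suc n))"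
proof (rule homI)
  fix f g assume fg: "f \<in> carrier (C U n)" "g \<in> carrier (C U n)"
  have "cech_coboundary A U n (f \<otimes>\<^bsub>C U n\<^esub> g) = reduce U (Suc n) (alt_face_sum n (\<lambda>s. f s + g s))"
    by (simp add: C_mult coboundary_reduce)
  also have "\<dots> = reduce U (Suc n) (\<lambda>s. cech_coboundary A U n f s + cech_coboundary A U n g s)"
    unfolding alt_face_sum_add coboundary_eq[OF fg(1)] coboundary_eq[OF fg(2)]
    by (intro reduce_cong cong_add; rule cong_sym[OF reduce_apply])
  also have "\<dots> = cech_coboundary A U n f \<otimes>\<^bsub>C U (Suc n)\<^esub> cech_coboundary A U n g"
    by (simp add: C_mult)
  finally show "cech_coboundary A U n (f \<otimes>\<^bsub>C U n\<^esub> g)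
      = cech_coboundary A U n f \<otimes>\<^bsub>C U (Suc n)\<^esub> cech_coboundary A U n g" .
qed (simp add: coboundary_eq)

sublocale coboundary: group_hom "C U n" "C U (Suc n)" "cech_coboundary A U n" for U n
proof -
  interpret a: comm_group "C U n" by (rule comm_group_C)
  interpret b: comm_group "C U (Suc n)" by (rule comm_group_C)
  show "group_hom (C U n) (C U (Suc n)) (cech_coboundary A U n)"
    by unfold_locales (rule coboundary_hom)
qed

lemma cocycles_iff:
  "f \<in> cech_cocycles A U n \<longleftrightarrow>
     f \<in> carrier (C U n) \<and> (\<forall>s\<in>cech_simplices U (Suc n). [alt_face_sum n f s = 0] (mod int p))"
proof (cases "f \<in> carrier (C U n)")
  case True
  have "cech_coboundary A U n f = \<one>\<^bsub>C U (Suc n)\<^esub> \<longleftrightarrow>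
     (\<forall>s\<in>cech_simplices U (Suc n). [alt_face_sum n f s = 0] (mod int p))"
    unfolding coboundary_eq[OF True] C_one
    by (auto simp: reduce_def fun_eq_iff cong_def restrict_def split: if_splits)
  with True show ?thesis by (simp add: cech_cocycles_def kernel_def)
qed (simp add: cech_cocycles_def kernel_def)

lemma coboundaries_Suc:
  "cech_coboundaries A U (Suc m) = range (\<lambda>g. reduce U (Suc m) (alt_face_sum m g))"
proof -
  have "cech_coboundaries A U (Suc m) = cech_coboundary A U m ` carrier (C U m)"
    by (simp add: cech_coboundaries_def)
  also have "carrier (C U m) = range (reduce U m)"
  proof
    show "carrier (C U m) \<subseteq> range (reduce U m)" using reduce_C[symmetric] by blast
  qed auto
  also have "cech_coboundary A U m ` range (reduce U m) = range (\<lambda>g. reduce U (Suc m) (alt_face_sum m g))"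
    by (simp add: image_image coboundary_reduce)
  finally show ?thesis .
qed

lemma subgroup_cocycles: "subgroup (cech_cocycles A U n) (C U n)"
  unfolding cech_cocycles_def by (rule coboundary.subgroup_kernel)

lemma subgroup_coboundaries_C: "subgroup (cech_coboundaries A U n) (C U n)"
proof (cases n)
  case 0
  interpret comm_group "C U n" by (rule comm_group_C)
  show ?thesis using 0 group.triv_subgroup[OF comm_group.axioms(2)[OF comm_group_C]] by (simp add: cech_coboundaries_def)
next
  case (Suc m)
  then show ?thesis using coboundary.img_is_subgroup[of U m] by (simp add: cech_coboundaries_def)
qed

lemma coboundaries_subset: "cech_coboundaries A U n \<subseteq> cech_cocycles A U n"
proof (cases n)
  case 0
  then show ?thesis
    using subgroup.one_closed[OF subgroup_cocycles, of U 0] by (simp add: cech_coboundaries_def)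
next
  case (Suc m)
  have "reduce U (Suc m) (alt_face_sum m g) \<in> cech_cocycles A U (Suc m)" for g
  proof -
    have "[alt_face_sum (Suc m) (reduce U (Suc m) (alt_face_sum m g)) s = 0] (mod int p)"
      if s: "s \<in> cech_simplices U (Suc (Suc m))" for s
    proof -
      have "[alt_face_sum (Suc m) (reduce U (Suc m) (alt_face_sum m g)) s
          = alt_face_sum (Suc m) (alt_face_sum m g) s] (mod int p)"
        by (intro alt_face_sum_cong reduce_apply cech_face_simplices[OF s])
      then show ?thesis using s by (simp add: alt_face_sum_twice cech_simplices_def)
    qed
    then show ?thesis by (simp add: cocycles_iff)
  qed
  then show ?thesis using Suc by (auto simp: coboundaries_Suc)
qed

abbreviation "Z \<equiv> cech_cocycle_group A"

lemma carrier_Z: "carrier (Z U n) = cech_cocycles A U n"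
  unfolding cech_cocycle_group_def
  by (rule subgroup.carrier_subgroup_generated_subgroup[OF subgroup_cocycles])

lemma mult_Z: "(\<otimes>\<^bsub>Z U n\<^esub>) = (\<otimes>\<^bsub>C U n\<^esub>)" and one_Z: "\<one>\<^bsub>Z U n\<^esub> = \<one>\<^bsub>C U n\<^esub>"
  by (simp_all add: cech_cocycle_group_def)

lemma comm_group_Z: "comm_group (Z U n)"
  unfolding cech_cocycle_group_def
  using comm_group_C group.abelian_subgroup_generated comm_group_def by blast

lemma subgroup_coboundaries: "subgroup (cech_coboundaries A U n) (Z U n)"
proof -
  interpret comm_group "C U n" by (rule comm_group_C)
  show ?thesis
    using subgroup_coboundaries_C coboundaries_subset carrier_Z
    unfolding cech_cocycle_group_def group.subgroup_subgroup_generated_iff[OF comm_group.axioms(2)[OF comm_group_C]]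
    by blast
qed

lemma comm_group_cover_cohomology: "comm_group (cover_cohomology A U n)"
  unfolding cover_cohomology_def
  by (rule comm_group.abelian_FactGroup[OF comm_group_Z subgroup_coboundaries])

lemma carrier_cover_cohomology:
  "carrier (cover_cohomology A U n) = cocycle_class A U n ` cech_cocycles A U n"
  by (auto simp: cover_cohomology_def carrier_FactGroup cocycle_class_def carrier_Z)

lemma one_cover_cohomology: "\<one>\<^bsub>cover_cohomology A U n\<^esub> = cech_coboundaries A U n"
  by (simp add: cover_cohomology_def)

lemma cocycle_class_coboundary:
  assumes "f \<in> cech_coboundaries A U n"
  shows "cocycle_class A U n f = \<one>\<^bsub>cover_cohomology A U n\<^esub>"
proof -
  interpret comm_group "Z U n" by (rule comm_group_Z)
  show ?thesis
    unfolding cocycle_class_def one_cover_cohomology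
    by (rule coset_join2[OF _ subgroup_coboundaries assms])
      (use assms coboundaries_subset[of U n] in \<open>auto simp: carrier_Z\<close>)
qed

lemma cochain_pullback_cocycle:
  assumes r: "refinement_map V U r" and f: "f \<in> cech_cocycles A U n"
  shows "cochain_pullback V r n f \<in> cech_cocycles A V n"
proof -
  have fC: "f \<in> carrier (C U n)" using f by (simp add: cocycles_iff)
  have "cochain_pullback V r n f \<in> carrier (C V n)"
    using fC map_refinement_simplices[OF r] by (auto simp: carrier_C cochain_pullback_def PiE_iff)
  moreover have "[alt_face_sum n (cochain_pullback V r n f) s = 0] (mod int p)"
    if s: "s \<in> cech_simplices V (Suc n)" for s
  proof -
    have "alt_face_sum n (cochain_pullback V r n f) s = alt_face_sum n f (map r s)"
      unfolding alt_face_sum_def cochain_pullback_def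
      by (intro sum.cong) (auto simp: cech_face_simplices[OF s] map_cech_face)
    then show ?thesis using f map_refinement_simplices[OF r s] by (simp add: cocycles_iff)
  qed
  ultimately show ?thesis by (simp add: cocycles_iff)
qed

end

section \<open>Degree zero cohomology and acyclicity\<close>

definition summand :: "'i set \<Rightarrow> ('i \<Rightarrow> ('b, 'c) monoid_scheme) \<Rightarrow> 'i \<Rightarrow> 'b \<Rightarrow> 'i \<Rightarrow> 'b" where
  "summand I G i c = (\<lambda>j\<in>I. if j = i then c else \<one>\<^bsub>G j\<^esub>)"

lemma summand_in_sum_group:
  assumes "\<And>i. i \<in> I \<Longrightarrow> group (G i)" "i \<in> I" "c \<in> carrier (G i)"
  shows "summand I G i c \<in> carrier (sum_group I G)"
proof -
  have "finite {j \<in> I. summand I G i c j \<noteq> \<one>\<^bsub>G j\<^esub>}"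
    by (rule finite_subset[of _ "{i}"]) (auto simp: summand_def)
  moreover have "\<one>\<^bsub>G j\<^esub> \<in> carrier (G j)" if "j \<in> I" for j
    using assms(1)[OF that] by (simp add: group.is_monoid)
  ultimately show ?thesis
    using assms by (auto simp: carrier_sum_group) (auto simp: summand_def)
qed

text \<open>Elements of a direct sum have finite support, so induction on the support reaches all of them
  from elements with a single nontrivial coordinate.\<close>
lemma sum_group_induct:
  assumes G: "\<And>i. i \<in> I \<Longrightarrow> group (G i)"
    and z: "z \<in> carrier (sum_group I G)"
    and one: "P \<one>\<^bsub>sum_group I G\<^esub>"
    and mult: "\<And>x y. x \<in> carrier (sum_group I G) \<Longrightarrow> y \<in> carrier (sum_group I G) \<Longrightarrow> P x \<Longrightarrow> P y
                 \<Longrightarrow> P (x \<otimes>\<^bsub>sum_group I G\<^esub> y)"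
    and summand: "\<And>i c. i \<in> I \<Longrightarrow> c \<in> carrier (G i) \<Longrightarrow> P (summand I G i c)"
  shows "P z"
proof -
  have "P z" if "finite F" "z \<in> carrier (sum_group I G)" "{i\<in>I. z i \<noteq> \<one>\<^bsub>G i\<^esub>} = F" for F z
    using that
  proof (induction F arbitrary: z rule: finite_induct)
    case empty
    then have "z = \<one>\<^bsub>sum_group I G\<^esub>"
      by (auto simp: carrier_sum_group[OF G] PiE_iff extensional_def fun_eq_iff restrict_def)
    with one show ?case by (simp only:)
  next
    case (insert i F)
    then have i: "i \<in> I" by auto
    have zi: "z i \<in> carrier (G i)" using insert.prems i by (auto simp: carrier_sum_group[OF G])
    have oneG: "\<one>\<^bsub>G j\<^esub> \<in> carrier (G j)" if "j \<in> I" for j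
      using G[OF that] by (simp add: group.is_monoid)
    define y where "y = (\<lambda>j\<in>I. if j = i then \<one>\<^bsub>G j\<^esub> else z j)"
    have supp: "{j\<in>I. y j \<noteq> \<one>\<^bsub>G j\<^esub>} = F"
      using insert.prems(2) insert.hyps i by (auto simp: y_def)
    have y: "y \<in> carrier (sum_group I G)"
      using insert.prems(1) insert.hyps(1) supp oneG
      by (auto simp: carrier_sum_group[OF G] y_def PiE_iff)
    have "summand I G i (z i) \<otimes>\<^bsub>sum_group I G\<^esub> y = z"
    proof
      fix j
      show "(summand I G i (z i) \<otimes>\<^bsub>sum_group I G\<^esub> y) j = z j"
        using insert.prems(1) i zi G[of j]
        by (cases "j \<in> I")
          (auto simp: carrier_sum_group[OF G] y_def summand_def PiE_iff extensional_def
             group.is_monoid monoid.l_one monoid.r_one)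
    qed
    moreover have "P (summand I G i (z i) \<otimes>\<^bsub>sum_group I G\<^esub> y)"
      by (intro mult y summand_in_sum_group summand i zi G insert.IH supp)
    ultimately show ?case by simp
  qed
  with z G show ?thesis by (auto simp: carrier_sum_group)
qed

lemma comm_group_sum_group:
  assumes "\<And>i. i \<in> I \<Longrightarrow> comm_group (G i)"
  shows "comm_group (sum_group I G)"
proof -
  have G: "\<And>i. i \<in> I \<Longrightarrow> group (G i)" using assms comm_group_def by blast
  show ?thesis
  proof (rule group.group_comm_groupI)
    fix x y assume xy: "x \<in> carrier (sum_group I G)" "y \<in> carrier (sum_group I G)"
    have "x i \<otimes>\<^bsub>G i\<^esub> y i = y i \<otimes>\<^bsub>G i\<^esub> x i" if i: "i \<in> I" for i
    proof -
      interpret comm_group "G i" using assms[OF i] .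
      show ?thesis using xy i by (intro m_comm) (auto simp: carrier_sum_group[OF G])
    qed
    then show "x \<otimes>\<^bsub>sum_group I G\<^esub> y = y \<otimes>\<^bsub>sum_group I G\<^esub> x" by (auto intro: restrict_ext)
  qed (simp add: G)
qed

lemma trivial_groups_isomorphic:
  assumes "group G" "group H" "carrier G = {\<one>\<^bsub>G\<^esub>}" "carrier H = {\<one>\<^bsub>H\<^esub>}"
  shows "G \<cong> H"
proof -
  have "\<one>\<^bsub>G\<^esub> \<otimes>\<^bsub>G\<^esub> \<one>\<^bsub>G\<^esub> = \<one>\<^bsub>G\<^esub>" "\<one>\<^bsub>H\<^esub> \<otimes>\<^bsub>H\<^esub> \<one>\<^bsub>H\<^esub> = \<one>\<^bsub>H\<^esub>"
    using assms(1,2) by (simp_all add: group.is_monoid monoid.l_one)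
  then have "(\<lambda>_. \<one>\<^bsub>H\<^esub>) \<in> iso G H"
    unfolding iso_def hom_def bij_betw_def by (simp add: assms(3,4))
  then show ?thesis unfolding is_iso_def by blast
qed

text \<open>The homomorphism out of a direct sum given by its universal property.\<close>
definition sum_hom :: "('b, 'c) monoid_scheme \<Rightarrow> 'i set \<Rightarrow> ('i \<Rightarrow> ('d, 'e) monoid_scheme)
    \<Rightarrow> ('i \<Rightarrow> 'd \<Rightarrow> 'b) \<Rightarrow> ('i \<Rightarrow> 'd) \<Rightarrow> 'b" where
  "sum_hom H I G h z = finprod H (\<lambda>i. h i (z i)) {i\<in>I. z i \<noteq> \<one>\<^bsub>G i\<^esub>}"

lemma (in comm_group)
  assumes K: "\<And>i. i \<in> I \<Longrightarrow> group (K i)"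
    and h: "\<And>i. i \<in> I \<Longrightarrow> h i \<in> hom (K i) G"
  shows sum_hom_hom: "sum_hom G I K h \<in> hom (sum_group I K) G"
    and sum_hom_summand: "\<And>i c. i \<in> I \<Longrightarrow> c \<in> carrier (K i) \<Longrightarrow> sum_hom G I K h (summand I K i c) = h i c"
proof -
  have h1: "h i \<one>\<^bsub>K i\<^esub> = \<one>" if "i \<in> I" for i
    using hom_one[OF h[OF that] K[OF that]] is_group by simp
  have hc: "h i c \<in> carrier G" if "i \<in> I" "c \<in> carrier (K i)" for i c
    using h[OF that(1)] that(2) by (rule hom_in_carrier)
  have ext: "sum_hom G I K h z = finprod G (\<lambda>i. h i (z i)) F"
    if "finite F" "F \<subseteq> I" "z \<in> carrier (sum_group I K)" "{i\<in>I. z i \<noteq> \<one>\<^bsub>K i\<^esub>} \<subseteq> F" for z F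
    unfolding sum_hom_def
    using that by (intro finprod_mono_neutral_cong_left) (auto simp: h1 hc carrier_sum_group[OF K] PiE_iff)
  show "sum_hom G I K h \<in> hom (sum_group I K) G"
  proof (rule homI)
    fix x assume x: "x \<in> carrier (sum_group I K)"
    then show "sum_hom G I K h x \<in> carrier G"
      unfolding sum_hom_def by (intro finprod_closed) (auto simp: hc carrier_sum_group[OF K] PiE_iff)
    fix y assume y: "y \<in> carrier (sum_group I K)"
    let ?F = "{i\<in>I. x i \<noteq> \<one>\<^bsub>K i\<^esub>} \<union> {i\<in>I. y i \<noteq> \<one>\<^bsub>K i\<^esub>}"
    have fin: "finite ?F" using x y by (auto simp: carrier_sum_group[OF K])
    have xc: "x i \<in> carrier (K i)" "y i \<in> carrier (K i)" if "i \<in> I" for i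
      using x y that by (auto simp: carrier_sum_group[OF K])
    have xy: "x \<otimes>\<^bsub>sum_group I K\<^esub> y \<in> carrier (sum_group I K)"
      by (rule monoid.m_closed[OF group.is_monoid[OF sum_group[OF K]] x y])
    have "sum_hom G I K h (x \<otimes>\<^bsub>sum_group I K\<^esub> y)
        = finprod G (\<lambda>i. h i ((x \<otimes>\<^bsub>sum_group I K\<^esub> y) i)) ?F"
      by (rule ext[OF fin _ xy]) (use K in \<open>auto simp: group.is_monoid monoid.l_one\<close>)
    also have "\<dots> = finprod G (\<lambda>i. h i (x i) \<otimes> h i (y i)) ?F"
      by (rule finprod_cong') (auto simp: hc xc hom_mult[OF h])
    also have "\<dots> = finprod G (\<lambda>i. h i (x i)) ?F \<otimes> finprod G (\<lambda>i. h i (y i)) ?F"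
      by (rule finprod_multf) (auto simp: hc xc)
    also have "\<dots> = sum_hom G I K h x \<otimes> sum_hom G I K h y"
      by (subst (1 2) ext[OF fin]) (auto simp: x y)
    finally show "sum_hom G I K h (x \<otimes>\<^bsub>sum_group I K\<^esub> y) = sum_hom G I K h x \<otimes> sum_hom G I K h y" .
  qed
  fix i c assume i: "i \<in> I" "c \<in> carrier (K i)"
  have "sum_hom G I K h (summand I K i c) = finprod G (\<lambda>j. h j (summand I K i c j)) {i}"
    by (rule ext) (use i K in \<open>auto simp: summand_in_sum_group\<close>, auto simp: summand_def split: if_splits)
  also have "\<dots> = h i c" using i by (simp add: summand_def hc)
  finally show "sum_hom G I K h (summand I K i c) = h i c" .
qed

context mod_p_coefficients
begin

abbreviation "covers X \<equiv> {U. open_cover X U}"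

lemma cech_incl_summand: "cech_incl A X n U = summand (covers X) (\<lambda>U. cover_cohomology A U n) U"
  by (simp add: cech_incl_def summand_def fun_eq_iff)

lemma group_cover_cohomology: "group (cover_cohomology A U n)"
  using comm_group_cover_cohomology comm_group_def by blast

lemma comm_group_cech_sum: "comm_group (cech_sum A X n)"
  unfolding cech_sum_def by (rule comm_group_sum_group) (rule comm_group_cover_cohomology)

sublocale S: comm_group "cech_sum A X n" for X n by (rule comm_group_cech_sum)

lemma cocycle_class_in_carrier:
  "f \<in> cech_cocycles A U n \<Longrightarrow> cocycle_class A U n f \<in> carrier (cover_cohomology A U n)"
  by (simp add: carrier_cover_cohomology)

lemma cech_incl_in_carrier:
  "open_cover X U \<Longrightarrow> f \<in> cech_cocycles A U n
     \<Longrightarrow> cech_incl A X n U (cocycle_class A U n f) \<in> carrier (cech_sum A X n)"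
  unfolding cech_incl_summand cech_sum_def
  by (rule summand_in_sum_group) (auto simp: group_cover_cohomology cocycle_class_in_carrier)

lemma cech_incl_one: "cech_incl A X n U \<one>\<^bsub>cover_cohomology A U n\<^esub> = \<one>\<^bsub>cech_sum A X n\<^esub>"
  unfolding cech_incl_def cech_sum_def one_sum_group by (rule restrict_ext) simp

lemma relators_subset: "cech_relators A X n \<subseteq> carrier (cech_sum A X n)"
  unfolding cech_relators_def by (auto intro!: cech_incl_in_carrier cochain_pullback_cocycle)

abbreviation "relations X n \<equiv> generate (cech_sum A X n) (cech_relators A X n)"

lemma subgroup_relations: "subgroup (relations X n) (cech_sum A X n)"
  by (rule S.generate_is_subgroup[OF relators_subset])

lemma normal_relations: "relations X n \<lhd> cech_sum A X n"
  using subgroup_relations S.normal_iff_subgroup by blast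

lemma relatorI:
  assumes "open_cover X U" "open_cover X V" "refinement_map V U r" "f \<in> cech_cocycles A U n"
  shows "cech_incl A X n U (cocycle_class A U n f) \<otimes>\<^bsub>cech_sum A X n\<^esub>
        inv\<^bsub>cech_sum A X n\<^esub> cech_incl A X n V (cocycle_class A V n (cochain_pullback V r n f)) \<in> relations X n"
  using assms by (intro generate.incl) (auto simp: cech_relators_def)

lemma cech_sum_induct:
  assumes "z \<in> carrier (cech_sum A X n)" "P \<one>\<^bsub>cech_sum A X n\<^esub>"
    and "\<And>x y. x \<in> carrier (cech_sum A X n) \<Longrightarrow> y \<in> carrier (cech_sum A X n) \<Longrightarrow> P x \<Longrightarrow> P y
                 \<Longrightarrow> P (x \<otimes>\<^bsub>cech_sum A X n\<^esub> y)"
    and "\<And>U f. open_cover X U \<Longrightarrow> f \<in> cech_cocycles A U n \<Longrightarrow> P (cech_incl A X n U (cocycle_class A U n f))"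
  shows "P z"
  using assms(1) unfolding cech_sum_def
proof (rule sum_group_induct[rotated])
  fix U c assume "U \<in> covers X" "c \<in> carrier (cover_cohomology A U n)"
  then show "P (summand (covers X) (\<lambda>U. cover_cohomology A U n) U c)"
    using assms(4) unfolding carrier_cover_cohomology cech_incl_summand by blast
qed (use assms(2,3) in \<open>simp_all only: cech_sum_def group_cover_cohomology\<close>)

text \<open>A cocycle is equal in the direct limit to each of its restrictions to finer covers, so it
  vanishes as soon as one of these is a coboundary.\<close>
lemma cech_cohomology_trivialI:
  assumes "\<And>U f. open_cover X U \<Longrightarrow> f \<in> cech_cocycles A U n \<Longrightarrow>
     \<exists>V r. open_cover X V \<and> refinement_map V U r \<and> cochain_pullback V r n f \<in> cech_coboundaries A V n"
  shows "carrier (cech_cohomology A X n) = {relations X n}"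
proof -
  interpret R: normal "relations X n" "cech_sum A X n" by (rule normal_relations)
  have all: "z \<in> relations X n" if "z \<in> carrier (cech_sum A X n)" for z
    using that
  proof (rule cech_sum_induct)
    fix U f assume Uf: "open_cover X U" "f \<in> cech_cocycles A U n"
    then obtain V r where V: "open_cover X V" "refinement_map V U r"
      "cochain_pullback V r n f \<in> cech_coboundaries A V n" using assms by blast
    show "cech_incl A X n U (cocycle_class A U n f) \<in> relations X n"
      using relatorI[OF Uf(1) V(1,2) Uf(2)] cech_incl_in_carrier[OF Uf]
      by (simp add: cocycle_class_coboundary[OF V(3)] cech_incl_one)
  qed (auto simp: R.m_closed)
  then have "carrier (cech_sum A X n) = relations X n" using R.subset by blast
  moreover have "relations X n #>\<^bsub>cech_sum A X n\<^esub> z = relations X n" if "z \<in> relations X n" for z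
    using that subgroup_relations R.subset by (intro S.coset_join2) auto
  moreover have "relations X n \<noteq> {}" using R.one_closed by blast
  ultimately show ?thesis
    unfolding cech_cohomology_def carrier_FactGroup by auto
qed

lemma group_cech_cohomology: "group (cech_cohomology A X n)"
  unfolding cech_cohomology_def by (rule normal.factorgroup_is_group[OF normal_relations])

lemma degree_0_class:
  assumes "f \<in> cech_cocycles A U 0"
  shows "cocycle_class A U 0 f = {f}"
proof -
  have f: "f \<in> carrier (C U 0)" using assms by (simp add: cocycles_iff)
  have "\<one>\<^bsub>C U 0\<^esub> \<otimes>\<^bsub>C U 0\<^esub> f = f"
    by (rule monoid.l_one[OF comm_monoid.axioms(1)[OF comm_group.axioms(1)[OF comm_group_C]] f])
  then show ?thesis
    unfolding cocycle_class_def r_coset_def cech_coboundaries_def by (simp add: mult_Z)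
qed

text \<open>In degree zero only the trivial cochain is a coboundary, so a class is the singleton of a
  cocycle; its value on a member of the cover containing \<open>x\<close> does not depend on that
  member.\<close>
definition cover_value :: "'a \<Rightarrow> 'a set set \<Rightarrow> ('a set list \<Rightarrow> int) set \<Rightarrow> int" where
  "cover_value x U c = (the_elem c) [SOME u. u \<in> U \<and> x \<in> u]"

lemma degree_0_cocycle_eq:
  assumes "f \<in> cech_cocycles A U 0" "u \<in> U" "v \<in> U" "u \<inter> v \<noteq> {}"
  shows "f [u] = f [v]"
proof -
  have "[u, v] \<in> cech_simplices U (Suc 0)" "[u] \<in> cech_simplices U 0" "[v] \<in> cech_simplices U 0"
    using assms by (auto simp: cech_simplices_def)
  moreover from this have "[alt_face_sum 0 f [u, v] = 0] (mod int p)"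
    using assms by (auto simp: cocycles_iff)
  then have "[f [v] = f [u]] (mod int p)"
    by (simp add: alt_face_sum_def cech_face_def cong_iff_dvd_diff)
  ultimately show ?thesis
    using assms(1) by (metis C_mod cocycles_iff cong_def)
qed

lemma cover_value_eq:
  assumes U: "open_cover X U" and x: "x \<in> topspace X"
    and f: "f \<in> cech_cocycles A U 0" and u: "u \<in> U" "x \<in> u"
  shows "cover_value x U (cocycle_class A U 0 f) = f [u]"
proof -
  have "(SOME u. u \<in> U \<and> x \<in> u) \<in> U \<and> x \<in> (SOME u. u \<in> U \<and> x \<in> u)"
    by (rule someI[of _ u]) (use u in auto)
  then show ?thesis
    unfolding cover_value_def degree_0_class[OF f] the_elem_eq
    using u by (intro degree_0_cocycle_eq[OF f]) auto
qed

lemma cover_value_hom: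
  assumes U: "open_cover X U" and x: "x \<in> topspace X"
  shows "cover_value x U \<in> hom (cover_cohomology A U 0) A"
proof -
  obtain u where u: "u \<in> U" "x \<in> u" using assms by (auto simp: open_cover_def)
  then have s: "[u] \<in> cech_simplices U 0" by (auto simp: cech_simplices_def)
  note val = cover_value_eq[OF U x _ u]
  show ?thesis
  proof (rule homI)
    fix c assume "c \<in> carrier (cover_cohomology A U 0)"
    then obtain f where f: "c = cocycle_class A U 0 f" "f \<in> cech_cocycles A U 0"
      by (auto simp: carrier_cover_cohomology)
    then show "cover_value x U c \<in> carrier A"
      using s by (auto simp: val cocycles_iff carrier_A carrier_C PiE_iff)
    fix d assume "d \<in> carrier (cover_cohomology A U 0)"
    then obtain g where g: "d = cocycle_class A U 0 g" "g \<in> cech_cocycles A U 0"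
      by (auto simp: carrier_cover_cohomology)
    have fg: "f \<otimes>\<^bsub>C U 0\<^esub> g \<in> cech_cocycles A U 0"
      using f g subgroup.m_closed[OF subgroup_cocycles] by blast
    have "c \<otimes>\<^bsub>cover_cohomology A U 0\<^esub> d = cocycle_class A U 0 (f \<otimes>\<^bsub>C U 0\<^esub> g)"
      using f g fg by (simp add: degree_0_class cover_cohomology_def set_mult_def mult_Z)
    then show "cover_value x U (c \<otimes>\<^bsub>cover_cohomology A U 0\<^esub> d) = cover_value x U c \<otimes>\<^bsub>A\<^esub> cover_value x U d"
      using s by (simp add: f g val fg) (simp add: C_mult reduce_def)
  qed
qed

text \<open>Evaluation of degree zero classes at a point. It respects refinement, so it is defined on the
  direct limit.\<close>
definition value_at :: "'a topology \<Rightarrow> 'a \<Rightarrow> ('a set set \<Rightarrow> ('a set list \<Rightarrow> int) set) \<Rightarrow> int" where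
  "value_at X x = sum_hom A (covers X) (\<lambda>U. cover_cohomology A U 0) (cover_value x)"

lemma
  assumes x: "x \<in> topspace X"
  shows value_at_hom: "value_at X x \<in> hom (cech_sum A X 0) A"
    and value_at_incl: "\<And>U f u. open_cover X U \<Longrightarrow> f \<in> cech_cocycles A U 0 \<Longrightarrow> u \<in> U \<Longrightarrow> x \<in> u \<Longrightarrow>
        value_at X x (cech_incl A X 0 U (cocycle_class A U 0 f)) = f [u]"
proof -
  show "value_at X x \<in> hom (cech_sum A X 0) A"
    unfolding value_at_def cech_sum_def
    by (rule A.sum_hom_hom) (auto simp: group_cover_cohomology cover_value_hom x)
  fix U f u assume *: "open_cover X U" "f \<in> cech_cocycles A U 0" "u \<in> U" "x \<in> u"
  have "value_at X x (cech_incl A X 0 U (cocycle_class A U 0 f)) = cover_value x U (cocycle_class A U 0 f)"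
    unfolding value_at_def cech_incl_summand
    by (rule A.sum_hom_summand) (use * in \<open>auto simp: group_cover_cohomology cover_value_hom x cocycle_class_in_carrier\<close>)
  also have "\<dots> = f [u]" by (rule cover_value_eq[OF *(1) x *(2-4)])
  finally show "value_at X x (cech_incl A X 0 U (cocycle_class A U 0 f)) = f [u]" .
qed

lemma group_hom_value_at: "x \<in> topspace X \<Longrightarrow> group_hom (cech_sum A X 0) A (value_at X x)"
  by (intro group_hom.intro group_hom_axioms.intro S.is_group A.is_group value_at_hom)

lemma relations_in_kernel:
  assumes x: "x \<in> topspace X"
  shows "relations X 0 \<subseteq> kernel (cech_sum A X 0) A (value_at X x)"
proof -
  interpret v: group_hom "cech_sum A X 0" A "value_at X x" by (rule group_hom_value_at[OF x])
  have "cech_relators A X 0 \<subseteq> kernel (cech_sum A X 0) A (value_at X x)"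
  proof
    fix z assume z: "z \<in> cech_relators A X 0"
    then obtain U V r f where Uf: "open_cover X U" "open_cover X V" "refinement_map V U r" "f \<in> cech_cocycles A U 0"
      and zeq: "z = cech_incl A X 0 U (cocycle_class A U 0 f) \<otimes>\<^bsub>cech_sum A X 0\<^esub>
        inv\<^bsub>cech_sum A X 0\<^esub> cech_incl A X 0 V (cocycle_class A V 0 (cochain_pullback V r 0 f))"
      unfolding cech_relators_def by blast
    let ?g = "cochain_pullback V r 0 f"
    have g: "?g \<in> cech_cocycles A V 0" by (rule cochain_pullback_cocycle[OF Uf(3,4)])
    obtain v where v: "v \<in> V" "x \<in> v" using Uf(2) x by (auto simp: open_cover_def)
    then have rv: "r v \<in> U" "x \<in> r v" using Uf(3) by (auto simp: refinement_map_def)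
    have "?g [v] = f [r v]" using v by (auto simp: cochain_pullback_def cech_simplices_def)
    then have "value_at X x (cech_incl A X 0 U (cocycle_class A U 0 f))
        = value_at X x (cech_incl A X 0 V (cocycle_class A V 0 ?g))"
      by (simp add: value_at_incl[OF x Uf(1) Uf(4) rv] value_at_incl[OF x Uf(2) g v])
    then have "value_at X x z = \<one>\<^bsub>A\<^esub>"
      unfolding zeq
      using cech_incl_in_carrier[OF Uf(1,4)] cech_incl_in_carrier[OF Uf(2) g]
      by (subst v.hom_mult) (auto simp del: mult_integer_mod_group one_integer_mod_group inv_integer_mod_group)
    then show "z \<in> kernel (cech_sum A X 0) A (value_at X x)"
      using relators_subset z by (auto simp: kernel_def)
  qed
  then show ?thesis by (rule S.generate_subgroup_incl[OF _ v.subgroup_kernel])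
qed

text \<open>Members of the cover with different values are disjoint, so the unions of those with the value
  of \<open>u\<close> and of those with another value separate the space.\<close>
lemma degree_0_cocycle_const:
  assumes con: "connected_space X" and U: "open_cover X U" and f: "f \<in> cech_cocycles A U 0"
    and u: "u \<in> U" "u \<noteq> {}" and v: "v \<in> U" "v \<noteq> {}"
  shows "f [u] = f [v]"
proof (rule ccontr)
  assume ne: "f [u] \<noteq> f [v]"
  define P where "P = \<Union>{w \<in> U. f [w] = f [u]}"
  define R where "R = \<Union>{w \<in> U. f [w] \<noteq> f [u]}"
  have "openin X P" "openin X R" using U by (auto simp: P_def R_def open_cover_def)
  moreover have "topspace X \<subseteq> P \<union> R"
  proof
    fix x assume "x \<in> topspace X"
    then obtain w where "w \<in> U" "x \<in> w" using U by (auto simp: open_cover_def)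
    then show "x \<in> P \<union> R" unfolding P_def R_def by (cases "f [w] = f [u]") auto
  qed
  moreover have "P \<inter> R = {}"
    using degree_0_cocycle_eq[OF f] by (force simp: P_def R_def)
  moreover have "P \<noteq> {}" "R \<noteq> {}" using u v ne by (auto simp: P_def R_def)
  ultimately show False using con unfolding connected_space_def by blast
qed

lemma degree_0_reduce_cocycle:
  assumes "\<And>u v. u \<in> U \<Longrightarrow> v \<in> U \<Longrightarrow> u \<inter> v \<noteq> {} \<Longrightarrow> g [u] = g [v]"
  shows "reduce U 0 g \<in> cech_cocycles A U 0"
proof -
  have "[alt_face_sum 0 (reduce U 0 g) s = 0] (mod int p)" if s: "s \<in> cech_simplices U (Suc 0)" for s
  proof -
    from s obtain u v where "s = [u, v]" by (auto simp: cech_simplices_def length_Suc_conv)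
    with s have uv: "s = [u, v]" "u \<in> U" "v \<in> U" "u \<inter> v \<noteq> {}" by (auto simp: cech_simplices_def)
    then have "[u] \<in> cech_simplices U 0" "[v] \<in> cech_simplices U 0" by (auto simp: cech_simplices_def)
    then show ?thesis
      using uv assms[OF uv(2-4)] by (simp add: alt_face_sum_def cech_face_def reduce_def)
  qed
  then show ?thesis by (simp add: cocycles_iff)
qed

text \<open>Evaluation at a point is onto, because the cover by the whole space carries constant cocycles.
  It is injective modulo the relations: on a connected space every degree zero cocycle is constant, hence
  the restriction of a constant cocycle on the whole space.\<close>
theorem degree_0_cohomology_connected:
  assumes con: "connected_space X" and ne: "topspace X \<noteq> {}"
  shows "cech_cohomology A X 0 \<cong> A"
proof -
  obtain x where x: "x \<in> topspace X" using ne by blast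
  interpret v: group_hom "cech_sum A X 0" A "value_at X x" by (rule group_hom_value_at[OF x])
  interpret R: normal "relations X 0" "cech_sum A X 0" by (rule normal_relations)
  let ?T = "{topspace X}"
  define k where "k c = reduce ?T 0 (\<lambda>_. c)" for c :: int
  define i where "i c = cech_incl A X 0 ?T (cocycle_class A ?T 0 (k c))" for c
  have T: "open_cover X ?T" by (simp add: open_cover_def)
  have Ts: "[topspace X] \<in> cech_simplices ?T 0" using ne by (simp add: cech_simplices_def)
  have k: "k c \<in> cech_cocycles A ?T 0" for c unfolding k_def by (rule degree_0_reduce_cocycle) simp
  have i: "i c \<in> carrier (cech_sum A X 0)" for c unfolding i_def by (rule cech_incl_in_carrier[OF T k])
  have vi: "value_at X x (i c) = c mod int p" for c
    unfolding i_def by (subst value_at_incl[OF x T k]) (use x Ts in \<open>auto simp: k_def reduce_def\<close>)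
  have add: "k a \<otimes>\<^bsub>C ?T 0\<^esub> k b = k ((a + b) mod int p)" for a b
    unfolding C_mult k_def by (intro reduce_cong) (auto simp: reduce_def cong_def mod_simps)
  have imult: "i (a \<otimes>\<^bsub>A\<^esub> b) = i a \<otimes>\<^bsub>cech_sum A X 0\<^esub> i b" for a b
  proof -
    have "cocycle_class A ?T 0 (k a) \<otimes>\<^bsub>cover_cohomology A ?T 0\<^esub> cocycle_class A ?T 0 (k b)
        = cocycle_class A ?T 0 (k ((a + b) mod int p))"
      using k by (simp add: degree_0_class cover_cohomology_def set_mult_def mult_Z add)
    moreover have "\<one>\<^bsub>cover_cohomology A W 0\<^esub> \<otimes>\<^bsub>cover_cohomology A W 0\<^esub> \<one>\<^bsub>cover_cohomology A W 0\<^esub>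
        = \<one>\<^bsub>cover_cohomology A W 0\<^esub>" for W :: "'a set set"
      using group_cover_cohomology[of W 0] by (simp add: group.is_monoid monoid.l_one)
    ultimately show ?thesis
      by (auto simp: i_def cech_incl_def cech_sum_def fun_eq_iff)
  qed
  have key: "z \<otimes>\<^bsub>cech_sum A X 0\<^esub> inv\<^bsub>cech_sum A X 0\<^esub> i (value_at X x z) \<in> relations X 0"
    if "z \<in> carrier (cech_sum A X 0)" for z
    using that
  proof (rule cech_sum_induct)
    have "i (value_at X x \<one>\<^bsub>cech_sum A X 0\<^esub>) = \<one>\<^bsub>cech_sum A X 0\<^esub>"
    proof -
      have "i 0 \<otimes>\<^bsub>cech_sum A X 0\<^esub> i 0 = i 0" using imult[of 0 0] by simp
      then have "i 0 = \<one>\<^bsub>cech_sum A X 0\<^esub>" using i S.l_cancel_one by metis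
      then show ?thesis by simp
    qed
    then show "\<one>\<^bsub>cech_sum A X 0\<^esub> \<otimes>\<^bsub>cech_sum A X 0\<^esub>
        inv\<^bsub>cech_sum A X 0\<^esub> i (value_at X x \<one>\<^bsub>cech_sum A X 0\<^esub>) \<in> relations X 0"
      using R.one_closed by simp
  next
    fix y z assume yz: "y \<in> carrier (cech_sum A X 0)" "z \<in> carrier (cech_sum A X 0)"
      and "y \<otimes>\<^bsub>cech_sum A X 0\<^esub> inv\<^bsub>cech_sum A X 0\<^esub> i (value_at X x y) \<in> relations X 0"
      and "z \<otimes>\<^bsub>cech_sum A X 0\<^esub> inv\<^bsub>cech_sum A X 0\<^esub> i (value_at X x z) \<in> relations X 0"
    from this(3,4) have "(y \<otimes>\<^bsub>cech_sum A X 0\<^esub> inv\<^bsub>cech_sum A X 0\<^esub> i (value_at X x y)) \<otimes>\<^bsub>cech_sum A X 0\<^esub>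
      (z \<otimes>\<^bsub>cech_sum A X 0\<^esub> inv\<^bsub>cech_sum A X 0\<^esub> i (value_at X x z)) \<in> relations X 0"
      by (rule R.m_closed)
    moreover have "(y \<otimes>\<^bsub>cech_sum A X 0\<^esub> z) \<otimes>\<^bsub>cech_sum A X 0\<^esub>
        inv\<^bsub>cech_sum A X 0\<^esub> i (value_at X x (y \<otimes>\<^bsub>cech_sum A X 0\<^esub> z))
      = (y \<otimes>\<^bsub>cech_sum A X 0\<^esub> inv\<^bsub>cech_sum A X 0\<^esub> i (value_at X x y)) \<otimes>\<^bsub>cech_sum A X 0\<^esub>
      (z \<otimes>\<^bsub>cech_sum A X 0\<^esub> inv\<^bsub>cech_sum A X 0\<^esub> i (value_at X x z))"
      unfolding v.hom_mult[OF yz] imult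
      using yz i by (simp add: S.inv_mult S.m_ac)
    ultimately show "(y \<otimes>\<^bsub>cech_sum A X 0\<^esub> z) \<otimes>\<^bsub>cech_sum A X 0\<^esub>
        inv\<^bsub>cech_sum A X 0\<^esub> i (value_at X x (y \<otimes>\<^bsub>cech_sum A X 0\<^esub> z)) \<in> relations X 0" by simp
  next
    fix U f assume U: "open_cover X U" and f: "f \<in> cech_cocycles A U 0"
    let ?z = "cech_incl A X 0 U (cocycle_class A U 0 f)"
    obtain u where u: "u \<in> U" "x \<in> u" using U x by (auto simp: open_cover_def)
    have ref: "refinement_map U ?T (\<lambda>_. topspace X)"
      using U by (auto simp: refinement_map_def open_cover_def dest: openin_subset)
    have "cochain_pullback U (\<lambda>_. topspace X) 0 (k (f [u])) = f"
    proof
      fix s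
      show "cochain_pullback U (\<lambda>_. topspace X) 0 (k (f [u])) s = f s"
      proof (cases "s \<in> cech_simplices U 0")
        case True
        then obtain w where "s = [w]" by (auto simp: cech_simplices_def length_Suc_conv)
        with True have w: "s = [w]" "w \<in> U" "w \<noteq> {}" by (auto simp: cech_simplices_def)
        have "f [w] = f [u]" using degree_0_cocycle_const[OF con U f] w u by blast
        moreover have "f s mod int p = f s" using C_mod f True by (auto simp: cocycles_iff)
        ultimately show ?thesis using True w Ts by (simp add: cochain_pullback_def k_def reduce_def)
      next
        case False
        then show ?thesis using f by (auto simp: cochain_pullback_def cocycles_iff carrier_C PiE_iff extensional_def)
      qed
    qed
    then have "i (f [u]) \<otimes>\<^bsub>cech_sum A X 0\<^esub> inv\<^bsub>cech_sum A X 0\<^esub> ?z \<in> relations X 0"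
      using relatorI[OF T U ref k, of "f [u]"] by (simp add: i_def)
    then have "inv\<^bsub>cech_sum A X 0\<^esub> (i (f [u]) \<otimes>\<^bsub>cech_sum A X 0\<^esub> inv\<^bsub>cech_sum A X 0\<^esub> ?z) \<in> relations X 0"
      by (rule R.m_inv_closed)
    then show "?z \<otimes>\<^bsub>cech_sum A X 0\<^esub> inv\<^bsub>cech_sum A X 0\<^esub> i (value_at X x ?z) \<in> relations X 0"
      using i cech_incl_in_carrier[OF U f] by (simp add: value_at_incl[OF x U f u] S.inv_mult_group)
  qed
  have "kernel (cech_sum A X 0) A (value_at X x) = relations X 0"
  proof
    show "kernel (cech_sum A X 0) A (value_at X x) \<subseteq> relations X 0"
    proof
      fix z assume "z \<in> kernel (cech_sum A X 0) A (value_at X x)"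
      then have z: "z \<in> carrier (cech_sum A X 0)" "value_at X x z = 0" by (auto simp: kernel_def)
      have "i 0 = \<one>\<^bsub>cech_sum A X 0\<^esub>" using i S.l_cancel_one imult[of 0 0] by simp
      then show "z \<in> relations X 0" using key[OF z(1)] z by simp
    qed
  qed (rule relations_in_kernel[OF x])
  moreover have "value_at X x ` carrier (cech_sum A X 0) = carrier A"
  proof
    show "carrier A \<subseteq> value_at X x ` carrier (cech_sum A X 0)"
    proof
      fix c assume "c \<in> carrier A"
      then have "value_at X x (i c) = c" by (simp add: vi carrier_A)
      then show "c \<in> value_at X x ` carrier (cech_sum A X 0)" using i by (metis imageI)
    qed
  qed auto
  ultimately show ?thesis
    unfolding cech_cohomology_def using v.FactGroup_iso by simp
qed

lemma point_cohomology_0: "cech_cohomology A (discrete_topology {()}) 0 \<cong> A"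
  by (rule degree_0_cohomology_connected) (auto simp: connected_space_discrete_topology)

text \<open>The cone with apex \<open>u\<close> is a chain homotopy on simplices that remain simplices when
  \<open>u\<close> is added.\<close>
lemma cone_primitive:
  assumes f: "f \<in> cech_cocycles A U (Suc n)" and s: "u # s \<in> cech_simplices U (Suc (Suc n))"
  shows "[alt_face_sum n (\<lambda>t. f (u # t)) s = f s] (mod int p)"
proof -
  have "[alt_face_sum (Suc n) f (u # s) = 0] (mod int p)"
    using f s by (auto simp: cocycles_iff)
  then show ?thesis unfolding alt_face_sum_Cons
    by (metis cong_diff_iff_cong_0 cong_sym)
qed

lemma coboundariesI:
  assumes "f \<in> carrier (C U (Suc n))"
    "\<And>s. s \<in> cech_simplices U (Suc n) \<Longrightarrow> [alt_face_sum n g s = f s] (mod int p)"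
  shows "f \<in> cech_coboundaries A U (Suc n)"
proof -
  have "f = reduce U (Suc n) (alt_face_sum n g)"
    using reduce_cong[of U "Suc n" "alt_face_sum n g" f] assms(2) reduce_C[OF assms(1)] by simp
  then show ?thesis by (auto simp: coboundaries_Suc)
qed

lemma point_cohomology_Suc:
  "carrier (cech_cohomology A (discrete_topology {()}) (Suc n)) = {relations (discrete_topology {()}) (Suc n)}"
proof (rule cech_cohomology_trivialI)
  fix U f assume U: "open_cover (discrete_topology {()}) U" and f: "f \<in> cech_cocycles A U (Suc n)"
  let ?V = "{{()}}"
  have "() \<in> \<Union>U" using U by (simp add: open_cover_def)
  then have "{()} \<in> U"
  proof
    fix u assume u: "() \<in> u" "u \<in> U"
    then have "u = {()}" by auto
    with u show ?thesis by simp
  qed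
  then have r: "refinement_map ?V U (\<lambda>v. v)" by (simp add: refinement_map_def)
  have V: "open_cover (discrete_topology {()}) ?V" by (simp add: open_cover_def)
  let ?g = "cochain_pullback ?V (\<lambda>v. v) (Suc n) f"
  have g: "?g \<in> cech_cocycles A ?V (Suc n)" by (rule cochain_pullback_cocycle[OF r f])
  have "?g \<in> cech_coboundaries A ?V (Suc n)"
  proof (rule coboundariesI)
    fix s assume "s \<in> cech_simplices ?V (Suc n)"
    then have "{()} # s \<in> cech_simplices ?V (Suc (Suc n))" by (auto simp: cech_simplices_def)
    then show "[alt_face_sum n (\<lambda>t. ?g ({()} # t)) s = ?g s] (mod int p)"
      by (rule cone_primitive[OF g])
  qed (use g in \<open>simp add: cocycles_iff\<close>)
  then show "\<exists>V r. open_cover (discrete_topology {()}) V \<and> refinement_map V U r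
      \<and> cochain_pullback V r (Suc n) f \<in> cech_coboundaries A V (Suc n)"
    using V r by blast
qed

theorem mod_acyclicI:
  assumes con: "connected_space X" and ne: "topspace X \<noteq> {}"
    and "\<And>n U f. open_cover X U \<Longrightarrow> f \<in> cech_cocycles A U (Suc n) \<Longrightarrow>
     \<exists>V r. open_cover X V \<and> refinement_map V U r \<and> cochain_pullback V r (Suc n) f \<in> cech_coboundaries A V (Suc n)"
  shows "mod_acyclic p X"
  unfolding mod_acyclic_def
proof
  fix n
  show "cech_cohomology A X n \<cong> cech_cohomology A (discrete_topology {()}) n"
  proof (cases n)
    case 0
    then show ?thesis
      using degree_0_cohomology_connected[OF con ne] point_cohomology_0 group_cech_cohomology
      by (metis group.iso_sym iso_trans)
  next
    case (Suc m)
    have "carrier (cech_cohomology A X n) = {\<one>\<^bsub>cech_cohomology A X n\<^esub>}"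
      using Suc cech_cohomology_trivialI[of X n] assms(3) by (auto simp: cech_cohomology_def)
    moreover have "carrier (cech_cohomology A (discrete_topology {()}) n) = {\<one>\<^bsub>cech_cohomology A (discrete_topology {()}) n\<^esub>}"
      using Suc point_cohomology_Suc[of m] by (simp add: cech_cohomology_def)
    ultimately show ?thesis
      by (intro trivial_groups_isomorphic group_cech_cohomology)
  qed
qed

text \<open>A separation gives a cover by two disjoint open sets, on which cocycles take two independent
  values. Evaluation at one point of each set keeps them apart in the limit, so there are at least \<open>p
  ^ 2\<close> classes of degree zero, while a point has only \<open>p\<close>.\<close>
theorem mod_acyclic_imp_connected:
  assumes ac: "mod_acyclic p X"
  shows "connected_space X"
proof (rule ccontr)
  assume "\<not> connected_space X"
  then obtain P R where PR: "openin X P" "openin X R" "topspace X \<subseteq> P \<union> R" "P \<inter> R = {}" "P \<noteq> {}" "R \<noteq> {}"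
    unfolding connected_space_def by blast
  then obtain x y where xy: "x \<in> P" "y \<in> R" by blast
  then have top: "x \<in> topspace X" "y \<in> topspace X" using PR by (auto dest: openin_subset)
  let ?U = "{P, R}"
  have U: "open_cover X ?U" using PR by (auto simp: open_cover_def dest: openin_subset)
  define k where "k a b = reduce ?U 0 (\<lambda>s. if s = [P] then a else b)" for a b :: int
  have k: "k a b \<in> cech_cocycles A ?U 0" for a b
    unfolding k_def by (rule degree_0_reduce_cocycle) (use PR in auto)
  define i where "i a b = cech_incl A X 0 ?U (cocycle_class A ?U 0 (k a b))" for a b
  have i: "i a b \<in> carrier (cech_sum A X 0)" for a b unfolding i_def by (rule cech_incl_in_carrier[OF U k])
  have simp: "[P] \<in> cech_simplices ?U 0" "[R] \<in> cech_simplices ?U 0" using PR by (auto simp: cech_simplices_def)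
  have PneR: "P \<noteq> R" using PR by auto
  have vx: "value_at X x (i a b) = a mod int p" for a b
    unfolding i_def by (subst value_at_incl[OF top(1) U k]) (use xy simp in \<open>auto simp: k_def reduce_def\<close>)
  have vy: "value_at X y (i a b) = b mod int p" for a b
    unfolding i_def by (subst value_at_incl[OF top(2) U k]) (use xy simp PneR in \<open>auto simp: k_def reduce_def\<close>)
  define j where "j = (\<lambda>(a, b). relations X 0 #>\<^bsub>cech_sum A X 0\<^esub> i a b)"
  have same: "value_at X w z = value_at X w z'"
    if w: "w \<in> topspace X" and z: "z \<in> carrier (cech_sum A X 0)" "z' \<in> carrier (cech_sum A X 0)"
      and eq: "relations X 0 #>\<^bsub>cech_sum A X 0\<^esub> z = relations X 0 #>\<^bsub>cech_sum A X 0\<^esub> z'" for w z z'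
  proof -
    interpret v: group_hom "cech_sum A X 0" A "value_at X w" by (rule group_hom_value_at[OF w])
    have "z \<in> relations X 0 #>\<^bsub>cech_sum A X 0\<^esub> z'"
      using S.rcos_self[OF z(1) subgroup_relations] eq by simp
    then obtain h where h: "h \<in> relations X 0" "z = h \<otimes>\<^bsub>cech_sum A X 0\<^esub> z'" by (auto simp: r_coset_def)
    then have "h \<in> carrier (cech_sum A X 0)" "value_at X w h = \<one>\<^bsub>A\<^esub>"
      using relations_in_kernel[OF w] by (auto simp: kernel_def)
    then show ?thesis using h z v.hom_mult[of h z'] v.hom_closed[of z'] A.l_one by simp
  qed
  have "inj_on j (carrier A \<times> carrier A)"
  proof (rule inj_onI, clarify)
    fix a b a' b' assume "a \<in> carrier A" "b \<in> carrier A" "a' \<in> carrier A" "b' \<in> carrier A" "j (a, b) = j (a', b')"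
    then show "a = a' \<and> b = b'"
      using same[OF top(1) i i, of a b a' b'] same[OF top(2) i i, of a b a' b']
      by (simp add: j_def vx vy carrier_A)
  qed
  moreover have "j ` (carrier A \<times> carrier A) \<subseteq> carrier (cech_cohomology A X 0)"
    using i by (auto simp: j_def cech_cohomology_def carrier_FactGroup)
  moreover have "cech_cohomology A X 0 \<cong> A"
    using ac point_cohomology_0 iso_trans unfolding mod_acyclic_def by blast
  then obtain h where h: "bij_betw h (carrier (cech_cohomology A X 0)) (carrier A)"
    by (auto simp: is_iso_def iso_def)
  moreover have "finite (carrier A)" "card (carrier A) = p" by (auto simp: carrier_A)
  ultimately have "card (carrier A \<times> carrier A) \<le> p"
    by (metis bij_betw_finite bij_betw_same_card card_inj_on_le)
  then have "p * p \<le> p" using \<open>card (carrier A) = p\<close> by (simp only: card_cartesian_product)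
  then show False using prime_gt_1_nat[OF prime_p] by auto
qed

end

section \<open>One-dimensional spaces\<close>

context mod_p_coefficients
begin

lemma alt_face_sum_replicate:
  "alt_face_sum n f (replicate (Suc (Suc n)) v) = (if odd n then f (replicate (Suc n) v) else 0)"
proof -
  have "alt_face_sum n f (replicate (Suc (Suc n)) v)
      = (\<Sum>i\<le>Suc n. (- 1) ^ i * f (replicate (Suc n) v))"
    unfolding alt_face_sum_def by (intro sum.cong) (simp_all add: cech_face_replicate del: replicate_Suc)
  also have "\<dots> = (\<Sum>i\<le>Suc n. (- 1) ^ i) * f (replicate (Suc n) v)"
    by (simp only: sum_distrib_right)
  also have "(\<Sum>i\<le>Suc n. (- 1) ^ i) = (if odd n then 1 else 0 :: int)"
  proof (induction n)
    case (Suc n)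
    then show ?case by (subst sum.atMost_Suc) auto
  qed simp
  finally show ?thesis by simp
qed

lemma simplex_same_set:
  assumes "s \<in> cech_simplices V n" "set t \<subseteq> set s" "length t = Suc m"
  shows "t \<in> cech_simplices V m"
proof -
  have "\<Inter> (set s) \<subseteq> \<Inter> (set t)" using assms(2) by (rule Inter_anti_mono)
  then show ?thesis using assms unfolding cech_simplices_def by auto
qed

lemma singleton_set_replicate: "set t = {v} \<Longrightarrow> length t = n \<Longrightarrow> t = replicate n v"
  by (intro replicate_eqI) auto

text \<open>The nerve is a graph, but degenerate simplices occur in all degrees. A primitive is obtained by
  coning each simplex from an apex \<open>ap\<close> chosen according to its set of vertices; this works on
  simplices all of whose faces have the same vertices. The remaining faces of a simplex with apex
  \<open>u\<close> are constant lists at a vertex \<open>v\<close> other than \<open>u\<close>, for which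
  the apex is \<open>v\<close> and not \<open>u\<close>. For even \<open>m\<close> the two cones agree by
  the cocycle condition. For odd \<open>m\<close> their difference \<open>k u v\<close> is absorbed by the
  coboundary of \<open>h\<close>, which is supported on constant lists and does not change the coboundary of
  the primitive.\<close>
theorem coboundary_of_one_dim_cover:
  assumes order: "\<And>s n. s \<in> cech_simplices V n \<Longrightarrow> card (set s) \<le> 2"
    and f: "f \<in> cech_cocycles A V (Suc (Suc m))"
  shows "f \<in> cech_coboundaries A V (Suc (Suc m))"
proof -
  define ap where "ap S = (SOME v. v \<in> S)" for S :: "'a set set"
  have ap_in: "ap S \<in> S" if "S \<noteq> {}" for S using that unfolding ap_def some_in_eq .
  define k where "k u v = f (replicate (m + 3) v) - f (u # replicate (m + 2) v)" for u v
  define h where "h u w = (if card (set w) = 1 \<and> hd w \<noteq> u then k u (hd w) else 0)" for u and w :: "'a set list"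
  define g where "g t = f (ap (set t) # t) + (if odd m then alt_face_sum m (h (ap (set t))) t else 0)" for t
  have h_rep: "h u (replicate (Suc m) v) = (if v = u then 0 else k u v)" for u v
    unfolding h_def set_replicate_Suc by simp
  show ?thesis
  proof (rule coboundariesI)
    show "f \<in> carrier (C V (Suc (Suc m)))" using f by (simp add: cocycles_iff)
    fix s assume s: "s \<in> cech_simplices V (Suc (Suc m))"
    then have len: "length s = m + 3" and ne: "set s \<noteq> {}" by (auto simp: cech_simplices_def)
    define u where "u = ap (set s)"
    have u: "u \<in> set s" using ap_in ne by (simp add: u_def)
    let ?G = "\<lambda>t. f (u # t) + (if odd m then alt_face_sum m (h u) t else 0)"
    have face: "[g t = ?G t] (mod int p)" if t: "t = cech_face i s" and i: "i \<le> Suc (Suc m)" for t i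
    proof (cases "set t = set s")
      case True
      show ?thesis unfolding g_def u_def True by (rule cong_refl)
    next
      case False
      have sub: "set t \<subseteq> set s" unfolding t by (rule set_cech_face_subset)
      have lt: "length t = m + 2" using t i len by simp
      then have tne: "set t \<noteq> {}" by auto
      have "set t \<subset> set s" using sub False by blast
      then have "card (set t) < 2" using order[OF s] psubset_card_mono[of "set s" "set t"] by simp
      moreover have "card (set t) \<noteq> 0" using tne by simp
      ultimately have "card (set t) = 1" by linarith
      then obtain v where v: "set t = {v}" by (rule card_1_singletonE)
      then have trep: "t = replicate (Suc (Suc m)) v" using singleton_set_replicate[OF v, of "Suc (Suc m)"] lt by (simp del: replicate_Suc)
      have apt: "ap (set t) = v" using ap_in[OF tne] v by simp
      show ?thesis
      proof (cases "v = u")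
        case True
        then show ?thesis using apt by (simp add: g_def)
      next
        case False
        have vs: "v \<in> set s" using v sub by blast
        have gt: "g t = f (replicate (m + 3) v)"
          unfolding g_def apt unfolding trep alt_face_sum_replicate h_rep by (simp add: numeral_3_eq_3)
        have Gt: "?G t = f (u # replicate (m + 2) v) + (if odd m then k u v else 0)"
          unfolding trep alt_face_sum_replicate h_rep using False by simp
        show ?thesis
        proof (cases "odd m")
          case True
          then show ?thesis unfolding gt Gt by (simp add: k_def)
        next
          case even: False
          have "u # replicate (m + 3) v \<in> cech_simplices V (Suc (Suc (Suc m)))"
            by (rule simplex_same_set[OF s]) (use u vs in auto)
          then have "[alt_face_sum (Suc m) (\<lambda>t. f (u # t)) (replicate (m + 3) v) = f (replicate (m + 3) v)] (mod int p)"
            by (rule cone_primitive[OF f])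
          moreover have "alt_face_sum (Suc m) (\<lambda>t. f (u # t)) (replicate (m + 3) v) = f (u # replicate (m + 2) v)"
            using alt_face_sum_replicate[of "Suc m" "\<lambda>t. f (u # t)" v] even by (simp add: numeral_3_eq_3)
          ultimately show ?thesis unfolding gt Gt using even by (simp add: cong_sym)
        qed
      qed
    qed
    have "[alt_face_sum (Suc m) g s = alt_face_sum (Suc m) ?G s] (mod int p)"
      by (rule alt_face_sum_cong) (rule face, auto)
    moreover have "alt_face_sum (Suc m) ?G s = alt_face_sum (Suc m) (\<lambda>t. f (u # t)) s"
    proof -
      have "alt_face_sum (Suc m) (alt_face_sum m (h u)) s = 0" by (rule alt_face_sum_twice) (rule len)
      moreover have "alt_face_sum (Suc m) (\<lambda>_. 0) s = 0" by (simp add: alt_face_sum_def)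
      ultimately show ?thesis unfolding alt_face_sum_add by (cases "odd m") simp_all
    qed
    moreover have "[alt_face_sum (Suc m) (\<lambda>t. f (u # t)) s = f s] (mod int p)"
      by (rule cone_primitive[OF f], rule simplex_same_set[OF s]) (use u len in auto)
    ultimately show "[alt_face_sum (Suc m) g s = f s] (mod int p)" by (auto intro: cong_trans)
  qed
qed

text \<open>The refinement has order at most two and turns every \<open>c\<close> that satisfies the cocycle
  condition on the given cover into the difference of a potential \<open>g\<close>.\<close>
definition trivializing_refinement ::
    "'a topology \<Rightarrow> 'a set set \<Rightarrow> 'a set set \<Rightarrow> ('a set \<Rightarrow> 'a set) \<Rightarrow> bool" where
  "trivializing_refinement X U V r \<longleftrightarrow>
     open_cover X V \<and> refinement_map V U r \<and>
     (\<forall>x\<in>topspace X. finite {v \<in> V. x \<in> v} \<and> card {v \<in> V. x \<in> v} \<le> 2) \<and>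
     (\<forall>c. (\<forall>u\<in>U. \<forall>v\<in>U. \<forall>w\<in>U. u \<inter> v \<inter> w \<noteq> {} \<longrightarrow> [c u v + c v w = c u w] (mod int p)) \<longrightarrow>
       (\<exists>g. \<forall>v\<in>V. \<forall>w\<in>V. v \<inter> w \<noteq> {} \<longrightarrow> [c (r v) (r w) = g w - g v] (mod int p)))"

text \<open>Covers of order two have no cohomology above degree one, and the potentials of the trivializing
  refinements are primitives in degree one.\<close>
theorem one_dim_mod_acyclic:
  assumes con: "connected_space X" and ne: "topspace X \<noteq> {}"
    and H: "\<And>U. open_cover X U \<Longrightarrow> \<exists>V r. trivializing_refinement X U V r"
  shows "covering_dim_le X 1" "mod_acyclic p X"
proof -
  show "covering_dim_le X 1"
    unfolding covering_dim_le_def cover_refines_def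
  proof (intro allI impI)
    fix U assume "open_cover X U"
    then obtain V r where "trivializing_refinement X U V r" using H by blast
    then show "\<exists>V. open_cover X V \<and> (\<forall>v\<in>V. \<exists>u\<in>U. v \<subseteq> u) \<and>
        (\<forall>x\<in>topspace X. finite {v \<in> V. x \<in> v} \<and> card {v \<in> V. x \<in> v} \<le> 1 + 1)"
      unfolding trivializing_refinement_def refinement_map_def by (intro exI[of _ V]) auto
  qed
  show "mod_acyclic p X"
  proof (rule mod_acyclicI[OF con ne])
    fix n U f assume U: "open_cover X U" and f: "f \<in> cech_cocycles A U (Suc n)"
    obtain V r where Vr: "trivializing_refinement X U V r" using H[OF U] by blast
    then have V: "open_cover X V" and r: "refinement_map V U r"
      and ord: "\<forall>x\<in>topspace X. finite {v \<in> V. x \<in> v} \<and> card {v \<in> V. x \<in> v} \<le> 2"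
      unfolding trivializing_refinement_def by simp_all
    let ?f = "cochain_pullback V r (Suc n) f"
    have f': "?f \<in> cech_cocycles A V (Suc n)" by (rule cochain_pullback_cocycle[OF r f])
    have "?f \<in> cech_coboundaries A V (Suc n)"
    proof (cases n)
      case (Suc m)
      have "card (set s) \<le> 2" if s: "s \<in> cech_simplices V k" for s k
      proof -
        obtain x where x: "x \<in> \<Inter> (set s)" using s by (auto simp: cech_simplices_def)
        have sub: "set s \<subseteq> {v \<in> V. x \<in> v}" using s x by (auto simp: cech_simplices_def)
        have "set s \<noteq> {}" using s by (auto simp: cech_simplices_def)
        then obtain v where "v \<in> set s" by (meson ex_in_conv)
        then have "v \<in> V" "x \<in> v" using sub by auto
        then have "x \<in> topspace X" using V unfolding open_cover_def by blast
        then have "finite {v \<in> V. x \<in> v}" "card {v \<in> V. x \<in> v} \<le> 2" using ord by auto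
        then show ?thesis using card_mono[OF _ sub] by linarith
      qed
      then show ?thesis using f' coboundary_of_one_dim_cover Suc by blast
    next
      case 0
      have cocycle: "[f [u, v] + f [v, w] = f [u, w]] (mod int p)"
        if "u \<in> U" "v \<in> U" "w \<in> U" "u \<inter> v \<inter> w \<noteq> {}" for u v w
      proof -
        have "[u, v, w] \<in> cech_simplices U (Suc (Suc 0))" using that by (auto simp: cech_simplices_def)
        then have "[alt_face_sum (Suc 0) f [u, v, w] = 0] (mod int p)"
          using f 0 by (auto simp: cocycles_iff)
        then have "[f [v, w] - f [u, w] + f [u, v] = 0] (mod int p)"
          by (simp add: alt_face_sum_def cech_face_def)
        then show ?thesis by (simp add: cong_iff_dvd_diff algebra_simps)
      qed
      have "\<exists>g. \<forall>v\<in>V. \<forall>w\<in>V. v \<inter> w \<noteq> {} \<longrightarrow> [f [r v, r w] = g w - g v] (mod int p)"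
        by (rule Vr[unfolded trivializing_refinement_def, THEN conjunct2, THEN conjunct2, THEN conjunct2,
          THEN spec, of "\<lambda>u v. f [u, v]", THEN mp]) (intro ballI impI cocycle)
      then obtain g where g: "\<forall>v\<in>V. \<forall>w\<in>V. v \<inter> w \<noteq> {} \<longrightarrow> [f [r v, r w] = g w - g v] (mod int p)" ..
      show ?thesis unfolding 0
      proof (rule coboundariesI)
        show "cochain_pullback V r (Suc 0) f \<in> carrier (C V (Suc 0))" using f' 0 by (simp add: cocycles_iff)
        fix s assume s: "s \<in> cech_simplices V (Suc 0)"
        then obtain v w where "s = [v, w]" by (auto simp: cech_simplices_def length_Suc_conv)
        with s have vw: "s = [v, w]" "v \<in> V" "w \<in> V" "v \<inter> w \<noteq> {}" by (auto simp: cech_simplices_def)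
        show "[alt_face_sum 0 (\<lambda>t. g (hd t)) s = cochain_pullback V r (Suc 0) f s] (mod int p)"
          using g[rule_format, OF vw(2-4)] s by (simp add: vw(1) alt_face_sum_def cech_face_def cochain_pullback_def cong_sym)
      qed
    qed
    then show "\<exists>V r. open_cover X V \<and> refinement_map V U r \<and> cochain_pullback V r (Suc n) f \<in> cech_coboundaries A V (Suc n)"
      using V r by blast
  qed
qed

end

section \<open>An inverse limit of theta graphs\<close>

text \<open>The pair \<open>(e, t)\<close> is the point at position \<open>t\<close> of the edge
  \<open>e\<close>. All edges have length one and share their two ends, so a path between different edges
  passes through one of these. The outer maximum only matters for positions outside of the unit
  interval.\<close>
definition theta_dist :: "nat \<times> real \<Rightarrow> nat \<times> real \<Rightarrow> real" where
  "theta_dist x y = (if fst x = fst y then \<bar>snd x - snd y\<bar> else max 0 (min (snd x + snd y) (2 - snd x - snd y)))"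

text \<open>The end points of all edges are represented on the edge \<open>0\<close>.\<close>
definition normal_point :: "nat \<times> real \<Rightarrow> nat \<times> real" where
  "normal_point x = (if 0 < snd x \<and> snd x < 1 then x else (0, snd x))"

lemma snd_normal_point [simp]: "snd (normal_point x) = snd x"
  by (simp add: normal_point_def)

lemma theta_dist_commute: "theta_dist x y = theta_dist y x"
  by (auto simp: theta_dist_def add.commute)

lemma theta_dist_normal:
  assumes "0 \<le> snd x" "snd x \<le> 1" "0 \<le> snd y" "snd y \<le> 1"
  shows "theta_dist (normal_point x) y = theta_dist x y"
  using assms by (auto simp: theta_dist_def normal_point_def)

lemma theta_dist_normal2:
  assumes "0 \<le> snd x" "snd x \<le> 1" "0 \<le> snd y" "snd y \<le> 1"
  shows "theta_dist (normal_point x) (normal_point y) = theta_dist x y"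
  using assms by (metis theta_dist_commute theta_dist_normal snd_normal_point)

lemma theta_dist_triangle:
  assumes "0 \<le> snd x" "snd x \<le> 1" "0 \<le> snd y" "snd y \<le> 1" "0 \<le> snd z" "snd z \<le> 1"
  shows "theta_dist x z \<le> theta_dist x y + theta_dist y z"
  by (insert assms, unfold theta_dist_def, cases "fst x = fst y"; cases "fst y = fst z"; cases "fst x = fst z";
      simp only: if_True if_False simp_thms; linarith)

lemma theta_dist_le_1:
  assumes "0 \<le> snd x" "snd x \<le> 1" "0 \<le> snd y" "snd y \<le> 1"
  shows "theta_dist x y \<le> 1"
  by (insert assms, unfold theta_dist_def, cases "fst x = fst y"; simp only: if_True if_False simp_thms; linarith)

lemma theta_dist_ge:
  assumes "0 \<le> snd x" "snd x \<le> 1" "0 \<le> snd y" "snd y \<le> 1"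
  shows "\<bar>snd x - snd y\<bar> \<le> theta_dist x y"
  by (insert assms, unfold theta_dist_def, cases "fst x = fst y"; simp only: if_True if_False simp_thms; linarith)

text \<open>The triangle wave of period two.\<close>
definition zigzag :: "real \<Rightarrow> real" where
  "zigzag y = (if even \<lfloor>y\<rfloor> then frac y else 1 - frac y)"

lemma zigzag_range: "0 \<le> zigzag y" "zigzag y \<le> 1"
  using frac_ge_0[of y] frac_lt_1[of y] by (auto simp: zigzag_def)

lemma zigzag_lipschitz: "\<bar>zigzag y - zigzag z\<bar> \<le> \<bar>y - z\<bar>"
proof -
  have "\<bar>zigzag y - zigzag z\<bar> \<le> z - y" if "y \<le> z" for y z
  proof -
    have fl: "\<lfloor>y\<rfloor> \<le> \<lfloor>z\<rfloor>" using that by (rule floor_mono)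
    consider "\<lfloor>z\<rfloor> = \<lfloor>y\<rfloor>" | "\<lfloor>z\<rfloor> = \<lfloor>y\<rfloor> + 1" | "\<lfloor>z\<rfloor> \<ge> \<lfloor>y\<rfloor> + 2" using fl by linarith
    then show ?thesis
    proof cases
      case 3
      then have "z - y \<ge> 1" by linarith
      then show ?thesis using zigzag_range[of y] zigzag_range[of z] by linarith
    next
      case 1
      then show ?thesis using that by (auto simp: zigzag_def frac_def)
    next
      case 2
      then show ?thesis using that frac_ge_0[of z] frac_lt_1[of y] unfolding zigzag_def by (auto simp: frac_def)
    qed
  qed
  then show ?thesis by (metis abs_minus_commute abs_of_nonneg abs_of_nonpos diff_ge_0_iff_ge diff_le_0_iff_le linear minus_diff_eq)
qed

text \<open>The combinatorial data of a self-map of the graph with \<open>N\<close> edges. The edge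
  \<open>e\<close> is mapped to the path \<open>e\<^sub>0 e\<^sup>-\<^sup>1 e\<^sub>1 e\<^sup>-\<^sup>1
  \<dots> e\<^sup>-\<^sup>1 e\<^sub>q\<close> with letters \<open>e\<^sub>i = letter e i\<close>, in which
  the inverse of \<open>e\<close> occurs \<open>q\<close> times and every edge occurs \<open>r\<close> times
  as a letter. Modulo a divisor of \<open>q\<close> the resulting chain is \<open>r\<close> times the sum of
  all edges, whatever \<open>e\<close> is.\<close>
locale theta_system =
  fixes N q r :: nat and letter :: "nat \<Rightarrow> nat \<Rightarrow> nat"
  assumes N_pos: "N > 0"
    and letter_less: "\<And>e i. e < N \<Longrightarrow> i \<le> q \<Longrightarrow> letter e i < N"
    and letter_count: "\<And>e h. e < N \<Longrightarrow> h < N \<Longrightarrow> card {i. i \<le> q \<and> letter e i = h} = r"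
begin

definition theta :: "(nat \<times> real) set" where
  "theta = {x. fst x < N \<and> 0 \<le> snd x \<and> snd x \<le> 1 \<and> normal_point x = x}"

lemma theta_snd: "x \<in> theta \<Longrightarrow> 0 \<le> snd x" "x \<in> theta \<Longrightarrow> snd x \<le> 1"
  by (auto simp: theta_def)

lemma normal_in_theta: "fst x < N \<Longrightarrow> 0 \<le> snd x \<Longrightarrow> snd x \<le> 1 \<Longrightarrow> normal_point x \<in> theta"
  using N_pos by (auto simp: theta_def normal_point_def)

sublocale T: Metric_space theta theta_dist
proof
  fix x y z
  show "theta_dist x y = theta_dist y x" by (rule theta_dist_commute)
  assume x: "x \<in> theta" and y: "y \<in> theta"
  show "theta_dist x y = 0 \<longleftrightarrow> x = y"
  proof
    assume 0: "theta_dist x y = 0"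
    then have s: "snd x = snd y" using theta_dist_ge[of x y] theta_snd x y by fastforce
    show "x = y"
    proof (cases "fst x = fst y")
      case True
      with s show ?thesis by (simp add: prod_eq_iff)
    next
      case False
      then have "snd x = 0 \<or> snd x = 1" using 0 s theta_snd[OF y] by (auto simp: theta_dist_def max_def min_def split: if_splits)
      then have "normal_point x = (0, snd x)" "normal_point y = (0, snd y)" using s by (auto simp: normal_point_def)
      then show ?thesis using x y s by (simp add: theta_def)
    qed
  qed (simp add: theta_dist_def)
  assume z: "z \<in> theta"
  show "theta_dist x z \<le> theta_dist x y + theta_dist y z"
    by (rule theta_dist_triangle) (use x y z theta_snd in auto)
next
  show "0 \<le> theta_dist x y" for x y by (simp add: theta_dist_def)
qed

abbreviation "stretch \<equiv> real (2 * q + 1)"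

text \<open>The edge is stretched to length \<open>2 * q + 1\<close>. Segments of even index run forward
  over the letters and segments of odd index run backward over the edge itself.\<close>
definition unfold_edge :: "nat \<times> real \<Rightarrow> nat \<times> real" where
  "unfold_edge x = (let j = nat \<lfloor>stretch * snd x\<rfloor> in
     (if even j then letter (fst x) (j div 2) else fst x, zigzag (stretch * snd x)))"

definition bonding :: "nat \<times> real \<Rightarrow> nat \<times> real" where
  "bonding x = normal_point (unfold_edge x)"

lemma snd_unfold_edge [simp]: "snd (unfold_edge x) = zigzag (stretch * snd x)"
  by (simp add: unfold_edge_def Let_def)

lemma unfold_edge_fst_less:
  assumes "fst x < N" "0 \<le> snd x" "snd x < 1"
  shows "fst (unfold_edge x) < N"
proof -
  have "stretch * snd x < stretch * 1" by (rule mult_strict_left_mono[OF assms(3)]) simp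
  also have "stretch * 1 = of_int (2 * int q + 1)" by simp
  finally have "stretch * snd x < of_int (2 * int q + 1)" .
  then have "\<lfloor>stretch * snd x\<rfloor> < 2 * int q + 1" by (simp only: floor_less_iff)
  then have "nat \<lfloor>stretch * snd x\<rfloor> div 2 \<le> q" by linarith
  then show ?thesis using assms letter_less by (auto simp: unfold_edge_def Let_def)
qed

lemma bonding_in_theta:
  assumes "x \<in> theta"
  shows "bonding x \<in> theta"
proof (cases "snd x = 1")
  case True
  have "zigzag stretch = 1" by (simp add: zigzag_def flip: of_nat_Suc of_nat_mult)
  then show ?thesis using True N_pos by (simp add: bonding_def theta_def normal_point_def)
next
  case False
  then have "snd x < 1" using assms theta_snd[of x] by simp
  then show ?thesis
    unfolding bonding_def using assms zigzag_range
    by (intro normal_in_theta unfold_edge_fst_less) (auto simp: theta_def)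
qed

lemma unfold_edge_lipschitz_same:
  assumes "fst x = fst y" "0 \<le> snd x" "0 \<le> snd y"
  shows "theta_dist (unfold_edge x) (unfold_edge y) \<le> stretch * \<bar>snd x - snd y\<bar>"
proof -
  have main: "theta_dist (unfold_edge x) (unfold_edge y) \<le> stretch * (snd y - snd x)"
    if "snd x \<le> snd y" "fst x = fst y" "0 \<le> snd x" for x y
  proof -
    define a b where "a = stretch * snd x" and "b = stretch * snd y"
    have ab: "a \<le> b" "0 \<le> a" using that by (auto simp: a_def b_def intro: mult_left_mono)
    have diff: "stretch * (snd y - snd x) = b - a" by (simp add: a_def b_def algebra_simps)
    have fl: "\<lfloor>a\<rfloor> \<le> \<lfloor>b\<rfloor>" using ab(1) by (rule floor_mono)
    have fl0: "0 \<le> \<lfloor>a\<rfloor>" using ab by simp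
    have fb0: "0 \<le> \<lfloor>b\<rfloor>" using fl0 fl by linarith
    have fx: "fst (unfold_edge x) = (if even \<lfloor>a\<rfloor> then letter (fst x) (nat \<lfloor>a\<rfloor> div 2) else fst x)"
      using fl0 unfolding unfold_edge_def Let_def a_def[symmetric] by (simp add: even_nat_iff)
    have fy: "fst (unfold_edge y) = (if even \<lfloor>b\<rfloor> then letter (fst x) (nat \<lfloor>b\<rfloor> div 2) else fst x)"
      using fb0 that(2) unfolding unfold_edge_def Let_def b_def[symmetric] by (simp add: even_nat_iff)
    have sx: "snd (unfold_edge x) = zigzag a" "snd (unfold_edge y) = zigzag b" by (simp_all add: a_def b_def)
    consider "\<lfloor>b\<rfloor> = \<lfloor>a\<rfloor>" | "\<lfloor>b\<rfloor> = \<lfloor>a\<rfloor> + 1" | "\<lfloor>b\<rfloor> \<ge> \<lfloor>a\<rfloor> + 2" using fl by linarith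
    then show ?thesis unfolding diff
    proof cases
      case 3
      then have "b - a \<ge> 1" by linarith
      moreover have "theta_dist (unfold_edge x) (unfold_edge y) \<le> 1"
        by (rule theta_dist_le_1) (auto simp: zigzag_range)
      ultimately show "theta_dist (unfold_edge x) (unfold_edge y) \<le> b - a" by linarith
    next
      case 1
      then have "fst (unfold_edge x) = fst (unfold_edge y)" by (simp add: fx fy)
      then show "theta_dist (unfold_edge x) (unfold_edge y) \<le> b - a"
        using zigzag_lipschitz[of a b] ab unfolding theta_dist_def sx by simp
    next
      case 2
      have "a < \<lfloor>a\<rfloor> + 1" "\<lfloor>a\<rfloor> \<le> a" "b < \<lfloor>a\<rfloor> + 2" "\<lfloor>a\<rfloor> + 1 \<le> b" using 2 by linarith+
      moreover have "zigzag a = (if even \<lfloor>a\<rfloor> then a - \<lfloor>a\<rfloor> else \<lfloor>a\<rfloor> + 1 - a)"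
        "zigzag b = (if even \<lfloor>a\<rfloor> then \<lfloor>a\<rfloor> + 2 - b else b - \<lfloor>a\<rfloor> - 1)"
        using 2 by (auto simp: zigzag_def frac_def)
      ultimately have "max 0 (min (zigzag a + zigzag b) (2 - zigzag a - zigzag b)) \<le> b - a"
        using ab by (auto simp: min_def max_def)
      then show "theta_dist (unfold_edge x) (unfold_edge y) \<le> b - a"
        using zigzag_lipschitz[of a b] ab unfolding theta_dist_def sx by auto
    qed
  qed
  show ?thesis
  proof (cases "snd x \<le> snd y")
    case True
    then show ?thesis using main[of x y] assms by simp
  next
    case False
    then show ?thesis using main[of y x] assms by (simp add: theta_dist_commute)
  qed
qed

lemma stretch_odd: "zigzag stretch = 1"
  by (simp add: zigzag_def flip: of_nat_Suc of_nat_mult)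

lemma zigzag_0 [simp]: "zigzag 0 = 0"
  by (simp add: zigzag_def)

text \<open>Two points on different edges are compared through whichever vertex is nearer; the vertices
  are mapped to themselves.\<close>
lemma bonding_lipschitz:
  assumes "x \<in> theta" "y \<in> theta"
  shows "theta_dist (bonding x) (bonding y) \<le> stretch * theta_dist x y"
proof -
  have xy: "0 \<le> snd x" "snd x \<le> 1" "0 \<le> snd y" "snd y \<le> 1" using assms theta_snd by auto
  have "theta_dist (unfold_edge x) (unfold_edge y) \<le> stretch * theta_dist x y"
  proof (cases "fst x = fst y")
    case True
    then show ?thesis using unfold_edge_lipschitz_same[OF True] xy by (simp add: theta_dist_def)
  next
    case False
    have via: "theta_dist (unfold_edge x) (unfold_edge y) \<le> stretch * \<bar>snd x - w\<bar> + stretch * \<bar>snd y - w\<bar>"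
      if w: "w = 0 \<or> w = 1" for w
    proof -
      let ?a = "unfold_edge (fst x, w)" and ?b = "unfold_edge (fst y, w)"
      have w01: "0 \<le> w" "w \<le> 1" using w by auto
      have "snd ?a = w" "snd ?b = w" using w stretch_odd by auto
      then have ab: "theta_dist ?a ?b = 0" using w by (auto simp: theta_dist_def)
      have "theta_dist (unfold_edge x) (unfold_edge y)
          \<le> theta_dist (unfold_edge x) ?a + theta_dist ?a (unfold_edge y)"
        by (rule theta_dist_triangle) (simp_all add: zigzag_range)
      also have "theta_dist ?a (unfold_edge y) \<le> theta_dist ?a ?b + theta_dist ?b (unfold_edge y)"
        by (rule theta_dist_triangle) (simp_all add: zigzag_range)
      also have "theta_dist (unfold_edge x) ?a \<le> stretch * \<bar>snd x - w\<bar>"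
        using unfold_edge_lipschitz_same[of x "(fst x, w)"] xy w01 by simp
      also have "theta_dist ?b (unfold_edge y) \<le> stretch * \<bar>snd y - w\<bar>"
        using unfold_edge_lipschitz_same[of y "(fst y, w)"] xy w01 by (simp add: theta_dist_commute)
      finally show ?thesis using ab by simp
    qed
    have "theta_dist x y = \<bar>snd x - 0\<bar> + \<bar>snd y - 0\<bar> \<or> theta_dist x y = \<bar>snd x - 1\<bar> + \<bar>snd y - 1\<bar>"
      using False xy by (auto simp: theta_dist_def min_def max_def)
    then show ?thesis using via[of 0] via[of 1] by (auto simp: ring_distribs)
  qed
  then show ?thesis unfolding bonding_def
    by (subst theta_dist_normal2) (auto simp: zigzag_range)
qed

abbreviation "Theta \<equiv> T.mtopology"

lemma bonding_continuous: "continuous_map Theta Theta bonding"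
proof -
  have "\<exists>d>0. \<forall>y. y \<in> theta \<and> theta_dist x y < d \<longrightarrow> theta_dist (bonding x) (bonding y) < e"
    if "x \<in> theta" "e > 0" for x e
  proof (intro exI[of _ "e / stretch"] conjI allI impI)
    fix y assume y: "y \<in> theta \<and> theta_dist x y < e / stretch"
    have "stretch * theta_dist x y < e" using y by (simp add: field_simps)
    then show "theta_dist (bonding x) (bonding y) < e"
      using bonding_lipschitz[OF that(1), of y] y by linarith
  qed (use that in simp)
  then show ?thesis
    unfolding T.metric_continuous_map[OF T.Metric_space_axioms] using bonding_in_theta by blast
qed

lemma compact_Theta: "compact_space Theta"
proof -
  have "continuous_map (top_of_set {0..1}) Theta (\<lambda>t. normal_point (e, t))" if "e < N" for e
    unfolding T.continuous_map_to_metric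
  proof (intro ballI allI impI)
    fix t :: real and \<epsilon> :: real assume t: "t \<in> topspace (top_of_set {0..1})" and e: "\<epsilon> > 0"
    show "\<exists>U. openin (top_of_set {0..1}) U \<and> t \<in> U \<and>
        (\<forall>s\<in>U. normal_point (e, s) \<in> T.mball (normal_point (e, t)) \<epsilon>)"
    proof (intro exI[of _ "{0..1} \<inter> ball t \<epsilon>"] conjI ballI)
      fix s assume s: "s \<in> {0..1} \<inter> ball t \<epsilon>"
      have "theta_dist (normal_point (e, t)) (normal_point (e, s)) = \<bar>t - s\<bar>"
        using s t by (subst theta_dist_normal2) (auto simp: theta_dist_def)
      then show "normal_point (e, s) \<in> T.mball (normal_point (e, t)) \<epsilon>"
        using s t that normal_in_theta by (auto simp: dist_real_def)
    qed (use t e in \<open>auto simp: openin_open_Int\<close>)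
  qed
  then have "compactin Theta ((\<lambda>t. normal_point (e, t)) ` {0..1})" if "e < N" for e
    by (rule image_compactin[rotated]) (use that in auto)
  then have "compactin Theta (\<Union>e\<in>{..<N}. (\<lambda>t. normal_point (e, t)) ` {0..1})"
    by (intro compactin_Union) auto
  moreover have "(\<Union>e\<in>{..<N}. (\<lambda>t. normal_point (e, t)) ` {0..1}) = theta"
  proof
    show "theta \<subseteq> (\<Union>e\<in>{..<N}. (\<lambda>t. normal_point (e, t)) ` {0..1})"
    proof
      fix x assume "x \<in> theta"
      then have "x = normal_point (fst x, snd x)" "fst x < N" "snd x \<in> {0..1}" by (auto simp: theta_def)
      then show "x \<in> (\<Union>e\<in>{..<N}. (\<lambda>t. normal_point (e, t)) ` {0..1})" by blast
    qed
    show "(\<Union>e\<in>{..<N}. (\<lambda>t. normal_point (e, t)) ` {0..1}) \<subseteq> theta"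
      using normal_in_theta by fastforce
  qed
  ultimately show ?thesis by (simp add: compact_space_def)
qed

definition threads :: "(nat \<Rightarrow> nat \<times> real) set" where
  "threads = {x. \<forall>n. x n \<in> theta \<and> x n = bonding (x (Suc n))}"

lemma thread_theta: "x \<in> threads \<Longrightarrow> x n \<in> theta"
  unfolding threads_def by blast

lemma thread_bonding: "x \<in> threads \<Longrightarrow> bonding (x (Suc n)) = x n"
  unfolding threads_def by (drule CollectD, drule spec[of _ n], drule conjunct2, erule sym)

lemma threadsI:
  assumes "\<And>n. x n \<in> theta" "\<And>n. bonding (x (Suc n)) = x n"
  shows "x \<in> threads"
  unfolding threads_def by (intro CollectI allI conjI assms(1) assms(2)[symmetric])

definition limit_topology :: "(nat \<Rightarrow> nat \<times> real) topology" where
  "limit_topology = subtopology (product_topology (\<lambda>_. Theta) UNIV) threads"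

lemma topspace_limit: "topspace limit_topology = threads"
  by (auto simp: limit_topology_def PiE_def thread_theta)

lemma proj_continuous: "continuous_map limit_topology Theta (\<lambda>x. x n)"
  unfolding limit_topology_def
  by (intro continuous_map_from_subtopology continuous_map_product_projection) auto

lemma compact_limit: "compact_space limit_topology"
proof -
  let ?P = "product_topology (\<lambda>_::nat. Theta) UNIV"
  have P: "compact_space ?P" using compact_Theta by (simp add: compact_space_product_topology)
  have "closedin ?P {x \<in> topspace ?P. x n = bonding (x (Suc n))}" for n
  proof (rule closedin_continuous_maps_eq[OF T.Hausdorff_space_mtopology])
    show "continuous_map ?P Theta (\<lambda>x. bonding (x (Suc n)))"
      using continuous_map_compose[OF continuous_map_product_projection[of "Suc n" UNIV "\<lambda>_. Theta"] bonding_continuous]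
      by (simp add: o_def)
  qed (rule continuous_map_product_projection, simp)
  then have "closedin ?P (\<Inter>n. {x \<in> topspace ?P. x n = bonding (x (Suc n))})" by (intro closedin_INT) auto
  moreover have "(\<Inter>n. {x \<in> topspace ?P. x n = bonding (x (Suc n))}) = threads"
  proof
    show "(\<Inter>n. {x \<in> topspace ?P. x n = bonding (x (Suc n))}) \<subseteq> threads"
    proof
      fix x assume x: "x \<in> (\<Inter>n. {x \<in> topspace ?P. x n = bonding (x (Suc n))})"
      have "x \<in> topspace ?P" using x by blast
      then have "x n \<in> theta" for n by auto
      moreover have "bonding (x (Suc n)) = x n" for n by (rule sym) (use x in blast)
      ultimately show "x \<in> threads" by (rule threadsI)
    qed
    show "threads \<subseteq> (\<Inter>n. {x \<in> topspace ?P. x n = bonding (x (Suc n))})"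
    proof (intro subsetI INT_I CollectI conjI)
      fix x n assume x: "x \<in> threads"
      show "x n = bonding (x (Suc n))" by (rule thread_bonding[OF x, symmetric])
      show "x \<in> topspace ?P" using thread_theta[OF x] by (auto simp: PiE_iff)
    qed
  qed
  ultimately have "closedin ?P threads" by (simp only:)
  then show ?thesis
    unfolding limit_topology_def using P closedin_compact_space compact_space_subtopology by blast
qed

lemma Hausdorff_limit: "Hausdorff_space limit_topology"
  unfolding limit_topology_def
  by (intro Hausdorff_space_subtopology) (simp add: Hausdorff_space_product_topology T.Hausdorff_space_mtopology)

lemma thread_lipschitz:
  assumes "x \<in> threads" "y \<in> threads" "m \<le> n"
  shows "theta_dist (x m) (y m) \<le> stretch ^ (n - m) * theta_dist (x n) (y n)"
  using assms(3)
proof (induction n rule: dec_induct)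
  case (step n)
  have "theta_dist (x n) (y n) \<le> stretch * theta_dist (x (Suc n)) (y (Suc n))"
    using bonding_lipschitz[of "x (Suc n)" "y (Suc n)"] assms(1,2) by (auto simp: thread_bonding thread_theta)
  then have "stretch ^ (n - m) * theta_dist (x n) (y n)
      \<le> stretch ^ (n - m) * (stretch * theta_dist (x (Suc n)) (y (Suc n)))"
    by (intro mult_left_mono) auto
  with step.IH have "theta_dist (x m) (y m)
      \<le> stretch ^ (n - m) * (stretch * theta_dist (x (Suc n)) (y (Suc n)))" by (rule order_trans)
  also have "\<dots> = stretch ^ (Suc n - m) * theta_dist (x (Suc n)) (y (Suc n))"
    using step.hyps by (simp only: Suc_diff_le power_Suc2 mult.assoc)
  finally show ?case .
qed simp

text \<open>The bonding maps are Lipschitz, so one coordinate of large index controls the finitely many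
  coordinates that define a basic neighbourhood.\<close>
lemma limit_base:
  assumes "openin limit_topology W" "x \<in> W"
  shows "\<exists>n d. d > 0 \<and> (\<forall>y\<in>threads. theta_dist (x n) (y n) < d \<longrightarrow> y \<in> W)"
proof -
  obtain V where V: "openin (product_topology (\<lambda>_::nat. Theta) UNIV) V" "W = V \<inter> threads"
    using assms(1) by (auto simp: limit_topology_def openin_subtopology)
  then obtain B where B: "finite {i. B i \<noteq> theta}" "\<And>i. openin Theta (B i)" "x \<in> Pi\<^sub>E UNIV B" "Pi\<^sub>E UNIV B \<subseteq> V"
    using assms(2) by (auto simp: openin_product_topology_alt)
  have xt: "x \<in> threads" using assms(2) V by auto
  have "\<exists>n d. d > 0 \<and> (\<forall>y\<in>threads. theta_dist (x n) (y n) < d \<longrightarrow> (\<forall>i\<in>F. y i \<in> B i))" if "finite F" for F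
    using that
  proof (induction F)
    case (insert i F)
    then obtain n d where nd: "d > 0" "\<And>y. y \<in> threads \<Longrightarrow> theta_dist (x n) (y n) < d \<Longrightarrow> \<forall>i\<in>F. y i \<in> B i" by auto
    have "x i \<in> B i" using B(3) by auto
    then obtain e where e: "e > 0" "T.mball (x i) e \<subseteq> B i"
      using B(2)[of i] unfolding T.openin_mtopology by blast
    define k where "k = max n i"
    define c where "c = min (d / stretch ^ (k - n)) (e / stretch ^ (k - i))"
    have pos: "stretch ^ j > 0" for j by simp
    show ?case
    proof (intro exI[of _ k] exI[of _ c] conjI ballI impI)
      show "c > 0" unfolding c_def using nd(1) e(1) pos by simp
      fix y j assume y: "y \<in> threads" "theta_dist (x k) (y k) < c" and j: "j \<in> insert i F"
      have "theta_dist (x n) (y n) \<le> stretch ^ (k - n) * theta_dist (x k) (y k)"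
        by (rule thread_lipschitz[OF xt y(1)]) (simp add: k_def)
      also have "\<dots> < d" using y(2) pos[of "k - n"] by (simp add: c_def field_simps)
      finally have 1: "theta_dist (x n) (y n) < d" .
      have "theta_dist (x i) (y i) \<le> stretch ^ (k - i) * theta_dist (x k) (y k)"
        by (rule thread_lipschitz[OF xt y(1)]) (simp add: k_def)
      also have "\<dots> < e" using y(2) pos[of "k - i"] by (simp add: c_def field_simps)
      finally have "y i \<in> T.mball (x i) e" using xt y(1) by (auto simp: thread_theta)
      then have "y i \<in> B i" by (rule subsetD[OF e(2)])
      then show "y j \<in> B j" using j nd(2)[OF y(1) 1] by (cases "j = i") auto
    qed
  next
    case empty
    show ?case by (intro exI[of _ 0] exI[of _ "1 :: real"]) simp
  qed
  from this[OF B(1)] obtain n d where nd': "d > 0 \<and> (\<forall>y\<in>threads. theta_dist (x n) (y n) < d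
      \<longrightarrow> (\<forall>i\<in>{i. B i \<noteq> theta}. y i \<in> B i))" by (elim exE)
  then have nd: "d > 0"
    "\<And>y. y \<in> threads \<Longrightarrow> theta_dist (x n) (y n) < d \<Longrightarrow> \<forall>i\<in>{i. B i \<noteq> theta}. y i \<in> B i" by auto
  have "y \<in> W" if y: "y \<in> threads" "theta_dist (x n) (y n) < d" for y
  proof -
    have "y i \<in> B i" for i using nd(2)[OF y] y(1) by (cases "B i = theta") (auto simp: thread_theta)
    then show ?thesis using B(4) V(2) y(1) by (auto simp: PiE_def)
  qed
  with nd(1) show ?thesis by blast
qed

text \<open>The second segment of each unfolded edge runs backwards over that same edge, so every point
  of an edge has a preimage on the same edge.\<close>
lemma bonding_surj:
  assumes "x \<in> theta" "q \<ge> 1"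
  shows "\<exists>y\<in>theta. bonding y = x"
proof (cases "0 < snd x \<and> snd x < 1")
  case True
  let ?y = "(fst x, (2 - snd x) / stretch)"
  have s: "stretch * snd ?y = 2 - snd x" by simp
  have fl: "\<lfloor>2 - snd x\<rfloor> = 1" using True by linarith
  have "zigzag (2 - snd x) = snd x" by (simp add: zigzag_def frac_def fl)
  moreover have "nat \<lfloor>stretch * snd ?y\<rfloor> = 1" unfolding s fl by simp
  ultimately have "unfold_edge ?y = x" unfolding unfold_edge_def Let_def s by simp
  then have "bonding ?y = x" using assms by (simp add: bonding_def theta_def)
  moreover have "?y \<in> theta"
    using True assms by (auto simp: theta_def normal_point_def field_simps)
  ultimately show ?thesis by blast
next
  case False
  then have "snd x = 0 \<or> snd x = 1" using theta_snd[OF assms(1)] by linarith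
  then have "bonding x = normal_point x"
    using stretch_odd by (auto simp: bonding_def normal_point_def)
  then have "bonding x = x" using assms(1) by (simp add: theta_def)
  then show ?thesis using assms(1) by blast
qed

lemma thread_from:
  assumes "x \<in> theta" "q \<ge> 1"
  shows "\<exists>z\<in>threads. z 0 = x"
proof -
  \<comment> \<open>A thread is built upwards from level zero by choosing preimages.\<close>
  define pre where "pre y = (SOME z. z \<in> theta \<and> bonding z = y)" for y
  have pre: "pre y \<in> theta \<and> bonding (pre y) = y" if "y \<in> theta" for y
    unfolding pre_def by (rule someI_ex) (use bonding_surj[OF that assms(2)] in blast)
  have "(pre ^^ n) x \<in> theta" for n using assms(1) pre by (induction n) auto
  then have "(\<lambda>n. (pre ^^ n) x) \<in> threads" using pre by (intro threadsI) auto
  then show ?thesis by (intro bexI[of _ "\<lambda>n. (pre ^^ n) x"]) auto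
qed

lemma thread_through:
  assumes "x \<in> theta" "q \<ge> 1"
  shows "\<exists>z\<in>threads. z n = x"
proof -
  obtain w where w: "w \<in> threads" "w 0 = x" using thread_from[OF assms] by blast
  define z where "z k = (if n \<le> k then w (k - n) else (bonding ^^ (n - k)) x)" for k
  have "(bonding ^^ k) x \<in> theta" for k using assms(1) bonding_in_theta by (induction k) auto
  moreover have "bonding (z (Suc k)) = z k" for k
  proof (cases "n \<le> k")
    case True
    then show ?thesis using w(1) by (simp add: z_def thread_bonding Suc_diff_le)
  next
    case False
    then have "n - k = Suc (n - Suc k)" by simp
    moreover have "z (Suc k) = (bonding ^^ (n - Suc k)) x" using False w(2) by (auto simp: z_def)
    ultimately show ?thesis using False by (simp add: z_def)
  qed
  ultimately have "z \<in> threads" using w(1) by (intro threadsI) (simp_all add: z_def thread_theta)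
  moreover have "z n = x" by (simp add: z_def w(2))
  ultimately show ?thesis by blast
qed

end

section \<open>Star covers of the limit\<close>

text \<open>A copy of the inverse limit on another type, described by its coordinate maps \<open>pr
  n\<close>.\<close>
locale theta_limit = theta_system N q r letter
  for N q r :: nat and letter :: "nat \<Rightarrow> nat \<Rightarrow> nat" +
  fixes X :: "'a topology" and pr :: "nat \<Rightarrow> 'a \<Rightarrow> nat \<times> real"
  assumes q_pos: "q \<ge> 1"
    and compact_X: "compact_space X"
    and pr_thread: "\<And>x. x \<in> topspace X \<Longrightarrow> (\<lambda>n. pr n x) \<in> threads"
    and pr_continuous: "\<And>n. continuous_map X Theta (pr n)"
    and pr_base: "\<And>W x. openin X W \<Longrightarrow> x \<in> W \<Longrightarrow>
        \<exists>n d. d > 0 \<and> (\<forall>y\<in>topspace X. theta_dist (pr n x) (pr n y) < d \<longrightarrow> y \<in> W)"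
    and pr_onto: "\<And>z. z \<in> threads \<Longrightarrow> \<exists>x\<in>topspace X. \<forall>n. pr n x = z n"
begin

lemma pr_theta: "x \<in> topspace X \<Longrightarrow> pr n x \<in> theta"
  using thread_theta[OF pr_thread] by simp

lemma pr_bonding: "x \<in> topspace X \<Longrightarrow> bonding (pr (Suc n) x) = pr n x"
  using thread_bonding[OF pr_thread] by simp

lemma pr_snd: "x \<in> topspace X \<Longrightarrow> 0 \<le> snd (pr n x)" "x \<in> topspace X \<Longrightarrow> snd (pr n x) \<le> 1"
  using pr_theta theta_snd by auto

lemma pr_fst: "x \<in> topspace X \<Longrightarrow> fst (pr n x) < N"
  using pr_theta[of x n] by (simp add: theta_def)

text \<open>With the edges of the \<open>n\<close>-th graph divided into \<open>M\<close> parts, this is the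
  part of \<open>X\<close> above the open star of the \<open>k\<close>-th division point of the edge
  \<open>e\<close>. The end points belong to all edges, so \<open>e\<close> does not matter for
  them.\<close>
definition star :: "nat \<Rightarrow> nat \<Rightarrow> nat \<Rightarrow> nat \<Rightarrow> 'a set" where
  "star n M e k = {x \<in> topspace X. \<bar>real M * snd (pr n x) - real k\<bar> < 1 \<and>
     (0 < k \<and> k < M \<longrightarrow> fst (pr n x) = e)}"

lemma star_subset: "star n M e k \<subseteq> topspace X"
  by (auto simp: star_def)

lemma star_vertex: "k = 0 \<or> k \<ge> M \<Longrightarrow> star n M e k = star n M e' k"
  by (auto simp: star_def)

lemma star_label: "x \<in> star n M e k \<Longrightarrow> star n M e k = star n M (fst (pr n x)) k"
  by (cases "0 < k \<and> k < M") (auto simp: star_def)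

lemma star_open:
  assumes M: "M \<ge> 1"
  shows "openin X (star n M e k)"
proof -
  define S where "S = {z \<in> theta. \<bar>real M * snd z - real k\<bar> < 1 \<and> (0 < k \<and> k < M \<longrightarrow> fst z = e)}"
  have "openin Theta S"
    unfolding T.openin_mtopology
  proof (intro conjI allI impI)
    fix z assume z: "z \<in> S"
    define d where "d = min ((1 - \<bar>real M * snd z - real k\<bar>) / real M)
        (if 0 < k \<and> k < M then min (snd z) (1 - snd z) else 1)"
    have mid: "0 < snd z \<and> snd z < 1" if "0 < k \<and> k < M"
    proof -
      have a: "\<bar>real M * snd z - real k\<bar> < 1" "real k \<ge> 1" "real k + 1 \<le> real M" using z that by (auto simp: S_def)
      then have "0 < real M * snd z" "real M * snd z < real M * 1" by linarith+
      then show ?thesis using M by (simp add: zero_less_mult_iff)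
    qed
    have d: "d > 0" unfolding d_def using z M mid by (auto simp: S_def)
    have "y \<in> S" if y: "y \<in> T.mball z d" for y
    proof -
      have yt: "y \<in> theta" "z \<in> theta" and dist: "theta_dist z y < d" using y by auto
      have rng: "0 \<le> snd z" "snd z \<le> 1" "0 \<le> snd y" "snd y \<le> 1" using yt theta_snd by auto
      have "\<bar>snd z - snd y\<bar> < (1 - \<bar>real M * snd z - real k\<bar>) / real M"
        using theta_dist_ge[OF rng] dist by (simp add: d_def)
      then have "real M * \<bar>snd z - snd y\<bar> < 1 - \<bar>real M * snd z - real k\<bar>"
        using M by (simp add: field_simps)
      moreover have "real M * \<bar>snd z - snd y\<bar> = \<bar>real M * snd z - real M * snd y\<bar>"
        by (simp add: abs_mult flip: right_diff_distrib)
      ultimately have 1: "\<bar>real M * snd y - real k\<bar> < 1" by linarith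
      have 2: "fst y = e" if k: "0 < k \<and> k < M"
      proof (rule ccontr)
        assume "fst y \<noteq> e"
        moreover have "fst z = e" using z k by (simp add: S_def)
        ultimately have "theta_dist z y = max 0 (min (snd z + snd y) (2 - snd z - snd y))"
          by (simp add: theta_dist_def)
        then have "theta_dist z y \<ge> min (snd z) (1 - snd z)" using rng by linarith
        moreover have "theta_dist z y < min (snd z) (1 - snd z)" using dist k by (simp add: d_def)
        ultimately show False by linarith
      qed
      show ?thesis using 1 2 yt by (simp add: S_def)
    qed
    then show "\<exists>d>0. T.mball z d \<subseteq> S" using d by blast
  qed (auto simp: S_def)
  then have "openin X {x \<in> topspace X. pr n x \<in> S}"
    by (rule openin_continuous_map_preimage[OF pr_continuous])
  moreover have "{x \<in> topspace X. pr n x \<in> S} = star n M e k"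
    using pr_theta by (auto simp: S_def star_def)
  ultimately show ?thesis by simp
qed

definition star_cover :: "nat \<Rightarrow> nat \<Rightarrow> 'a set set" where
  "star_cover n M = {star n M e k | e k. e < N \<and> k \<le> M}"

lemma star_in_cover: "e < N \<Longrightarrow> k \<le> M \<Longrightarrow> star n M e k \<in> star_cover n M"
  by (auto simp: star_cover_def)

lemma point_in_star:
  fixes n M :: nat
  assumes x: "x \<in> topspace X"
  defines "k \<equiv> nat \<lfloor>real M * snd (pr n x)\<rfloor>"
  shows "x \<in> star n M (fst (pr n x)) k" "k \<le> M"
proof -
  have "0 \<le> real M * snd (pr n x)" using pr_snd[OF x] by simp
  then have k: "real k = of_int \<lfloor>real M * snd (pr n x)\<rfloor>" by (simp add: k_def)
  then have "\<bar>real M * snd (pr n x) - real k\<bar> < 1" by linarith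
  then show "x \<in> star n M (fst (pr n x)) k" using x by (simp add: star_def)
  have "real M * snd (pr n x) \<le> real M" using pr_snd[OF x] by (simp add: mult_left_le)
  then have "\<lfloor>real M * snd (pr n x)\<rfloor> \<le> int M" by linarith
  then show "k \<le> M" by (simp add: k_def)
qed

lemma open_cover_star_cover: "M \<ge> 1 \<Longrightarrow> open_cover X (star_cover n M)"
  unfolding open_cover_def
proof (intro conjI ballI equalityI subsetI)
  fix x assume x: "x \<in> topspace X"
  show "x \<in> \<Union> (star_cover n M)"
    by (rule UnionI[OF star_in_cover[OF pr_fst[OF x] point_in_star(2)[OF x]] point_in_star(1)[OF x]])
next
  fix x assume "x \<in> \<Union> (star_cover n M)"
  then show "x \<in> topspace X" by (auto simp: star_cover_def star_def)
qed (auto simp: star_cover_def intro: star_open)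

lemma star_cover_order:
  assumes x: "x \<in> topspace X"
  shows "finite {v \<in> star_cover n M. x \<in> v}" "card {v \<in> star_cover n M. x \<in> v} \<le> 2"
proof -
  let ?k = "nat \<lfloor>real M * snd (pr n x)\<rfloor>" and ?h = "fst (pr n x)"
  have sub: "{v \<in> star_cover n M. x \<in> v} \<subseteq> {star n M ?h ?k, star n M ?h (Suc ?k)}"
  proof
    fix v assume "v \<in> {v \<in> star_cover n M. x \<in> v}"
    then obtain e k where v: "v = star n M e k" "x \<in> star n M e k" by (auto simp: star_cover_def)
    then have "\<bar>real M * snd (pr n x) - real k\<bar> < 1" by (simp add: star_def)
    moreover have "0 \<le> real M * snd (pr n x)" using pr_snd[OF x] by simp
    ultimately have "k = ?k \<or> k = Suc ?k" by linarith
    then show "v \<in> {star n M ?h ?k, star n M ?h (Suc ?k)}" using star_label[OF v(2)] v(1) by auto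
  qed
  then show "finite {v \<in> star_cover n M. x \<in> v}" by (rule finite_subset) simp
  have "card {v \<in> star_cover n M. x \<in> v} \<le> card {star n M ?h ?k, star n M ?h (Suc ?k)}"
    by (rule card_mono[OF _ sub]) simp
  also have "\<dots> \<le> 2" by (simp add: card_insert_if)
  finally show "card {v \<in> star_cover n M. x \<in> v} \<le> 2" .
qed

lemma star_diameter:
  assumes "x \<in> star n M e k" "y \<in> star n M e k" "M \<ge> 1" "k \<le> M"
  shows "theta_dist (pr n x) (pr n y) < 2 / real M"
proof -
  let ?s = "snd (pr n x)" and ?t = "snd (pr n y)"
  have top: "x \<in> topspace X" "y \<in> topspace X" using assms by (auto simp: star_def)
  have b: "\<bar>real M * ?s - real k\<bar> < 1" "\<bar>real M * ?t - real k\<bar> < 1" using assms by (auto simp: star_def)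
  have "real M * theta_dist (pr n x) (pr n y) < 2"
  proof (cases "fst (pr n x) = fst (pr n y)")
    case True
    then have "real M * theta_dist (pr n x) (pr n y) = \<bar>real M * ?s - real M * ?t\<bar>"
      by (simp add: theta_dist_def abs_mult flip: right_diff_distrib)
    then show ?thesis using b by linarith
  next
    case False
    then have k: "k = 0 \<or> k = M" using assms by (auto simp: star_def)
    have "real M * theta_dist (pr n x) (pr n y) = max 0 (min (real M * ?s + real M * ?t) (2 * real M - real M * ?s - real M * ?t))"
      using False assms(3) by (simp add: theta_dist_def max_mult_distrib_left min_mult_distrib_left algebra_simps)
    then show ?thesis using b k by (auto simp: min_def max_def)
  qed
  then show ?thesis using assms(3) by (simp add: field_simps)
qed

lemma pr_dist_mono:
  assumes "x \<in> topspace X" "y \<in> topspace X" "m \<le> n"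
  shows "theta_dist (pr m x) (pr m y) \<le> stretch ^ (n - m) * theta_dist (pr n x) (pr n y)"
  using thread_lipschitz[OF pr_thread[OF assms(1)] pr_thread[OF assms(2)] assms(3)] .

text \<open>By compactness finitely many coordinates, hence a single one, suffice for the whole cover, and
  stars of a fine subdivision are small in that coordinate.\<close>
lemma stars_refine:
  assumes U: "open_cover X U"
  shows "\<exists>n M. M \<ge> 1 \<and> (\<forall>v\<in>star_cover n M. \<exists>u\<in>U. v \<subseteq> u)"
proof -
  have "\<exists>n d. \<exists>u\<in>U. d > 0 \<and> (\<forall>y\<in>topspace X. theta_dist (pr n x) (pr n y) < d \<longrightarrow> y \<in> u)"
    if x: "x \<in> topspace X" for x
  proof -
    obtain u where "u \<in> U" "x \<in> u" using U x by (auto simp: open_cover_def)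
    moreover from this have "openin X u" using U by (auto simp: open_cover_def)
    ultimately show ?thesis using pr_base[of u x] by fast
  qed
  then obtain n d u where ndu: "\<And>x. x \<in> topspace X \<Longrightarrow> u x \<in> U \<and> d x > (0::real) \<and>
      (\<forall>y\<in>topspace X. theta_dist (pr (n x) x) (pr (n x) y) < d x \<longrightarrow> y \<in> u x)" by metis
  define B where "B x = {y \<in> topspace X. pr (n x) y \<in> T.mball (pr (n x) x) (d x / 2)}" for x
  have B_open: "openin X (B x)" for x
    unfolding B_def by (rule openin_continuous_map_preimage[OF pr_continuous T.openin_mball])
  have xB: "x \<in> B x" if "x \<in> topspace X" for x
    using that ndu[OF that] pr_theta by (simp add: B_def)
  obtain F where F: "finite F" "F \<subseteq> B ` topspace X" "topspace X \<subseteq> \<Union> F"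
    using compact_X[unfolded compact_space_alt, rule_format, of "B ` topspace X"] B_open xB by blast
  then obtain P where P: "finite P" "P \<subseteq> topspace X" "F = B ` P" by (meson finite_subset_image)
  define m where "m = Max (insert 0 (n ` P))"
  define c where "c = Min (insert 1 ((\<lambda>x. d x / 2 / stretch ^ (m - n x)) ` P))"
  have m: "n x \<le> m" if "x \<in> P" for x unfolding m_def using P(1) that by (intro Max_ge) auto
  have c: "c > 0" unfolding c_def using P(1,2) ndu by (subst Min_gr_iff) auto
  have cx: "c \<le> d x / 2 / stretch ^ (m - n x)" if "x \<in> P" for x
    unfolding c_def using P(1) that by (intro Min_le) auto
  obtain M where M: "real M > max 1 (2 / c)" using reals_Archimedean2 by blast
  then have M1: "M \<ge> 1" "2 / real M < c" using c by (auto simp: field_simps)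
  have "\<exists>u\<in>U. v \<subseteq> u" if v: "v \<in> star_cover m M" for v
  proof (cases "v = {}")
    case True
    have "\<exists>x. x \<in> topspace X" using pr_onto thread_from[OF normal_in_theta[of "(0, 0)"] q_pos] N_pos by fastforce
    then show ?thesis using U True by (auto simp: open_cover_def)
  next
    case False
    then obtain y where y: "y \<in> v" by blast
    obtain e k where ek: "v = star m M e k" "k \<le> M" using v by (auto simp: star_cover_def)
    have yt: "y \<in> topspace X" using y ek by (auto simp: star_def)
    then obtain x where x: "x \<in> P" "y \<in> B x" using F(3) P(3) by blast
    then have xt: "x \<in> topspace X" using P(2) by blast
    have "z \<in> u x" if z: "z \<in> v" for z
    proof -
      have zt: "z \<in> topspace X" using z ek by (auto simp: star_def)
      have "theta_dist (pr m y) (pr m z) < c"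
        using star_diameter[of y m M e k z] y z ek M1 by simp
      then have "theta_dist (pr m y) (pr m z) < d x / 2 / stretch ^ (m - n x)" using cx[OF x(1)] by linarith
      then have "stretch ^ (m - n x) * theta_dist (pr m y) (pr m z) < d x / 2"
        by (subst (asm) pos_less_divide_eq) (auto simp: mult.commute)
      then have "theta_dist (pr (n x) y) (pr (n x) z) < d x / 2"
        using pr_dist_mono[OF yt zt m[OF x(1)]] by linarith
      moreover have "theta_dist (pr (n x) x) (pr (n x) y) < d x / 2" using x(2) by (simp add: B_def)
      moreover have "theta_dist (pr (n x) x) (pr (n x) z)
          \<le> theta_dist (pr (n x) x) (pr (n x) y) + theta_dist (pr (n x) y) (pr (n x) z)"
        by (rule T.triangle) (use pr_theta xt yt zt in auto)
      ultimately have "theta_dist (pr (n x) x) (pr (n x) z) < d x" by linarith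
      then show ?thesis using ndu[OF xt] zt by blast
    qed
    then show ?thesis using ndu[OF xt] by blast
  qed
  then show ?thesis using M1(1) by blast
qed

lemma star_consecutive:
  assumes "e < N" "k < M"
  shows "star n M e k \<inter> star n M e (Suc k) \<noteq> {}"
proof -
  let ?t = "(real k + 1 / 2) / real M"
  have M: "real M > 0" using assms by simp
  have t: "0 < ?t" "?t < 1" using assms by (auto simp: field_simps)
  have "real k + 1 \<le> real M" using assms(2) by linarith
  then have "?t < 1" using M by (simp add: field_simps)
  then have "(e, ?t) \<in> theta" using assms t by (simp add: theta_def normal_point_def)
  then obtain z where z: "z \<in> threads" "z n = (e, ?t)" using thread_through[OF _ q_pos] by blast
  then obtain x where x: "x \<in> topspace X" "pr n x = (e, ?t)" using pr_onto[OF z(1)] by fastforce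
  have "real M * ?t = real k + 1 / 2" using M by simp
  then have "x \<in> star n M e k \<inter> star n M e (Suc k)" using x by (simp add: star_def)
  then show ?thesis by blast
qed

lemma X_nonempty: "topspace X \<noteq> {}"
  using star_consecutive[OF N_pos, of 0 1 0] star_subset by fastforce

text \<open>Consecutive stars on an edge meet and all edges have a common end, so if every star lies in one
  of two disjoint sets, all stars lie in the same one.\<close>
lemma connected_X: "connected_space X"
proof (rule ccontr)
  assume "\<not> connected_space X"
  then obtain P R where PR: "openin X P" "openin X R" "topspace X \<subseteq> P \<union> R" "P \<inter> R = {}" "P \<noteq> {}" "R \<noteq> {}"
    unfolding connected_space_def by blast
  then have "open_cover X {P, R}" by (auto simp: open_cover_def dest: openin_subset)
  then obtain n M where nM: "M \<ge> 1" "\<And>v. v \<in> star_cover n M \<Longrightarrow> v \<subseteq> P \<or> v \<subseteq> R"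
    using stars_refine[of "{P, R}"] by blast
  \<comment> \<open>The set that contains the star of the common end \<open>0\<close> contains all stars.\<close>
  have main: "\<Union> (star_cover n M) \<subseteq> A"
    if A: "star n M 0 0 \<subseteq> A" "A \<inter> B = {}" "\<And>v. v \<in> star_cover n M \<Longrightarrow> v \<subseteq> A \<or> v \<subseteq> B" for A B
  proof -
    have "star n M e k \<subseteq> A" if e: "e < N" and k: "k \<le> M" for e k
      using k
    proof (induction k)
      case 0
      then show ?case using A(1) star_vertex[of 0 M n e 0] by simp
    next
      case (Suc k)
      then have "star n M e k \<subseteq> A" "star n M e k \<inter> star n M e (Suc k) \<noteq> {}"
        using star_consecutive[OF e] by auto
      moreover have "star n M e (Suc k) \<subseteq> A \<or> star n M e (Suc k) \<subseteq> B"
        by (rule A(3)[OF star_in_cover[OF e Suc.prems]])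
      ultimately show ?case using A(2) by blast
    qed
    then show ?thesis by (auto simp: star_cover_def)
  qed
  have "\<Union> (star_cover n M) = topspace X" using open_cover_star_cover[OF nM(1)] by (simp add: open_cover_def)
  moreover have "star n M 0 0 \<subseteq> P \<or> star n M 0 0 \<subseteq> R" by (rule nM(2)[OF star_in_cover[OF N_pos]]) simp
  ultimately have "topspace X \<subseteq> P \<or> topspace X \<subseteq> R"
    using main[of P R] main[of R P] nM(2) PR(4) by (metis inf_commute)
  then show False using PR by (auto dest!: openin_subset)
qed

end

section \<open>Acyclicity of the limit\<close>

lemma zigzag_quotient:
  assumes "M \<ge> 1"
  shows "real M * zigzag (real k / real M)
    = real (if even (k div M) then k mod M else M - k mod M)"
proof -
  have fl: "\<lfloor>real k / real M\<rfloor> = int (k div M)"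
    by (simp add: floor_divide_of_nat_eq)
  have "real k = real M * real (k div M) + real (k mod M)"
    by (metis mult_div_mod_eq of_nat_add of_nat_mult)
  then have "real M * frac (real k / real M) = real (k mod M)"
  proof -
    have "real M * frac (real k / real M) = real k - real M * real (k div M)"
      using assms by (simp add: frac_def fl right_diff_distrib)
    then show ?thesis using \<open>real k = real M * real (k div M) + real (k mod M)\<close> by linarith
  qed
  moreover have "k mod M \<le> M" using assms by (simp add: less_imp_le)
  ultimately show ?thesis using assms
    by (auto simp: zigzag_def fl right_diff_distrib)
qed

lemma alternating_sum:
  fixes a :: "nat \<Rightarrow> int"
  shows "(\<Sum>j<2 * q + 1. if even j then a (j div 2) else - c) = (\<Sum>i\<le>q. a i) - int q * c"
proof (induction q)
  case (Suc q)
  have "{..<2 * Suc q + 1} = insert (2 * q + 2) (insert (2 * q + 1) {..<2 * q + 1})" by auto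
  then show ?case using Suc by (simp add: algebra_simps)
qed simp

context theta_limit
begin

text \<open>The division point to which the bonding map sends the \<open>k\<close>-th division point of the
  edge \<open>e\<close>, when the edges of the source are divided into \<open>(2 * q + 1) * M\<close>
  parts.\<close>
definition fold_index :: "nat \<Rightarrow> nat \<Rightarrow> nat \<Rightarrow> nat \<times> nat" where
  "fold_index M e k = (if even (k div M) then (letter e (k div M div 2), k mod M) else (e, M - k mod M))"

abbreviation "folded_star n M e k \<equiv> star n M (fst (fold_index M e k)) (snd (fold_index M e k))"

lemma star_fold:
  assumes M: "M \<ge> 1" and k: "k \<le> (2 * q + 1) * M"
  shows "star (Suc n) ((2 * q + 1) * M) e k \<subseteq> folded_star n M e k"
proof
  let ?L = "(2 * q + 1) * M"
  fix x assume x: "x \<in> star (Suc n) ?L e k"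
  then have top: "x \<in> topspace X" by (simp add: star_def)
  define h t where "h = fst (pr (Suc n) x)" and "t = snd (pr (Suc n) x)"
  define y where "y = stretch * t"
  have prn: "pr n x = bonding (pr (Suc n) x)" using pr_bonding[OF top] by simp
  have snd_n: "snd (pr n x) = zigzag y" by (simp add: prn bonding_def y_def t_def)
  have My: "real ?L * t = real M * y" by (simp add: y_def algebra_simps)
  have yk: "\<bar>real M * y - real k\<bar> < 1" using x by (simp only: star_def mem_Collect_eq t_def[symmetric] My)
  have Mpos: "real M > 0" using M by simp
  have sk: "real (snd (fold_index M e k)) = real M * zigzag (real k / real M)"
    unfolding zigzag_quotient[OF M] fold_index_def by simp
  have "\<bar>real M * snd (pr n x) - real (snd (fold_index M e k))\<bar> = real M * \<bar>zigzag y - zigzag (real k / real M)\<bar>"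
    unfolding snd_n sk using Mpos by (simp add: abs_mult flip: right_diff_distrib)
  also have "\<dots> \<le> real M * \<bar>y - real k / real M\<bar>"
    using Mpos zigzag_lipschitz by (intro mult_left_mono) auto
  also have "\<dots> = \<bar>real M * y - real k\<bar>"
    using Mpos by (simp add: abs_mult_pos' right_diff_distrib flip: abs_mult_pos)
  finally have near: "\<bar>real M * snd (pr n x) - real (snd (fold_index M e k))\<bar> < 1" using yk by linarith
  have label: "fst (pr n x) = fst (fold_index M e k)"
    if s: "0 < snd (fold_index M e k) \<and> snd (fold_index M e k) < M"
  proof -
    define j where "j = k div M"
    have s0: "0 < k mod M" using s by (auto simp: fold_index_def split: if_splits)
    have sM: "k mod M < M" using M by simp
    have kj: "k = j * M + k mod M" by (simp add: j_def)
    have "k \<noteq> 0" "k \<noteq> ?L" using s0 by (intro notI; simp)+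
    then have he: "h = e" using x k by (simp add: star_def h_def)
    have "real k = real M * real j + real (k mod M)" using kj by (metis of_nat_add of_nat_mult mult.commute)
    moreover have "real (k mod M) \<ge> 1" "real (k mod M) + 1 \<le> real M" using s0 sM by linarith+
    ultimately have "real M * real j < real M * y" "real M * y < real M * real j + real M"
      using yk by linarith+
    then have "real M * real j < real M * y" "real M * y < real M * (real j + 1)"
      by (simp_all only: distrib_left mult_1_right)
    then have y: "real j < y" "y < real j + 1" using Mpos by simp_all
    then have fl: "\<lfloor>y\<rfloor> = int j" by linarith
    then have "0 < zigzag y" "zigzag y < 1" using y by (auto simp: zigzag_def frac_def)
    then have "pr n x = unfold_edge (pr (Suc n) x)"
      unfolding prn bonding_def normal_point_def by (simp add: y_def t_def)
    also have "fst \<dots> = (if even j then letter h (j div 2) else h)"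
      unfolding unfold_edge_def Let_def t_def[symmetric] y_def[symmetric] fl h_def by simp
    finally show ?thesis unfolding fold_index_def j_def[symmetric] he by simp
  qed
  show "x \<in> folded_star n M e k" using top near label by (simp add: star_def)
qed

lemma fold_index_bounds:
  assumes "M \<ge> 1" "e < N" "k \<le> (2 * q + 1) * M"
  shows "fst (fold_index M e k) < N" "snd (fold_index M e k) \<le> M"
proof -
  have "k div M \<le> 2 * q + 1" using assms(1,3) by (metis div_le_mono nonzero_mult_div_cancel_right not_one_le_zero)
  then have "k div M div 2 \<le> q" by linarith
  then show "fst (fold_index M e k) < N" using assms letter_less by (auto simp: fold_index_def)
  show "snd (fold_index M e k) \<le> M" using assms(1) by (auto simp: fold_index_def less_imp_le)
qed

lemma folded_star_segment:
  assumes M: "M \<ge> 1" and s: "s \<le> M"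
  shows "folded_star n M e (j * M + s) = (if even j then star n M (letter e (j div 2)) s else star n M e (M - s))"
proof (cases "s = M")
  case True
  have "j * M + M = Suc j * M" by simp
  then have "fold_index M e (j * M + s) = (if even j then (e, M) else (letter e (Suc j div 2), 0))"
    using M True by (simp add: fold_index_def del: mult_Suc)
  then show ?thesis
    using star_vertex[of M M n e "letter e (j div 2)"] star_vertex[of 0 M n e "letter e (Suc j div 2)"] True by simp
next
  case False
  then have "(j * M + s) div M = j" "(j * M + s) mod M = s" using s M by auto
  then show ?thesis by (simp add: fold_index_def)
qed

text \<open>Each edge of the finer graph runs forward over its letters, which cover every edge equally
  often, and backward over itself a number of times divisible by \<open>p\<close>. So all edges acquire the same
  total value modulo \<open>p\<close>, and the partial sums along the edges agree at the second vertex: they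
  form a potential.\<close>
lemma trivializing_refinement_exists:
  assumes p: "prime p" and pq: "p dvd q" and U: "open_cover X U"
  shows "\<exists>V \<rho>. mod_p_coefficients.trivializing_refinement p X U V \<rho>"
proof -
  interpret mod_p_coefficients p by unfold_locales (rule p)
  obtain n M where M: "M \<ge> 1" and fine: "\<forall>v\<in>star_cover n M. \<exists>u\<in>U. v \<subseteq> u"
    using stars_refine[OF U] by blast
  define into where "into v = (SOME u. u \<in> U \<and> v \<subseteq> u)" for v
  have into: "into v \<in> U \<and> v \<subseteq> into v" if "v \<in> star_cover n M" for v
    unfolding into_def by (rule someI_ex) (use fine that in blast)
  let ?L = "(2 * q + 1) * M"
  let ?n = "Suc n"
  define V where "V = star_cover ?n ?L"
  define ind where "ind v = (SOME ek. v = star ?n ?L (fst ek) (snd ek) \<and> fst ek < N \<and> snd ek \<le> ?L)" for v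
  have ind: "v = star ?n ?L (fst (ind v)) (snd (ind v)) \<and> fst (ind v) < N \<and> snd (ind v) \<le> ?L"
    if "v \<in> V" for v
    unfolding ind_def by (rule someI_ex) (use that in \<open>auto simp: V_def star_cover_def\<close>)
  define sf where "sf e k = folded_star n M e k" for e k
  have sf_cover: "sf e k \<in> star_cover n M" if "e < N" "k \<le> ?L" for e k
    unfolding sf_def by (intro star_in_cover fold_index_bounds M that)
  have sub_sf: "star ?n ?L e k \<subseteq> sf e k" if "k \<le> ?L" for e k
    unfolding sf_def by (rule star_fold[OF M that])
  define \<rho> where "\<rho> v = into (sf (fst (ind v)) (snd (ind v)))" for v
  have L1: "?L \<ge> 1" using M by simp
  have cov: "open_cover X V" unfolding V_def by (rule open_cover_star_cover[OF L1])
  have ref: "refinement_map V U \<rho>"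
    unfolding refinement_map_def
  proof
    fix v assume v: "v \<in> V"
    note i = ind[OF v]
    have "sf (fst (ind v)) (snd (ind v)) \<in> star_cover n M" using sf_cover i by blast
    moreover have "v \<subseteq> sf (fst (ind v)) (snd (ind v))" using i sub_sf by metis
    ultimately show "\<rho> v \<in> U \<and> v \<subseteq> \<rho> v" unfolding \<rho>_def using into by blast
  qed
  have pot: "\<exists>g. \<forall>v\<in>V. \<forall>w\<in>V. v \<inter> w \<noteq> {} \<longrightarrow> [c (\<rho> v) (\<rho> w) = g w - g v] (mod int p)"
    if c: "\<forall>u\<in>U. \<forall>v\<in>U. \<forall>w\<in>U. u \<inter> v \<inter> w \<noteq> {} \<longrightarrow> [c u v + c v w = c u w] (mod int p)"
    for c :: "'a set \<Rightarrow> 'a set \<Rightarrow> int"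
  proof -
    define cc where "cc v w = c (into v) (into w)" for v w
    have coc: "[cc u v + cc v w = cc u w] (mod int p)"
      if "u \<in> star_cover n M" "v \<in> star_cover n M" "w \<in> star_cover n M" "u \<inter> v \<inter> w \<noteq> {}" for u v w
      unfolding cc_def
    proof (rule c[rule_format])
      show "into u \<inter> into v \<inter> into w \<noteq> {}" using into that by blast
    qed (use into that in auto)
    have cc0: "[cc v v = 0] (mod int p)" if "v \<in> star_cover n M" "v \<noteq> {}" for v
    proof -
      have "[cc v v + cc v v = cc v v + 0] (mod int p)" using coc[of v v v] that by simp
      then show ?thesis by (simp only: cong_add_lcancel)
    qed
    have anti: "[cc v w = - cc w v] (mod int p)"
      if "v \<in> star_cover n M" "w \<in> star_cover n M" "v \<inter> w \<noteq> {}" for v w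
    proof -
      have "[cc v w + cc w v = cc v v] (mod int p)" using coc[of v w v] that by (simp add: Int_ac)
      moreover have "[cc v v = 0] (mod int p)" by (rule cc0) (use that in auto)
      ultimately have "[cc v w + cc w v = 0] (mod int p)" by (rule cong_trans)
      then show ?thesis by (simp add: cong_iff_dvd_diff)
    qed
    define a where "a e k = cc (star n M e k) (star n M e (Suc k))" for e k
    define total where "total e = (\<Sum>k<M. a e k)" for e
    define b where "b e k = cc (sf e k) (sf e (Suc k))" for e k
    define G where "G e k = (\<Sum>i<k. b e i)" for e k
    define K where "K = (\<Sum>h<N. int r * total h)"
    have b_even: "b e (j * M + s) = a (letter e (j div 2)) s" if "even j" "s < M" for e j s
      using folded_star_segment[OF M, of s n e j] folded_star_segment[OF M, of "Suc s" n e j] that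
      by (simp add: b_def sf_def a_def)
    have b_odd: "[b e (j * M + s) = - a e (M - Suc s)] (mod int p)" if "odd j" "s < M" "e < N" for e j s
    proof -
      have eq: "b e (j * M + s) = cc (star n M e (M - s)) (star n M e (M - Suc s))"
        using folded_star_segment[OF M, of s n e j] folded_star_segment[OF M, of "Suc s" n e j] that
        by (simp add: b_def sf_def)
      have MS: "M - s = Suc (M - Suc s)" using that by simp
      show ?thesis unfolding eq a_def MS
        by (rule anti) (use star_consecutive[of e "M - Suc s" M n] that in \<open>auto intro: star_in_cover\<close>)
    qed
    have seg: "[(\<Sum>s<M. b e (j * M + s)) = (if even j then total (letter e (j div 2)) else - total e)] (mod int p)"
      if "e < N" for e j
    proof (cases "even j")
      case True
      then show ?thesis by (simp add: total_def b_even)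
    next
      case False
      have "[(\<Sum>s<M. b e (j * M + s)) = (\<Sum>s<M. - a e (M - Suc s))] (mod int p)"
        by (rule cong_sum) (use b_odd False that in auto)
      also have "(\<Sum>s<M. - a e (M - Suc s)) = - total e"
        by (simp add: total_def sum_negf sum.nat_diff_reindex)
      finally show ?thesis using False by simp
    qed
    have letters: "(\<Sum>i\<le>q. total (letter e i)) = K" if e: "e < N" for e
    proof -
      have "(\<Sum>i\<le>q. total (letter e i)) = (\<Sum>h<N. \<Sum>i | i \<in> {..q} \<and> letter e i = h. total (letter e i))"
        by (rule sum.group[symmetric]) (use letter_less e in auto)
      also have "\<dots> = (\<Sum>h<N. int r * total h)"
      proof (rule sum.cong)
        fix h assume h: "h \<in> {..<N}"
        have "(\<Sum>i | i \<in> {..q} \<and> letter e i = h. total (letter e i)) = (\<Sum>i | i \<le> q \<and> letter e i = h. total h)"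
          by (rule sum.cong) auto
        then show "(\<Sum>i | i \<in> {..q} \<and> letter e i = h. total (letter e i)) = int r * total h"
          using letter_count[OF e, of h] h by simp
      qed simp
      finally show ?thesis by (simp add: K_def)
    qed
    have G_end: "[G e ?L = K] (mod int p)" if e: "e < N" for e
    proof -
      have "G e ?L = (\<Sum>j<2 * q + 1. sum (b e) {j * M..<j * M + M})"
        unfolding G_def by (rule sum.nat_group[symmetric])
      also have "\<dots> = (\<Sum>j<2 * q + 1. \<Sum>s<M. b e (j * M + s))"
      proof (rule sum.cong)
        fix j
        show "sum (b e) {j * M..<j * M + M} = (\<Sum>s<M. b e (j * M + s))"
          using sum.shift_bounds_nat_ivl[of "b e" 0 "j * M" M] by (simp add: atLeast0LessThan add.commute)
      qed simp
      finally have "[G e ?L = (\<Sum>j<2 * q + 1. if even j then total (letter e (j div 2)) else - total e)] (mod int p)"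
        using cong_sum[of "{..<2 * q + 1}" "\<lambda>j. \<Sum>s<M. b e (j * M + s)"] seg[OF e] by presburger
      also have "(\<Sum>j<2 * q + 1. if even j then total (letter e (j div 2)) else - total e) = K - int q * total e"
        by (subst alternating_sum) (simp add: letters[OF e])
      also have "[K - int q * total e = K] (mod int p)"
        using pq by (simp add: cong_iff_dvd_diff)
      finally show ?thesis .
    qed
    define g where "g v = G (fst (ind v)) (snd (ind v))" for v
    have "[c (\<rho> v) (\<rho> w) = g w - g v] (mod int p)" if v: "v \<in> V" and w: "w \<in> V" and vw: "v \<inter> w \<noteq> {}" for v w
    proof -
      obtain x where x: "x \<in> v" "x \<in> w" using vw by blast
      define h where "h = fst (pr ?n x)"
      have top: "x \<in> topspace X" using x(1) ind[OF v] star_subset by blast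
      have h: "h < N" unfolding h_def by (rule pr_fst[OF top])
      have move: "sf (fst (ind u)) (snd (ind u)) = sf h (snd (ind u)) \<and> [g u = G h (snd (ind u))] (mod int p)
          \<and> \<bar>real ?L * snd (pr ?n x) - real (snd (ind u))\<bar> < 1 \<and> x \<in> sf h (snd (ind u)) \<and> snd (ind u) \<le> ?L"
        if u: "u \<in> V" "x \<in> u" for u
      proof -
        define e k where "e = fst (ind u)" and "k = snd (ind u)"
        have ek: "u = star ?n ?L e k" "e < N" "k \<le> ?L" using ind[OF u(1)] by (auto simp: e_def k_def)
        have xs: "x \<in> star ?n ?L e k" using u ek by simp
        have 1: "sf e k = sf h k \<and> [G e k = G h k] (mod int p)"
        proof -
          consider "0 < k \<and> k < ?L" | "k = 0" | "k = ?L" using ek(3) by linarith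
          then show ?thesis
          proof cases
            case 1
            then have "e = h" using xs by (simp add: star_def h_def)
            then show ?thesis by simp
          next
            case 2
            then show ?thesis using star_vertex[of 0 M n "letter e 0" "letter h 0"]
              by (simp add: G_def sf_def fold_index_def)
          next
            case 3
            have "sf e' ?L = star n M e' M" for e'
              using M by (simp add: sf_def fold_index_def del: mult_Suc)
            then have "sf e k = sf h k" using 3 star_vertex[of M M n e h] by simp
            then show ?thesis using G_end[OF ek(2)] G_end[OF h] 3 by (auto intro: cong_trans cong_sym)
          qed
        qed
        have "x \<in> sf e k" using xs sub_sf[OF ek(3)] by blast
        then show ?thesis using 1 xs ek(3) unfolding g_def e_def[symmetric] k_def[symmetric]
          by (auto simp: star_def)
      qed
      define k l where "k = snd (ind v)" and "l = snd (ind w)"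
      note mv = move[OF v x(1), folded k_def] and mw = move[OF w x(2), folded l_def]
      have "cc (sf h k) (sf h l) = c (\<rho> v) (\<rho> w)"
        using mv mw by (simp add: cc_def \<rho>_def k_def l_def)
      moreover have "[cc (sf h k) (sf h l) = G h l - G h k] (mod int p)"
      proof -
        have cks: "sf h k \<in> star_cover n M" "sf h l \<in> star_cover n M" using sf_cover[OF h] mv mw by auto
        have "\<bar>real k - real l\<bar> < 2" using mv mw by linarith
        then consider "k = l" | "l = Suc k" | "k = Suc l" by linarith
        then show ?thesis
        proof cases
          case 1
          then show ?thesis using cc0[OF cks(1)] mv by auto
        next
          case 2
          then show ?thesis by (simp add: G_def b_def)
        next
          case 3
          have "[cc (sf h k) (sf h l) = - cc (sf h l) (sf h k)] (mod int p)"
            by (rule anti[OF cks]) (use mv mw in auto)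
          then show ?thesis using 3 by (simp add: G_def b_def)
        qed
      qed
      moreover have "[G h l - G h k = g w - g v] (mod int p)"
        by (rule cong_diff) (use mv mw cong_sym in auto)
      ultimately show ?thesis by (metis cong_trans)
    qed
    then show ?thesis by blast
  qed
  have "trivializing_refinement X U V \<rho>"
    unfolding trivializing_refinement_def
  proof (intro conjI cov ref)
    show "\<forall>x\<in>topspace X. finite {v \<in> V. x \<in> v} \<and> card {v \<in> V. x \<in> v} \<le> 2"
      unfolding V_def using star_cover_order by blast
    show "\<forall>c. (\<forall>u\<in>U. \<forall>v\<in>U. \<forall>w\<in>U. u \<inter> v \<inter> w \<noteq> {} \<longrightarrow> [c u v + c v w = c u w] (mod int p)) \<longrightarrow>
        (\<exists>g. \<forall>v\<in>V. \<forall>w\<in>V. v \<inter> w \<noteq> {} \<longrightarrow> [c (\<rho> v) (\<rho> w) = g w - g v] (mod int p))"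
      by (intro allI impI pot)
  qed
  then show ?thesis by blast
qed

theorem theta_limit_acyclic:
  assumes "prime p" "p dvd q"
  shows "covering_dim_le X 1" "mod_acyclic p X"
proof -
  interpret mod_p_coefficients p by unfold_locales (rule assms)
  show "covering_dim_le X 1" "mod_acyclic p X"
    by (rule one_dim_mod_acyclic[OF connected_X X_nonempty trivializing_refinement_exists[OF assms]]; assumption)+
qed

end

section \<open>Actions of finite quotients on acyclic spaces\<close>

text \<open>A sequence is determined by the rational lower bounds of its real coordinates, together with the
  natural number coordinates, so it is encoded by a set of natural numbers.\<close>
lemma lepoll_nat_sequences: "(UNIV :: (nat \<Rightarrow> nat \<times> real) set) \<lesssim> (UNIV :: real set)"
proof -
  define S where "S x = {to_nat (n, e, c) | n e (c :: rat). fst (x n) = e \<and> of_rat c < snd (x n)}"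
    for x :: "nat \<Rightarrow> nat \<times> real"
  have mem: "to_nat (n, e, c) \<in> S x \<longleftrightarrow> fst (x n) = e \<and> of_rat c < snd (x n)" for x n e c
    by (auto simp: S_def)
  have "x = y" if eq: "S x = S y" for x y
  proof
    fix n
    have iff: "fst (x n) = e \<and> of_rat c < snd (x n) \<longleftrightarrow> fst (y n) = e \<and> of_rat c < snd (y n)" for e c
      using mem[of n e c x] mem[of n e c y] eq by simp
    obtain c where "of_rat c < snd (x n)"
      using of_rat_dense[of "snd (x n) - 1" "snd (x n)"] by auto
    then have "fst (x n) = fst (y n)" using iff[of "fst (x n)" c] by simp
    moreover have "snd (x n) = snd (y n)"
    proof (rule ccontr)
      assume "snd (x n) \<noteq> snd (y n)"
      then consider "snd (x n) < snd (y n)" | "snd (y n) < snd (x n)" by linarith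
      then show False
      proof cases
        case 1
        then obtain c where "snd (x n) < of_rat c" "of_rat c < snd (y n)" using of_rat_dense by blast
        then show False using iff[of "fst (y n)" c] by simp
      next
        case 2
        then obtain c where "snd (y n) < of_rat c" "of_rat c < snd (x n)" using of_rat_dense by blast
        then show False using iff[of "fst (x n)" c] by simp
      qed
    qed
    ultimately show "x n = y n" by (simp add: prod_eq_iff)
  qed
  then have "inj S" by (rule injI)
  then have "(UNIV :: (nat \<Rightarrow> nat \<times> real) set) \<lesssim> (UNIV :: nat set set)" unfolding lepoll_def by blast
  also have "\<dots> \<approx> (UNIV :: real set)" by (rule nat_sets_eqpoll_reals)
  finally show ?thesis .
qed

text \<open>The topology is transported along an injection of the set of threads into the given
  type.\<close>
lemma (in theta_system) theta_limit_exists: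
  assumes big: "(UNIV :: real set) \<lesssim> (UNIV :: 'a set)" and q: "q \<ge> 1"
  shows "\<exists>(X :: 'a topology) pr. theta_limit N q r letter X pr \<and> Hausdorff_space X"
proof -
  have "threads \<lesssim> (UNIV :: 'a set)"
    using lepoll_trans[OF subset_imp_lepoll[OF subset_UNIV] lepoll_trans[OF lepoll_nat_sequences big]] .
  then obtain e :: "(nat \<Rightarrow> nat \<times> real) \<Rightarrow> 'a" where e: "inj_on e threads" unfolding lepoll_def by blast
  define g where "g = inv_into threads e"
  have ge: "g (e z) = z" if "z \<in> threads" for z unfolding g_def using e that by (rule inv_into_f_f)
  define X where "X = pullback_topology (e ` threads) g limit_topology"
  have top: "topspace X = e ` threads"
    unfolding X_def topspace_pullback_topology topspace_limit using ge by auto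
  have g: "g x \<in> threads" "e (g x) = x" if "x \<in> topspace X" for x
    using that ge by (auto simp: top)
  have gc: "continuous_map X limit_topology g"
    unfolding continuous_map_def
  proof (intro conjI allI impI)
    fix U assume U: "openin limit_topology U"
    have "{x \<in> topspace X. g x \<in> U} = g -` U \<inter> e ` threads" by (auto simp: top)
    then show "openin X {x \<in> topspace X. g x \<in> U}" unfolding X_def openin_pullback_topology using U by blast
  qed (use g topspace_limit in auto)
  have ec: "continuous_map limit_topology X e"
    unfolding continuous_map_def
  proof (intro conjI allI impI)
    fix W assume "openin X W"
    then obtain U where U: "openin limit_topology U" "W = g -` U \<inter> e ` threads"
      unfolding X_def openin_pullback_topology by blast
    then have "{z \<in> topspace limit_topology. e z \<in> W} = U"
      using openin_subset[OF U(1)] ge unfolding topspace_limit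
      by (intro equalityI subsetI) (auto, metis)
    then show "openin limit_topology {z \<in> topspace limit_topology. e z \<in> W}" using U by simp
  qed (auto simp: top topspace_limit)
  have "homeomorphic_maps limit_topology X e g"
    unfolding homeomorphic_maps_def using ec gc ge g by (simp add: topspace_limit)
  then have homeo: "limit_topology homeomorphic_space X" unfolding homeomorphic_space_def by blast
  have "theta_limit N q r letter X (\<lambda>n x. g x n)"
  proof
    show "compact_space X" using homeomorphic_compact_space[OF homeo] compact_limit by blast
    show "q \<ge> 1" by (rule q)
    show "(\<lambda>n. g x n) \<in> threads" if "x \<in> topspace X" for x using g[OF that] by simp
    show "continuous_map X Theta (\<lambda>x. g x n)" for n
      using continuous_map_compose[OF gc proj_continuous[of n]] by (simp add: o_def)
    show "\<exists>x\<in>topspace X. \<forall>n. g x n = z n" if "z \<in> threads" for z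
      using that ge by (intro bexI[of _ "e z"]) (auto simp: top)
    fix W x assume W: "openin X W" "x \<in> W"
    have xt: "x \<in> topspace X" using W openin_subset by blast
    have "openin limit_topology {z \<in> topspace limit_topology. e z \<in> W}"
      by (rule openin_continuous_map_preimage[OF ec W(1)])
    moreover have "g x \<in> {z \<in> topspace limit_topology. e z \<in> W}" using g[OF xt] W(2) by (simp add: topspace_limit)
    ultimately obtain n d where "d > 0" "\<forall>y\<in>threads. theta_dist (g x n) (y n) < d
        \<longrightarrow> y \<in> {z \<in> topspace limit_topology. e z \<in> W}" using limit_base by meson
    then have "d > 0 \<and> (\<forall>y\<in>topspace X. theta_dist (g x n) (g y n) < d \<longrightarrow> y \<in> W)" using g by fastforce
    then show "\<exists>n d. d > 0 \<and> (\<forall>y\<in>topspace X. theta_dist (g x n) (g y n) < d \<longrightarrow> y \<in> W)" by blast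
  qed
  moreover have "Hausdorff_space X" using homeomorphic_Hausdorff_space[OF homeo] Hausdorff_limit by blast
  ultimately show ?thesis by blast
qed

text \<open>A permutation action on the edges that is compatible with the letters commutes with the bonding
  map. Since no edge is fixed by the whole group, only the two ends of the graph are.\<close>
locale theta_action = theta_limit N q r letter X pr + group Q
  for N q r :: nat and letter :: "nat \<Rightarrow> nat \<Rightarrow> nat" and X :: "'a topology" and pr
    and Q :: "('g, 'h) monoid_scheme" (structure) +
  fixes \<sigma> :: "'g \<Rightarrow> nat \<Rightarrow> nat"
  assumes Hausdorff_X: "Hausdorff_space X"
    and \<sigma>_less: "\<And>g e. g \<in> carrier Q \<Longrightarrow> e < N \<Longrightarrow> \<sigma> g e < N"
    and \<sigma>_mult: "\<And>g h e. g \<in> carrier Q \<Longrightarrow> h \<in> carrier Q \<Longrightarrow> e < N \<Longrightarrow> \<sigma> (g \<otimes>\<^bsub>Q\<^esub> h) e = \<sigma> g (\<sigma> h e)"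
    and \<sigma>_one: "\<And>e. e < N \<Longrightarrow> \<sigma> \<one>\<^bsub>Q\<^esub> e = e"
    and \<sigma>_letter: "\<And>g e i. g \<in> carrier Q \<Longrightarrow> e < N \<Longrightarrow> i \<le> q \<Longrightarrow> letter (\<sigma> g e) i = \<sigma> g (letter e i)"
    and \<sigma>_moves: "\<And>e. e < N \<Longrightarrow> \<exists>g\<in>carrier Q. \<sigma> g e \<noteq> e"
begin

definition move :: "'g \<Rightarrow> nat \<times> real \<Rightarrow> nat \<times> real" where
  "move g x = normal_point (\<sigma> g (fst x), snd x)"

lemma snd_move [simp]: "snd (move g x) = snd x"
  by (simp add: move_def)

lemma move_theta: "g \<in> carrier Q \<Longrightarrow> x \<in> theta \<Longrightarrow> move g x \<in> theta"
  unfolding move_def by (rule normal_in_theta) (auto simp: theta_def \<sigma>_less)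

lemma move_vertex: "x \<in> theta \<Longrightarrow> \<not> (0 < snd x \<and> snd x < 1) \<Longrightarrow> move g x = x"
  by (auto simp: move_def normal_point_def theta_def)

lemma move_inner: "0 < snd x \<Longrightarrow> snd x < 1 \<Longrightarrow> move g x = (\<sigma> g (fst x), snd x)"
  by (simp add: move_def normal_point_def)

lemma move_mult:
  assumes "g \<in> carrier Q" "h \<in> carrier Q" "x \<in> theta"
  shows "move (g \<otimes>\<^bsub>Q\<^esub> h) x = move g (move h x)"
proof (cases "0 < snd x \<and> snd x < 1")
  case True
  then show ?thesis using assms by (simp add: move_inner \<sigma>_mult theta_def)
next
  case False
  then show ?thesis using assms by (simp add: move_vertex)
qed

lemma move_one: "x \<in> theta \<Longrightarrow> move \<one>\<^bsub>Q\<^esub> x = x"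
  by (simp add: move_def \<sigma>_one theta_def)

lemma \<sigma>_inj:
  assumes g: "g \<in> carrier Q" and e: "e < N" "e' < N" and eq: "\<sigma> g e = \<sigma> g e'"
  shows "e = e'"
proof -
  have "\<sigma> (inv\<^bsub>Q\<^esub> g) (\<sigma> g d) = d" if "d < N" for d
    using \<sigma>_mult[of "inv\<^bsub>Q\<^esub> g" g d] g that \<sigma>_one by simp
  then show ?thesis using e eq by metis
qed

lemma move_isometry:
  assumes g: "g \<in> carrier Q" and x: "x \<in> theta" and y: "y \<in> theta"
  shows "theta_dist (move g x) (move g y) = theta_dist x y"
proof -
  have "theta_dist (move g x) (move g y) = theta_dist (\<sigma> g (fst x), snd x) (\<sigma> g (fst y), snd y)"
    unfolding move_def by (rule theta_dist_normal2) (use theta_snd x y in auto)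
  then show ?thesis using \<sigma>_inj[OF g, of "fst x" "fst y"] x y by (auto simp: theta_dist_def theta_def)
qed

lemma move_bonding:
  assumes g: "g \<in> carrier Q" and x: "x \<in> theta"
  shows "bonding (move g x) = move g (bonding x)"
proof (cases "0 < snd x \<and> snd x < 1")
  case True
  have "stretch * snd x < stretch * 1" by (rule mult_strict_left_mono) (use True in simp_all)
  then have "\<lfloor>stretch * snd x\<rfloor> < 2 * int q + 1" by (simp add: floor_less_iff algebra_simps)
  then have i: "nat \<lfloor>stretch * snd x\<rfloor> div 2 \<le> q" by linarith
  have "fst x < N" using x by (simp add: theta_def)
  then have "unfold_edge (move g x) = (\<sigma> g (fst (unfold_edge x)), snd (unfold_edge x))"
    using True g i \<sigma>_letter by (simp add: move_inner unfold_edge_def Let_def)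
  then show ?thesis by (simp add: bonding_def move_def) (simp add: normal_point_def)
next
  case False
  have "move g (bonding x) = bonding x"
  proof (rule move_vertex[OF bonding_in_theta[OF x]])
    have "snd x = 0 \<or> snd x = 1" using False theta_snd[OF x] by linarith
    then show "\<not> (0 < snd (bonding x) \<and> snd (bonding x) < 1)" using stretch_odd by (auto simp: bonding_def)
  qed
  then show ?thesis using move_vertex[OF x False] by simp
qed

lemma pr_inj:
  assumes "x \<in> topspace X" "y \<in> topspace X" "\<And>n. pr n x = pr n y"
  shows "x = y"
proof (rule ccontr)
  assume "x \<noteq> y"
  then obtain W W' where W: "openin X W" "x \<in> W" "y \<in> W'" "disjnt W W'"
    using Hausdorff_X assms unfolding Hausdorff_space_def by meson
  then obtain n d where nd: "d > 0" "\<forall>z\<in>topspace X. theta_dist (pr n x) (pr n z) < d \<longrightarrow> z \<in> W"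
    using pr_base by meson
  have "theta_dist (pr n x) (pr n y) = 0" using assms(3) by (simp add: theta_dist_def)
  then have "y \<in> W" using nd assms(2) by simp
  then show False using W by (auto simp: disjnt_def)
qed

text \<open>The action on \<open>X\<close> moves each coordinate by \<open>move g\<close>; a point is
  determined by its coordinates because \<open>X\<close> is Hausdorff.\<close>
definition act :: "'g \<Rightarrow> 'a \<Rightarrow> 'a" where
  "act g = (\<lambda>x\<in>topspace X. SOME y. y \<in> topspace X \<and> (\<forall>n. pr n y = move g (pr n x)))"

lemma act:
  assumes g: "g \<in> carrier Q" and x: "x \<in> topspace X"
  shows "act g x \<in> topspace X" "pr n (act g x) = move g (pr n x)"
proof -
  have "(\<lambda>n. move g (pr n x)) \<in> threads"
  proof (rule threadsI)
    show "bonding (move g (pr (Suc n) x)) = move g (pr n x)" for n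
      using move_bonding[OF g pr_theta[OF x]] pr_bonding[OF x] by simp
  qed (rule move_theta[OF g pr_theta[OF x]])
  then have "\<exists>y. y \<in> topspace X \<and> (\<forall>n. pr n y = move g (pr n x))" using pr_onto by blast
  from someI_ex[OF this] show "act g x \<in> topspace X" "pr n (act g x) = move g (pr n x)"
    using x by (auto simp: act_def)
qed

lemma act_mult:
  assumes "g \<in> carrier Q" "h \<in> carrier Q" "x \<in> topspace X"
  shows "act (g \<otimes>\<^bsub>Q\<^esub> h) x = act g (act h x)"
  by (rule pr_inj) (use assms in \<open>auto simp: act move_mult pr_theta\<close>)

lemma act_one: "x \<in> topspace X \<Longrightarrow> act \<one>\<^bsub>Q\<^esub> x = x"
  by (rule pr_inj) (auto simp: act move_one pr_theta)

lemma act_inv: "g \<in> carrier Q \<Longrightarrow> x \<in> topspace X \<Longrightarrow> act (inv\<^bsub>Q\<^esub> g) (act g x) = x"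
  using act_mult[of "inv\<^bsub>Q\<^esub> g" g x] act_one by simp

lemma act_inv': "g \<in> carrier Q \<Longrightarrow> x \<in> topspace X \<Longrightarrow> act g (act (inv\<^bsub>Q\<^esub> g) x) = x"
  using act_mult[of g "inv\<^bsub>Q\<^esub> g" x] act_one by simp

lemma act_continuous:
  assumes g: "g \<in> carrier Q"
  shows "continuous_map X X (act g)"
  unfolding continuous_map_def
proof (intro conjI allI impI)
  fix W assume W: "openin X W"
  show "openin X {x \<in> topspace X. act g x \<in> W}"
  proof (subst openin_subopen, intro ballI)
    fix x assume "x \<in> {x \<in> topspace X. act g x \<in> W}"
    then have x: "x \<in> topspace X" "act g x \<in> W" by auto
    obtain n d where nd: "d > 0" "\<forall>y\<in>topspace X. theta_dist (pr n (act g x)) (pr n y) < d \<longrightarrow> y \<in> W"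
      using pr_base[OF W x(2)] by blast
    let ?B = "{y \<in> topspace X. pr n y \<in> T.mball (pr n x) d}"
    have "openin X ?B" by (rule openin_continuous_map_preimage[OF pr_continuous T.openin_mball])
    moreover have "x \<in> ?B" using x nd(1) pr_theta by simp
    moreover have "act g y \<in> W" if "y \<in> ?B" for y
    proof -
      have "theta_dist (pr n (act g x)) (pr n (act g y)) < d"
        using that x g by (simp add: act move_isometry)
      then show ?thesis using nd(2) act(1)[OF g] that by blast
    qed
    ultimately show "\<exists>T. openin X T \<and> x \<in> T \<and> T \<subseteq> {x \<in> topspace X. act g x \<in> W}"
      by (intro exI[of _ ?B]) auto
  qed
qed (use act g in auto)

lemma act_Bij: "g \<in> carrier Q \<Longrightarrow> act g \<in> Bij (topspace X)"
  unfolding Bij_def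
proof
  assume g: "g \<in> carrier Q"
  show "act g \<in> extensional (topspace X)" by (simp add: act_def)
  show "act g \<in> {f. bij_betw f (topspace X) (topspace X)}"
    using g by (auto simp: act act_inv act_inv' intro!: bij_betw_byWitness[of _ "act (inv\<^bsub>Q\<^esub> g)"])
qed

lemma top_action_act: "top_action Q X act"
  unfolding top_action_def
proof (intro conjI ballI)
  have "act \<in> hom Q (BijGroup (topspace X))"
  proof (rule homI)
    fix g h assume gh: "g \<in> carrier Q" "h \<in> carrier Q"
    have "act (g \<otimes>\<^bsub>Q\<^esub> h) = compose (topspace X) (act g) (act h)"
    proof
      fix x
      show "act (g \<otimes>\<^bsub>Q\<^esub> h) x = compose (topspace X) (act g) (act h) x"
        by (cases "x \<in> topspace X") (auto simp: compose_def act_mult gh, simp add: act_def)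
    qed
    then show "act (g \<otimes>\<^bsub>Q\<^esub> h) = act g \<otimes>\<^bsub>BijGroup (topspace X)\<^esub> act h"
      using gh act_Bij by (simp add: BijGroup_def)
  qed (simp add: BijGroup_def act_Bij)
  then show "group_action Q (topspace X) act"
    by (intro group_action.intro group_hom.intro group_hom_axioms.intro group_BijGroup is_group)
  fix g assume g: "g \<in> carrier Q"
  have "homeomorphic_maps X X (act g) (act (inv\<^bsub>Q\<^esub> g))"
    unfolding homeomorphic_maps_def using g act_continuous act_inv act_inv' by auto
  then show "homeomorphic_map X X (act g)" by (rule homeomorphic_maps_imp_map)
qed

text \<open>The constant threads at the two ends are fixed. Every fixed point lies above one of the ends,
  and the stars of the two ends are disjoint open sets.\<close>
lemma fixed_points_disconnected:
  "\<not> connected_space (subtopology X (fixed_points Q (topspace X) act))"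
proof -
  let ?F = "fixed_points Q (topspace X) act"
  let ?A = "star 0 2 0 0" and ?B = "star 0 2 0 2"
  have const: "(\<lambda>_. (0, t)) \<in> threads" if "t = 0 \<or> t = 1" for t
    using that N_pos stretch_odd
    by (intro threadsI) (auto simp: theta_def normal_point_def bonding_def prod_eq_iff)
  have vertex: "\<exists>x\<in>?F. pr 0 x = (0, t)" if t: "t = 0 \<or> t = 1" for t
  proof -
    obtain x where x: "x \<in> topspace X" "\<forall>n. pr n x = (0, t)" using pr_onto[OF const[OF t]] by auto
    have "act g x = x" if g: "g \<in> carrier Q" for g
      by (rule pr_inj) (use act[OF g x(1)] x t in \<open>auto simp: move_def normal_point_def\<close>)
    then show ?thesis using x by (auto simp: fixed_points_def)
  qed
  obtain x y where x: "x \<in> ?F" "pr 0 x = (0, 0)" and y: "y \<in> ?F" "pr 0 y = (0, 1)"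
    using vertex[of 0] vertex[of 1] by blast
  have top: "topspace (subtopology X ?F) = ?F" by (auto simp: fixed_points_def)
  have cover: "?F \<subseteq> ?A \<union> ?B"
  proof
    fix z assume z: "z \<in> ?F"
    then have zt: "z \<in> topspace X" by (simp add: fixed_points_def)
    have "\<not> (0 < snd (pr 0 z) \<and> snd (pr 0 z) < 1)"
    proof
      assume inner: "0 < snd (pr 0 z) \<and> snd (pr 0 z) < 1"
      obtain g where g: "g \<in> carrier Q" "\<sigma> g (fst (pr 0 z)) \<noteq> fst (pr 0 z)" using \<sigma>_moves[OF pr_fst[OF zt]] by blast
      have "act g z = z" using z g by (simp add: fixed_points_def)
      then have "move g (pr 0 z) = pr 0 z" using act(2)[OF g(1) zt, of 0] by simp
      then show False using g(2) inner by (metis fst_conv move_inner)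
    qed
    then have "snd (pr 0 z) = 0 \<or> snd (pr 0 z) = 1" using pr_snd[OF zt, of 0] by linarith
    then show "z \<in> ?A \<union> ?B" using zt by (auto simp: star_def)
  qed
  have opens: "openin (subtopology X ?F) (?A \<inter> ?F)" "openin (subtopology X ?F) (?B \<inter> ?F)"
    using star_open[of 2] by (auto simp: openin_subtopology)
  have disj: "(?A \<inter> ?F) \<inter> (?B \<inter> ?F) = {}" by (auto simp: star_def)
  have "x \<in> ?A \<inter> ?F" "y \<in> ?B \<inter> ?F" using x y by (auto simp: star_def fixed_points_def)
  then have ne: "?A \<inter> ?F \<noteq> {}" "?B \<inter> ?F \<noteq> {}" by blast+
  have "topspace (subtopology X ?F) \<subseteq> (?A \<inter> ?F) \<union> (?B \<inter> ?F)" using cover top by blast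
  then show ?thesis unfolding connected_space_def using opens disj ne by blast
qed

end

text \<open>The edges are labelled by the elements of the finite quotient, which acts by left
  multiplication. The letters of the edge \<open>e\<close> are the products \<open>e f\<close>, with
  \<open>f\<close> running through the quotient twice; this is equivariant, and every edge occurs twice.
  Running through it only once would give \<open>q = N - 1\<close>, which has no prime divisor for a
  quotient of order two.\<close>
theorem finite_quotient_moves_acyclic_space:
  fixes Q :: "('g, 'h) monoid_scheme"
  assumes big: "(UNIV :: real set) \<lesssim> (UNIV :: 'a set)"
    and H: "H \<lhd> Q" and fin: "finite (carrier (Q Mod H))" and proper: "H \<noteq> carrier Q"
  shows "\<exists>p (X :: 'a topology) \<phi>. prime p \<and> X_ac X \<and> mod_acyclic p X \<and> top_action Q X \<phi> \<and>
     \<not> mod_acyclic p (subtopology X (fixed_points Q (topspace X) \<phi>))"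
proof -
  interpret H: normal H Q by (rule H)
  define F where "F = Q Mod H"
  interpret F: group F unfolding F_def by (rule H.factorgroup_is_group)
  define N where "N = card (carrier F)"
  have finF: "finite (carrier F)" using fin by (simp add: F_def)
  obtain en where en: "bij_betw en {..<N} (carrier F)"
    using ex_bij_betw_nat_finite[OF finF] by (auto simp: N_def atLeast0LessThan)
  define num where "num = inv_into {..<N} en"
  have en_in: "en e \<in> carrier F" if "e < N" for e using bij_betwE[OF en] that by auto
  have num_less: "num f < N" if "f \<in> carrier F" for f
    using bij_betwE[OF bij_betw_inv_into[OF en]] that by (auto simp: num_def)
  have en_num: "en (num f) = f" if "f \<in> carrier F" for f
    using bij_betw_inv_into_right[OF en] that by (simp add: num_def)
  have num_en: "num (en e) = e" if "e < N" for e
    using bij_betw_inv_into_left[OF en] that by (simp add: num_def)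
  obtain g0 where g0: "g0 \<in> carrier Q" "g0 \<notin> H" using proper H.subset by blast
  define cl where "cl g = H #>\<^bsub>Q\<^esub> g" for g
  have cl_in: "cl g \<in> carrier F" if "g \<in> carrier Q" for g
    using that by (auto simp: cl_def F_def carrier_FactGroup)
  have cl_mult: "cl (g \<otimes>\<^bsub>Q\<^esub> h) = cl g \<otimes>\<^bsub>F\<^esub> cl h" if "g \<in> carrier Q" "h \<in> carrier Q" for g h
    using H.rcos_sum[OF that] by (simp add: cl_def F_def)
  have cl_one: "cl \<one>\<^bsub>Q\<^esub> = \<one>\<^bsub>F\<^esub>" using H.coset_mult_one[OF H.subset] by (simp add: cl_def F_def)
  have cl_g0: "cl g0 \<noteq> \<one>\<^bsub>F\<^esub>"
    using g0 H.rcos_self[OF g0(1) H.subgroup_axioms] by (auto simp: cl_def F_def)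
  have N2: "N \<ge> 2"
  proof -
    have "card {cl g0, \<one>\<^bsub>F\<^esub>} \<le> N" unfolding N_def by (rule card_mono[OF finF]) (use cl_in g0 in auto)
    then show ?thesis using cl_g0 by simp
  qed
  define q where "q = 2 * N - 1"
  define letter where "letter e i = num (en e \<otimes>\<^bsub>F\<^esub> en (i mod N))" for e i
  define \<sigma> where "\<sigma> g e = num (cl g \<otimes>\<^bsub>F\<^esub> en e)" for g e
  have modN: "i mod N < N" for i using N2 by simp
  interpret theta_system N q 2 letter
  proof
    show "N > 0" using N2 by simp
    show "letter e i < N" if "e < N" for e i unfolding letter_def using that en_in modN by (intro num_less) auto
    fix e h assume eh: "e < N" "h < N"
    define k where "k = num (inv\<^bsub>F\<^esub> (en e) \<otimes>\<^bsub>F\<^esub> en h)"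
    have k: "k < N" unfolding k_def using eh en_in by (intro num_less) auto
    have "letter e i = h \<longleftrightarrow> i mod N = k" for i
    proof -
      have "letter e i = h \<longleftrightarrow> en e \<otimes>\<^bsub>F\<^esub> en (i mod N) = en h"
        unfolding letter_def using eh en_in modN en_num num_en by (metis F.m_closed)
      also have "\<dots> \<longleftrightarrow> en (i mod N) = inv\<^bsub>F\<^esub> (en e) \<otimes>\<^bsub>F\<^esub> en h"
        using F.inv_solve_left[of "en (i mod N)" "en e" "en h"] eh en_in modN by auto
      also have "\<dots> \<longleftrightarrow> i mod N = k"
        unfolding k_def using eh en_in modN en_num num_en by (metis F.inv_closed F.m_closed)
      finally show ?thesis .
    qed
    moreover have "{i. i \<le> q \<and> i mod N = k} = {k, k + N}"
    proof (intro equalityI subsetI)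
      fix i assume "i \<in> {i. i \<le> q \<and> i mod N = k}"
      then have i: "i < 2 * N" "i mod N = k" using N2 by (auto simp: q_def)
      then have "i = k \<or> i - N = k" using i by (cases "i < N") (auto simp: mod_if[of i N])
      then show "i \<in> {k, k + N}" using i k by (cases "i < N") auto
    qed (use k N2 in \<open>auto simp: q_def\<close>)
    ultimately show "card {i. i \<le> q \<and> letter e i = h} = 2" using N2 by simp
  qed
  have q1: "q \<ge> 1" using N2 by (simp add: q_def)
  obtain X :: "'a topology" and pr where X: "theta_limit N q 2 letter X pr" "Hausdorff_space X"
    using theta_limit_exists[OF big q1] by blast
  interpret L: theta_limit N q 2 letter X pr by (rule X)
  interpret A: theta_action N q 2 letter X pr Q \<sigma>
  proof
    show "Hausdorff_space X" by (rule X)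
    show "\<sigma> g e < N" if "g \<in> carrier Q" "e < N" for g e
      unfolding \<sigma>_def using that en_in cl_in by (intro num_less) auto
    show "\<sigma> (g \<otimes>\<^bsub>Q\<^esub> h) e = \<sigma> g (\<sigma> h e)" if "g \<in> carrier Q" "h \<in> carrier Q" "e < N" for g h e
      unfolding \<sigma>_def using that by (simp add: cl_mult en_num cl_in en_in F.m_assoc)
    show "\<sigma> \<one>\<^bsub>Q\<^esub> e = e" if "e < N" for e
      unfolding \<sigma>_def using that by (simp add: cl_one en_in num_en)
    show "letter (\<sigma> g e) i = \<sigma> g (letter e i)" if "g \<in> carrier Q" "e < N" "i \<le> q" for g e i
      unfolding \<sigma>_def letter_def using that modN[of i] by (simp add: en_num cl_in en_in F.m_assoc)
    show "\<exists>g\<in>carrier Q. \<sigma> g e \<noteq> e" if e: "e < N" for e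
    proof
      show "\<sigma> g0 e \<noteq> e"
      proof
        assume "\<sigma> g0 e = e"
        then have "cl g0 \<otimes>\<^bsub>F\<^esub> en e = en e"
          unfolding \<sigma>_def using en_num[of "cl g0 \<otimes>\<^bsub>F\<^esub> en e"] cl_in g0 en_in[OF e] by simp
        then show False using cl_g0 cl_in[OF g0(1)] en_in[OF e] by (simp add: F.r_cancel_one)
      qed
    qed (rule g0)
  qed
  have "q \<noteq> 1" using N2 by (simp add: q_def)
  then obtain p where p: "prime p" "p dvd q" using prime_factor_nat by blast
  note ac = L.theta_limit_acyclic[OF p]
  have "X_ac X" unfolding X_ac_def finite_covering_dim_def using X(2) ac p(1) by blast
  moreover have "\<not> mod_acyclic p (subtopology X (fixed_points Q (topspace X) A.act))"
    using mod_p_coefficients.mod_acyclic_imp_connected[OF mod_p_coefficients.intro[OF p(1)]]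
      A.fixed_points_disconnected by blast
  ultimately show ?thesis using p(1) ac(2) A.top_action_act by blast
qed

section \<open>Invariant means on precompact groups\<close>

text \<open>Up to elements at distance zero, the pseudometric \<open>D\<close> makes the group a dense
  subgroup of a compact group. Lipschitz functions play the role of continuous functions on it.\<close>
locale precompact_group = group Q for Q :: "('g, 'h) monoid_scheme" (structure) +
  fixes D :: "'g \<Rightarrow> 'g \<Rightarrow> real"
  assumes D_nonneg: "\<And>g h. 0 \<le> D g h"
    and D_refl: "\<And>g. D g g = 0"
    and D_commute: "\<And>g h. D g h = D h g"
    and D_triangle: "\<And>g h k. g \<in> carrier Q \<Longrightarrow> h \<in> carrier Q \<Longrightarrow> k \<in> carrier Q \<Longrightarrow> D g k \<le> D g h + D h k"
    and D_left: "\<And>k g h. k \<in> carrier Q \<Longrightarrow> g \<in> carrier Q \<Longrightarrow> h \<in> carrier Q \<Longrightarrow> D (k \<otimes> g) (k \<otimes> h) = D g h"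
    and D_right: "\<And>k g h. k \<in> carrier Q \<Longrightarrow> g \<in> carrier Q \<Longrightarrow> h \<in> carrier Q \<Longrightarrow> D (g \<otimes> k) (h \<otimes> k) = D g h"
    and D_totally_bounded: "\<And>e. e > 0 \<Longrightarrow> \<exists>T. finite T \<and> T \<subseteq> carrier Q \<and> (\<forall>g\<in>carrier Q. \<exists>t\<in>T. D g t < e)"
begin

definition lip :: "real \<Rightarrow> ('g \<Rightarrow> real) \<Rightarrow> bool" where
  "lip L u \<longleftrightarrow> (\<forall>g\<in>carrier Q. \<forall>h\<in>carrier Q. \<bar>u g - u h\<bar> \<le> L * D g h)"

definition Lip :: "('g \<Rightarrow> real) \<Rightarrow> bool" where
  "Lip u \<longleftrightarrow> (\<exists>L\<ge>0. lip L u)"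

lemma lipD: "lip L u \<Longrightarrow> g \<in> carrier Q \<Longrightarrow> h \<in> carrier Q \<Longrightarrow> \<bar>u g - u h\<bar> \<le> L * D g h"
  by (simp add: lip_def)

lemma net:
  assumes "e > 0"
  obtains T where "T \<noteq> []" "set T \<subseteq> carrier Q" "\<And>g. g \<in> carrier Q \<Longrightarrow> \<exists>t\<in>set T. D g t < e"
proof -
  obtain F where F: "finite F" "F \<subseteq> carrier Q" "\<forall>g\<in>carrier Q. \<exists>t\<in>F. D g t < e"
    using D_totally_bounded[OF assms] by blast
  obtain T where T: "set T = F" using finite_list[OF F(1)] by blast
  have "F \<noteq> {}" using F(3) one_closed by blast
  then show ?thesis using that[of T] T F by auto
qed

lemma Lip_bounded:
  assumes "Lip u"
  shows "\<exists>B\<ge>0. \<forall>g\<in>carrier Q. \<bar>u g\<bar> \<le> B"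
proof -
  obtain L where L: "L \<ge> 0" "lip L u" using assms by (auto simp: Lip_def)
  obtain T where T: "set T \<subseteq> carrier Q" "\<And>g. g \<in> carrier Q \<Longrightarrow> \<exists>t\<in>set T. D g t < 1"
    by (rule net[of 1]) auto
  have "\<bar>u g\<bar> \<le> L + (\<Sum>t\<in>set T. \<bar>u t\<bar>)" if g: "g \<in> carrier Q" for g
  proof -
    obtain t where t: "t \<in> set T" "D g t < 1" using T(2)[OF g] by blast
    have "\<bar>u g - u t\<bar> \<le> L * D g t" using lipD[OF L(2) g] t T(1) by blast
    also have "\<dots> \<le> L * 1" using t L(1) by (intro mult_left_mono) auto
    finally have "\<bar>u g - u t\<bar> \<le> L" by simp
    moreover have "\<bar>u t\<bar> \<le> (\<Sum>t\<in>set T. \<bar>u t\<bar>)" using t(1) by (intro member_le_sum) auto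
    ultimately show ?thesis by linarith
  qed
  moreover have "0 \<le> L + (\<Sum>t\<in>set T. \<bar>u t\<bar>)" using L(1) by (intro add_nonneg_nonneg sum_nonneg) auto
  ultimately show ?thesis by blast
qed

lemma Lip_const: "Lip (\<lambda>_. c)"
  unfolding Lip_def lip_def by (intro exI[of _ 0]) simp

lemma Lip_add: "Lip u \<Longrightarrow> Lip v \<Longrightarrow> Lip (\<lambda>x. u x + v x)"
proof -
  assume "Lip u" "Lip v"
  then obtain L M where LM: "L \<ge> 0" "lip L u" "M \<ge> 0" "lip M v" by (auto simp: Lip_def)
  have "lip (L + M) (\<lambda>x. u x + v x)"
    unfolding lip_def
  proof (intro ballI)
    fix g h assume gh: "g \<in> carrier Q" "h \<in> carrier Q"
    show "\<bar>u g + v g - (u h + v h)\<bar> \<le> (L + M) * D g h"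
      using lipD[OF LM(2) gh] lipD[OF LM(4) gh] by (simp add: distrib_right)
  qed
  then show ?thesis using LM by (auto simp: Lip_def intro!: exI[of _ "L + M"])
qed

lemma Lip_mult: "Lip u \<Longrightarrow> Lip v \<Longrightarrow> Lip (\<lambda>x. u x * v x)"
proof -
  assume u: "Lip u" and v: "Lip v"
  obtain L M where LM: "L \<ge> 0" "lip L u" "M \<ge> 0" "lip M v" using u v by (auto simp: Lip_def)
  obtain A B where A: "A \<ge> 0" "\<forall>g\<in>carrier Q. \<bar>u g\<bar> \<le> A" and B: "B \<ge> 0" "\<forall>g\<in>carrier Q. \<bar>v g\<bar> \<le> B"
    using Lip_bounded[OF u] Lip_bounded[OF v] by blast
  have "lip (A * M + B * L) (\<lambda>x. u x * v x)"
    unfolding lip_def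
  proof (intro ballI)
    fix g h assume gh: "g \<in> carrier Q" "h \<in> carrier Q"
    have "u g * v g - u h * v h = u g * (v g - v h) + v h * (u g - u h)" by (simp add: algebra_simps)
    then have "\<bar>u g * v g - u h * v h\<bar> \<le> \<bar>u g\<bar> * \<bar>v g - v h\<bar> + \<bar>v h\<bar> * \<bar>u g - u h\<bar>"
      by (metis abs_mult abs_triangle_ineq)
    also have "\<dots> \<le> A * (M * D g h) + B * (L * D g h)"
      using A B gh lipD[OF LM(2) gh] lipD[OF LM(4) gh] by (intro add_mono mult_mono) auto
    finally show "\<bar>u g * v g - u h * v h\<bar> \<le> (A * M + B * L) * D g h" by (simp add: algebra_simps)
  qed
  then show ?thesis using LM A B by (auto simp: Lip_def intro!: exI[of _ "A * M + B * L"])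
qed

lemma Lip_scale: "Lip u \<Longrightarrow> Lip (\<lambda>x. c * u x)"
  by (rule Lip_mult[OF Lip_const])

lemma Lip_diff: "Lip u \<Longrightarrow> Lip v \<Longrightarrow> Lip (\<lambda>x. u x - v x)"
  using Lip_add[OF _ Lip_scale[of v "-1"], of u] by simp

lemma Lip_sum: "(\<And>i. i \<in> I \<Longrightarrow> Lip (u i)) \<Longrightarrow> Lip (\<lambda>x. \<Sum>i\<in>I. u i x)"
  by (induction I rule: infinite_finite_induct) (auto simp: Lip_const Lip_add)

lemma Lip_D: "x \<in> carrier Q \<Longrightarrow> Lip (D x)"
proof -
  assume x: "x \<in> carrier Q"
  have "lip 1 (D x)"
    unfolding lip_def
  proof (intro ballI)
    fix g h assume gh: "g \<in> carrier Q" "h \<in> carrier Q"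
    show "\<bar>D x g - D x h\<bar> \<le> 1 * D g h"
      using D_triangle[OF x gh] D_triangle[OF x gh(2,1)] D_commute[of g h] by linarith
  qed
  then show ?thesis by (auto simp: Lip_def intro!: exI[of _ 1])
qed

lemma D_inv:
  assumes "g \<in> carrier Q" "h \<in> carrier Q"
  shows "D (inv g) (inv h) = D g h"
proof -
  have "D (inv g) (inv h) = D (g \<otimes> inv g) (g \<otimes> inv h)" by (rule D_left[symmetric]) (use assms in auto)
  also have "\<dots> = D (g \<otimes> inv g \<otimes> h) (g \<otimes> inv h \<otimes> h)" by (rule D_right[symmetric]) (use assms in auto)
  also have "\<dots> = D h g" using assms by (simp add: m_assoc)
  finally show ?thesis by (simp add: D_commute)
qed

lemma Lip_isometry:
  assumes u: "Lip u" and f: "\<And>x. x \<in> carrier Q \<Longrightarrow> f x \<in> carrier Q"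
    and D: "\<And>x y. x \<in> carrier Q \<Longrightarrow> y \<in> carrier Q \<Longrightarrow> D (f x) (f y) = D x y"
  shows "Lip (\<lambda>x. u (f x))"
proof -
  obtain L where L: "L \<ge> 0" "lip L u" using u by (auto simp: Lip_def)
  have "lip L (\<lambda>x. u (f x))"
    unfolding lip_def using lipD[OF L(2) f f] by (simp add: D)
  then show ?thesis using L(1) unfolding Lip_def by (intro exI[of _ L]) simp
qed

lemma Lip_inv: "Lip u \<Longrightarrow> Lip (\<lambda>x. u (inv x))"
  by (erule Lip_isometry) (auto simp: D_inv)

lemma Lip_right: "Lip u \<Longrightarrow> k \<in> carrier Q \<Longrightarrow> Lip (\<lambda>x. u (x \<otimes> k))"
  by (erule Lip_isometry) (auto simp: D_right)

lemma Lip_left: "Lip u \<Longrightarrow> k \<in> carrier Q \<Longrightarrow> Lip (\<lambda>x. u (k \<otimes> x))"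
  by (erule Lip_isometry) (auto simp: D_left)

definition avg :: "'g list \<Rightarrow> ('g \<Rightarrow> real) \<Rightarrow> 'g \<Rightarrow> real" where
  "avg gs u h = (\<Sum>g\<leftarrow>gs. u (g \<otimes> h)) / length gs"

abbreviation "ok gs \<equiv> gs \<noteq> [] \<and> set gs \<subseteq> carrier Q"

definition list_prod :: "'g list \<Rightarrow> 'g list \<Rightarrow> 'g list" where
  "list_prod gs ts = concat (map (\<lambda>t. map (\<lambda>g. g \<otimes> t) gs) ts)"

lemma list_prod_ok:
  assumes "ok gs" "ok ts"
  shows "ok (list_prod gs ts)"
proof
  have "hd ts \<in> set ts" using assms(2) by simp
  then show "list_prod gs ts \<noteq> []" using assms(1) unfolding list_prod_def by auto
  show "set (list_prod gs ts) \<subseteq> carrier Q" using assms unfolding list_prod_def by auto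
qed

lemma avg_avg:
  assumes "ok gs" "ok ts" "h \<in> carrier Q"
  shows "avg ts (avg gs u) h = avg (list_prod gs ts) u h"
proof -
  have len: "length (list_prod gs ts) = length gs * length ts"
    by (induction ts) (auto simp: list_prod_def)
  have "(\<Sum>g\<leftarrow>list_prod gs ts. u (g \<otimes> h)) = (\<Sum>t\<leftarrow>ts. \<Sum>g\<leftarrow>gs. u (g \<otimes> t \<otimes> h))"
    by (induction ts) (auto simp: list_prod_def o_def)
  also have "\<dots> = (\<Sum>t\<leftarrow>ts. \<Sum>g\<leftarrow>gs. u (g \<otimes> (t \<otimes> h)))"
    using assms by (intro arg_cong[of _ _ sum_list] map_cong refl) (auto simp: m_assoc subset_iff)
  finally have s: "(\<Sum>g\<leftarrow>list_prod gs ts. u (g \<otimes> h)) = (\<Sum>t\<leftarrow>ts. \<Sum>g\<leftarrow>gs. u (g \<otimes> (t \<otimes> h)))" .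
  have "(\<Sum>t\<leftarrow>ts. avg gs u (t \<otimes> h)) = (\<Sum>t\<leftarrow>ts. \<Sum>g\<leftarrow>gs. u (g \<otimes> (t \<otimes> h))) / length gs"
    unfolding avg_def by (induction ts) (auto simp: add_divide_distrib)
  then show ?thesis unfolding avg_def[of ts] avg_def[of "list_prod gs ts"] s len by simp
qed

lemma avg_le:
  assumes "gs \<noteq> []" "\<And>g. g \<in> set gs \<Longrightarrow> u (g \<otimes> h) \<le> b"
  shows "avg gs u h \<le> b"
proof -
  have "(\<Sum>g\<leftarrow>gs. u (g \<otimes> h)) \<le> (\<Sum>g\<leftarrow>gs. b)" using assms(2) by (rule sum_list_mono)
  then show ?thesis using assms(1) by (simp add: avg_def sum_list_triv field_simps)
qed

lemma avg_le_strict: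
  assumes "t \<in> set gs" "\<And>g. g \<in> set gs \<Longrightarrow> u (g \<otimes> h) \<le> b" "u (t \<otimes> h) \<le> b - d"
  shows "avg gs u h \<le> b - d / length gs"
proof -
  have "(\<Sum>g\<leftarrow>gs. u (g \<otimes> h)) \<le> length gs * b - d"
    using assms
  proof (induction gs)
    case (Cons a gs)
    have a: "u (a \<otimes> h) \<le> b" by (rule Cons.prems(2)) simp
    show ?case
    proof (cases "t \<in> set gs")
      case True
      then have "(\<Sum>g\<leftarrow>gs. u (g \<otimes> h)) \<le> length gs * b - d" using Cons by simp
      then show ?thesis using a by (simp add: algebra_simps)
    next
      case False
      then have "u (a \<otimes> h) \<le> b - d" using Cons.prems by simp
      moreover have "(\<Sum>g\<leftarrow>gs. u (g \<otimes> h)) \<le> (\<Sum>g\<leftarrow>gs. b)" using Cons.prems(2) by (intro sum_list_mono) auto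
      ultimately show ?thesis by (simp add: sum_list_triv algebra_simps)
    qed
  qed simp
  moreover have "length gs > 0" using assms(1) by (cases gs) auto
  ultimately show ?thesis by (simp add: avg_def field_simps)
qed

lemma avg_add: "avg gs (\<lambda>x. u x + v x) h = avg gs u h + avg gs v h"
  by (simp add: avg_def sum_list_addf add_divide_distrib)

lemma avg_scale: "avg gs (\<lambda>x. c * u x) h = c * avg gs u h"
  by (simp add: avg_def sum_list_const_mult)

lemma avg_abs_le:
  assumes "gs \<noteq> []" "\<And>g. g \<in> set gs \<Longrightarrow> \<bar>u (g \<otimes> h) - c\<bar> \<le> b"
  shows "\<bar>avg gs u h - c\<bar> \<le> b"
proof -
  have 1: "avg gs u h \<le> c + b" by (rule avg_le[OF assms(1)]) (use assms(2) in \<open>fastforce simp: abs_le_iff\<close>)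
  have "avg gs (\<lambda>x. (-1) * u x) h \<le> b - c"
    by (rule avg_le[OF assms(1)]) (use assms(2) in \<open>fastforce simp: abs_le_iff\<close>)
  then show ?thesis using 1 unfolding avg_scale by linarith
qed

lemma lip_avg:
  assumes L: "lip L u" "L \<ge> 0" and gs: "ok gs"
  shows "lip L (avg gs u)"
  unfolding lip_def
proof (intro ballI)
  fix x y assume xy: "x \<in> carrier Q" "y \<in> carrier Q"
  have le: "avg gs u x \<le> avg gs u y + L * D x y" if xy: "x \<in> carrier Q" "y \<in> carrier Q" for x y
  proof -
    have "(\<Sum>g\<leftarrow>gs. u (g \<otimes> x)) \<le> (\<Sum>g\<leftarrow>gs. u (g \<otimes> y) + L * D x y)"
    proof (rule sum_list_mono)
      fix g assume "g \<in> set gs"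
      then have g: "g \<in> carrier Q" using gs by blast
      show "u (g \<otimes> x) \<le> u (g \<otimes> y) + L * D x y"
        using lipD[OF L(1), of "g \<otimes> x" "g \<otimes> y"] g xy by (simp add: D_left)
    qed
    then show ?thesis using gs by (simp add: avg_def sum_list_addf sum_list_triv field_simps)
  qed
  show "\<bar>avg gs u x - avg gs u y\<bar> \<le> L * D x y"
    using le[OF xy] le[OF xy(2,1)] D_commute[of x y] by (simp add: abs_le_iff)
qed

lemma Lip_avg: "Lip u \<Longrightarrow> ok gs \<Longrightarrow> Lip (avg gs u)"
  unfolding Lip_def using lip_avg by blast

text \<open>The constant \<open>c\<close> is a uniform limit of finite averages of left translates of
  \<open>u\<close>; on a compact group it is the integral for the Haar measure.\<close>
definition is_mean :: "('g \<Rightarrow> real) \<Rightarrow> real \<Rightarrow> bool" where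
  "is_mean u c \<longleftrightarrow> (\<forall>e>0. \<exists>gs. ok gs \<and> (\<forall>h\<in>carrier Q. \<bar>avg gs u h - c\<bar> \<le> e))"

text \<open>The infimum \<open>c\<close> of the upper bounds of all averages of \<open>u\<close> is the mean: all averages share the
  modulus of continuity of \<open>u\<close>, so an average that nearly attains \<open>c\<close> but drops below \<open>c - e\<close>
  somewhere would drop on a translate of a fixed ball, and averaging it over a finite net, of size
  independent of the average, would push its upper bound below \<open>c\<close>.\<close>
lemma is_mean_exists:
  assumes u: "Lip u"
  shows "\<exists>c. is_mean u c"
proof -
  obtain L where L: "L \<ge> 0" "lip L u" using u by (auto simp: Lip_def)
  obtain B where B: "B \<ge> 0" "\<forall>g\<in>carrier Q. \<bar>u g\<bar> \<le> B" using Lip_bounded[OF u] by blast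
  define A where "A = {b. \<exists>gs. ok gs \<and> (\<forall>h\<in>carrier Q. avg gs u h \<le> b)}"
  define c where "c = Inf A"
  have avgB: "\<bar>avg gs u h\<bar> \<le> B" if "ok gs" "h \<in> carrier Q" for gs h
    using avg_abs_le[of gs u h 0 B] that B(2) by (auto simp: subset_iff)
  have bdd: "bdd_below A"
  proof (rule bdd_belowI[of _ "- B"])
    fix b assume "b \<in> A"
    then obtain gs where "ok gs" "\<forall>h\<in>carrier Q. avg gs u h \<le> b" by (auto simp: A_def)
    then show "- B \<le> b" using avgB[of gs \<one>] one_closed by (force simp: abs_le_iff)
  qed
  have ne: "A \<noteq> {}"
  proof -
    have "ok [\<one>]" by simp
    then have "avg [\<one>] u h \<le> B" if "h \<in> carrier Q" for h using avgB[of "[\<one>]" h] that by linarith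
    then have "B \<in> A" using \<open>ok [\<one>]\<close> unfolding A_def by blast
    then show ?thesis by blast
  qed
  have "\<exists>gs. ok gs \<and> (\<forall>h\<in>carrier Q. \<bar>avg gs u h - c\<bar> \<le> e)" if e: "e > 0" for e
  proof -
    define d where "d = e / (2 * (L + 1))"
    have d: "d > 0" using e L by (simp add: d_def)
    have "L / (2 * (L + 1)) \<le> 1 / 2" using L(1) by (simp add: field_simps)
    then have "L / (2 * (L + 1)) * e \<le> 1 / 2 * e" using e by (intro mult_right_mono) auto
    then have Ld: "L * d \<le> e / 2" by (simp add: d_def)
    obtain T where T: "T \<noteq> []" "set T \<subseteq> carrier Q" "\<And>g. g \<in> carrier Q \<Longrightarrow> \<exists>t\<in>set T. D g t < d"
      using net[OF d] by blast
    \<comment> \<open>A drop by \<open>e\<close> at one point lowers the bound of an average over \<open>T\<close> by \<open>e / 2\<close> divided by the length of \<open>T\<close>.\<close>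
    define \<eta> where "\<eta> = min e (e / (2 * length T))"
    have \<eta>: "\<eta> > 0" using e T(1) by (simp add: \<eta>_def)
    obtain b where b: "b \<in> A" "b < c + \<eta>"
      using cInf_lessD[OF ne, of "c + \<eta>"] \<eta> by (auto simp: c_def)
    then obtain gs where gs: "ok gs" "\<And>h. h \<in> carrier Q \<Longrightarrow> avg gs u h \<le> b" by (auto simp: A_def)
    have cb: "c \<le> b" unfolding c_def using b(1) bdd by (rule cInf_lower)
    have low: "avg gs u h0 \<ge> c - e" if h0: "h0 \<in> carrier Q" for h0
    proof (rule ccontr)
      assume "\<not> avg gs u h0 \<ge> c - e"
      then have lt: "avg gs u h0 < c - e" by simp
      have "avg T (avg gs u) h \<le> b - (e / 2) / length T" if h: "h \<in> carrier Q" for h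
      proof -
        obtain t where t: "t \<in> set T" "D (h0 \<otimes> inv h) t < d" using T(3)[of "h0 \<otimes> inv h"] h h0 by auto
        have tQ: "t \<in> carrier Q" using t T(2) by blast
        have "D (h0 \<otimes> inv h) t = D (h0 \<otimes> inv h \<otimes> h) (t \<otimes> h)" using h h0 tQ by (simp add: D_right)
        then have Dh: "D h0 (t \<otimes> h) < d" using t h h0 by (simp add: m_assoc)
        have "\<bar>avg gs u h0 - avg gs u (t \<otimes> h)\<bar> \<le> L * D h0 (t \<otimes> h)"
          using lipD[OF lip_avg[OF L(2,1) gs(1)]] h0 h tQ by simp
        also have "\<dots> \<le> L * d" using Dh L(1) by (intro mult_left_mono) auto
        finally have "avg gs u (t \<otimes> h) \<le> b - e / 2" using lt Ld cb by linarith
        then show ?thesis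
          by (intro avg_le_strict[OF t(1)]) (use gs(2) h T(2) in auto)
      qed
      then have "\<forall>h\<in>carrier Q. avg (list_prod gs T) u h \<le> b - (e / 2) / length T"
        using avg_avg[OF gs(1)] T by simp
      then have "b - (e / 2) / length T \<in> A" using list_prod_ok[OF gs(1)] T by (auto simp: A_def)
      then have "c \<le> b - (e / 2) / length T" unfolding c_def using bdd by (intro cInf_lower)
      moreover have "\<eta> \<le> (e / 2) / length T" by (simp add: \<eta>_def)
      ultimately show False using b(2) by linarith
    qed
    have "\<bar>avg gs u h - c\<bar> \<le> e" if h: "h \<in> carrier Q" for h
      using low[OF h] gs(2)[OF h] b(2) by (simp add: \<eta>_def abs_le_iff)
    then show ?thesis using gs(1) by blast
  qed
  then show ?thesis by (auto simp: is_mean_def)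
qed

definition right_avg :: "'g list \<Rightarrow> ('g \<Rightarrow> real) \<Rightarrow> 'g \<Rightarrow> real" where
  "right_avg gs u h = (\<Sum>g\<leftarrow>gs. u (h \<otimes> g)) / length gs"

definition is_right_mean :: "('g \<Rightarrow> real) \<Rightarrow> real \<Rightarrow> bool" where
  "is_right_mean u c \<longleftrightarrow> (\<forall>e>0. \<exists>gs. ok gs \<and> (\<forall>h\<in>carrier Q. \<bar>right_avg gs u h - c\<bar> \<le> e))"

lemma right_avg_inv:
  assumes "set gs \<subseteq> carrier Q" "h \<in> carrier Q"
  shows "right_avg (map (\<lambda>g. inv g) gs) u h = avg gs (\<lambda>x. u (inv x)) (inv h)"
proof -
  have "map (\<lambda>g. u (h \<otimes> inv g)) gs = map (\<lambda>g. u (inv (g \<otimes> inv h))) gs"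
    using assms by (intro map_cong refl) (auto simp: inv_mult_group subset_iff)
  then show ?thesis by (simp only: right_avg_def avg_def map_map o_def length_map)
qed

lemma is_right_mean_exists:
  assumes "Lip u"
  shows "\<exists>c. is_right_mean u c"
proof -
  obtain c where c: "is_mean (\<lambda>x. u (inv x)) c" using is_mean_exists[OF Lip_inv[OF assms]] by blast
  have "is_right_mean u c"
    unfolding is_right_mean_def
  proof (intro allI impI)
    fix e :: real assume "e > 0"
    then obtain gs where gs: "ok gs" "\<forall>h\<in>carrier Q. \<bar>avg gs (\<lambda>x. u (inv x)) h - c\<bar> \<le> e"
      using c unfolding is_mean_def by blast
    then have "\<forall>h\<in>carrier Q. \<bar>right_avg (map (\<lambda>g. inv g) gs) u h - c\<bar> \<le> e"
      by (simp add: right_avg_inv)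
    moreover have "ok (map (\<lambda>g. inv g) gs)" using gs(1) by auto
    ultimately show "\<exists>gs. ok gs \<and> (\<forall>h\<in>carrier Q. \<bar>right_avg gs u h - c\<bar> \<le> e)" by blast
  qed
  then show ?thesis by blast
qed

lemma right_avg_abs_le:
  assumes "gs \<noteq> []" "\<And>g. g \<in> set gs \<Longrightarrow> \<bar>u (h \<otimes> g) - c\<bar> \<le> b"
  shows "\<bar>right_avg gs u h - c\<bar> \<le> b"
proof -
  have "\<bar>(\<Sum>g\<leftarrow>gs. u (h \<otimes> g)) - length gs * c\<bar> \<le> length gs * b"
    using assms(2)
  proof (induction gs)
    case (Cons a gs)
    have "\<bar>u (h \<otimes> a) - c\<bar> \<le> b" "\<bar>(\<Sum>g\<leftarrow>gs. u (h \<otimes> g)) - length gs * c\<bar> \<le> length gs * b"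
      using Cons by auto
    then show ?case by (simp add: abs_le_iff algebra_simps)
  qed simp
  moreover have "right_avg gs u h - c = ((\<Sum>g\<leftarrow>gs. u (h \<otimes> g)) - length gs * c) / length gs"
    using assms(1) by (simp add: right_avg_def field_simps)
  ultimately show ?thesis using assms(1) by (simp add: abs_divide pos_divide_le_eq mult.commute)
qed

lemma avg_right_avg_commute:
  assumes "set gs \<subseteq> carrier Q" "set ls \<subseteq> carrier Q" "h \<in> carrier Q"
  shows "avg gs (right_avg ls u) h = right_avg ls (avg gs u) h"
proof -
  have "(\<Sum>g\<leftarrow>gs. \<Sum>l\<leftarrow>ls. u (g \<otimes> h \<otimes> l)) = (\<Sum>l\<leftarrow>ls. \<Sum>g\<leftarrow>gs. u (g \<otimes> h \<otimes> l))"
    by (induction gs) (auto simp: sum_list_addf)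
  also have "\<dots> = (\<Sum>l\<leftarrow>ls. \<Sum>g\<leftarrow>gs. u (g \<otimes> (h \<otimes> l)))"
    using assms by (intro arg_cong[of _ _ sum_list] map_cong refl) (auto simp: m_assoc subset_iff)
  finally have "(\<Sum>g\<leftarrow>gs. \<Sum>l\<leftarrow>ls. u (g \<otimes> h \<otimes> l)) = (\<Sum>l\<leftarrow>ls. \<Sum>g\<leftarrow>gs. u (g \<otimes> (h \<otimes> l)))" .
  moreover have div: "(\<Sum>x\<leftarrow>xs. F x / c) = (\<Sum>x\<leftarrow>xs. F x) / c" for F :: "'g \<Rightarrow> real" and c xs
    by (induction xs) (auto simp: add_divide_distrib)
  ultimately show ?thesis by (simp add: avg_def right_avg_def div)
qed

text \<open>Averages over left translates commute with averages over right translates.\<close>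
lemma mean_eq_right_mean:
  assumes c: "is_mean u c" and d: "is_right_mean u d"
  shows "c = d"
proof (rule ccontr)
  assume ne: "c \<noteq> d"
  define e where "e = \<bar>c - d\<bar> / 3"
  have e: "e > 0" using ne by (simp add: e_def)
  obtain gs ls where gs: "ok gs" "\<And>h. h \<in> carrier Q \<Longrightarrow> \<bar>avg gs u h - c\<bar> \<le> e"
    and ls: "ok ls" "\<And>h. h \<in> carrier Q \<Longrightarrow> \<bar>right_avg ls u h - d\<bar> \<le> e"
    using c d e unfolding is_mean_def is_right_mean_def by meson
  have "\<bar>avg gs (right_avg ls u) \<one> - d\<bar> \<le> e" by (rule avg_abs_le) (use gs ls in auto)
  moreover have "\<bar>right_avg ls (avg gs u) \<one> - c\<bar> \<le> e" by (rule right_avg_abs_le) (use gs ls in auto)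
  moreover have "avg gs (right_avg ls u) \<one> = right_avg ls (avg gs u) \<one>"
    using gs ls by (intro avg_right_avg_commute) auto
  ultimately have "\<bar>c - d\<bar> \<le> 2 * e" by linarith
  then show False using e by (simp add: e_def)
qed

definition mean :: "('g \<Rightarrow> real) \<Rightarrow> real" where
  "mean u = (SOME c. is_mean u c)"

lemma is_mean_mean: "Lip u \<Longrightarrow> is_mean u (mean u)"
  unfolding mean_def by (rule someI_ex) (rule is_mean_exists)

lemma is_right_mean_mean: "Lip u \<Longrightarrow> is_right_mean u (mean u)"
  using is_right_mean_exists mean_eq_right_mean is_mean_mean by blast

lemma meanI: "Lip u \<Longrightarrow> is_mean u c \<Longrightarrow> mean u = c"
  using mean_eq_right_mean is_right_mean_mean by metis

lemma meanI_right: "Lip u \<Longrightarrow> is_right_mean u c \<Longrightarrow> mean u = c"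
  using mean_eq_right_mean is_mean_mean by metis

lemma mean_right_translate:
  assumes "Lip u" "k \<in> carrier Q"
  shows "mean (\<lambda>x. u (x \<otimes> k)) = mean u"
proof (rule meanI[OF Lip_right[OF assms]])
  have "avg gs (\<lambda>x. u (x \<otimes> k)) h = avg gs u (h \<otimes> k)" if "ok gs" "h \<in> carrier Q" for gs h
    unfolding avg_def using that assms(2)
    by (intro arg_cong2[of _ _ _ _ "(/)"] arg_cong[of _ _ sum_list] map_cong refl) (auto simp: m_assoc subset_iff)
  then show "is_mean (\<lambda>x. u (x \<otimes> k)) (mean u)"
    using is_mean_mean[OF assms(1)] assms(2) unfolding is_mean_def by (metis m_closed)
qed

lemma mean_left_translate:
  assumes "Lip u" "k \<in> carrier Q"
  shows "mean (\<lambda>x. u (k \<otimes> x)) = mean u"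
proof (rule meanI_right[OF Lip_left[OF assms]])
  have "right_avg gs (\<lambda>x. u (k \<otimes> x)) h = right_avg gs u (k \<otimes> h)" if "ok gs" "h \<in> carrier Q" for gs h
    unfolding right_avg_def using that assms(2)
    by (intro arg_cong2[of _ _ _ _ "(/)"] arg_cong[of _ _ sum_list] map_cong refl) (auto simp: m_assoc subset_iff)
  then show "is_right_mean (\<lambda>x. u (k \<otimes> x)) (mean u)"
    using is_right_mean_mean[OF assms(1)] assms(2) unfolding is_right_mean_def by (metis m_closed)
qed

lemma mean_avg:
  assumes u: "Lip u" and gs: "ok gs"
  shows "mean (avg gs u) = mean u"
proof (rule meanI_right[OF Lip_avg[OF assms]])
  show "is_right_mean (avg gs u) (mean u)"
    unfolding is_right_mean_def
  proof (intro allI impI)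
    fix e :: real assume "e > 0"
    then obtain ls where ls: "ok ls" "\<And>h. h \<in> carrier Q \<Longrightarrow> \<bar>right_avg ls u h - mean u\<bar> \<le> e"
      using is_right_mean_mean[OF u] unfolding is_right_mean_def by meson
    have "\<bar>right_avg ls (avg gs u) h - mean u\<bar> \<le> e" if h: "h \<in> carrier Q" for h
    proof -
      have "\<bar>avg gs (right_avg ls u) h - mean u\<bar> \<le> e"
        by (rule avg_abs_le) (use gs ls h in \<open>auto simp: subset_iff\<close>)
      then show ?thesis using avg_right_avg_commute gs ls(1) h by metis
    qed
    then show "\<exists>ls. ok ls \<and> (\<forall>h\<in>carrier Q. \<bar>right_avg ls (avg gs u) h - mean u\<bar> \<le> e)" using ls(1) by blast
  qed
qed

text \<open>Averaging a second time does not spoil an average that is already nearly constant, so the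
  functions can be treated one after the other.\<close>
lemma simultaneous_average:
  assumes "finite F" "\<And>u. u \<in> F \<Longrightarrow> Lip u" "e > 0"
  shows "\<exists>gs. ok gs \<and> (\<forall>u\<in>F. \<forall>h\<in>carrier Q. \<bar>avg gs u h - mean u\<bar> \<le> e)"
  using assms(1,2)
proof (induction F rule: finite_induct)
  case empty
  show ?case by (intro exI[of _ "[\<one>]"]) simp
next
  case (insert v F)
  then obtain gs where gs: "ok gs" "\<And>u h. u \<in> F \<Longrightarrow> h \<in> carrier Q \<Longrightarrow> \<bar>avg gs u h - mean u\<bar> \<le> e" by auto
  have v: "Lip v" using insert.prems by simp
  have "is_mean (avg gs v) (mean v)" using is_mean_mean[OF Lip_avg[OF v gs(1)]] mean_avg[OF v gs(1)] by simp
  then obtain ts where ts: "ok ts" "\<And>h. h \<in> carrier Q \<Longrightarrow> \<bar>avg ts (avg gs v) h - mean v\<bar> \<le> e"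
    using assms(3) unfolding is_mean_def by meson
  have "\<bar>avg (list_prod gs ts) u h - mean u\<bar> \<le> e" if u: "u \<in> insert v F" and h: "h \<in> carrier Q" for u h
  proof -
    have "\<bar>avg ts (avg gs u) h - mean u\<bar> \<le> e"
    proof (cases "u = v")
      case True
      then show ?thesis using ts(2)[OF h] by simp
    next
      case False
      then have "u \<in> F" using u by simp
      then show ?thesis by (rule avg_abs_le[rotated, OF gs(2)]) (use ts(1) h in auto)
    qed
    then show ?thesis using avg_avg[OF gs(1) ts(1) h] by simp
  qed
  then show ?case using list_prod_ok[OF gs(1) ts(1)] by blast
qed

lemma mean_add:
  assumes u: "Lip u" and v: "Lip v"
  shows "mean (\<lambda>x. u x + v x) = mean u + mean v"
proof (rule meanI[OF Lip_add[OF assms]])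
  show "is_mean (\<lambda>x. u x + v x) (mean u + mean v)"
    unfolding is_mean_def
  proof (intro allI impI)
    fix e :: real assume "e > 0"
    then obtain gs where gs: "ok gs" "\<forall>w\<in>{u, v}. \<forall>h\<in>carrier Q. \<bar>avg gs w h - mean w\<bar> \<le> e / 2"
      using simultaneous_average[of "{u, v}" "e / 2"] u v by auto
    have "\<forall>h\<in>carrier Q. \<bar>avg gs (\<lambda>x. u x + v x) h - (mean u + mean v)\<bar> \<le> e"
    proof
      fix h assume "h \<in> carrier Q"
      then have "\<bar>avg gs u h - mean u\<bar> \<le> e / 2" "\<bar>avg gs v h - mean v\<bar> \<le> e / 2" using gs(2) by auto
      then show "\<bar>avg gs (\<lambda>x. u x + v x) h - (mean u + mean v)\<bar> \<le> e" unfolding avg_add by linarith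
    qed
    then show "\<exists>gs. ok gs \<and> (\<forall>h\<in>carrier Q. \<bar>avg gs (\<lambda>x. u x + v x) h - (mean u + mean v)\<bar> \<le> e)"
      using gs(1) by blast
  qed
qed

lemma mean_le:
  assumes u: "Lip u" and le: "\<And>x. x \<in> carrier Q \<Longrightarrow> u x \<le> b"
  shows "mean u \<le> b"
proof (rule field_le_epsilon)
  fix e :: real assume "e > 0"
  then obtain gs where gs: "ok gs" "\<forall>h\<in>carrier Q. \<bar>avg gs u h - mean u\<bar> \<le> e"
    using is_mean_mean[OF u] unfolding is_mean_def by blast
  have "avg gs u \<one> \<le> b" by (rule avg_le) (use gs(1) le in \<open>auto simp: subset_iff\<close>)
  moreover have "\<bar>avg gs u \<one> - mean u\<bar> \<le> e" using gs(2) by blast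
  ultimately show "mean u \<le> b + e" by linarith
qed

lemma mean_const: "mean (\<lambda>_. c) = c"
proof (rule meanI[OF Lip_const])
  show "is_mean (\<lambda>_. c) c"
    unfolding is_mean_def by (intro allI impI exI[of _ "[\<one>]"]) (simp add: avg_def)
qed

lemma mean_scale:
  assumes u: "Lip u"
  shows "mean (\<lambda>x. c * u x) = c * mean u"
proof (rule meanI[OF Lip_scale[OF u]])
  show "is_mean (\<lambda>x. c * u x) (c * mean u)"
    unfolding is_mean_def
  proof (intro allI impI)
    fix e :: real assume e: "e > 0"
    then have "e / (\<bar>c\<bar> + 1) > 0" by (simp add: add_nonneg_pos)
    then obtain gs where gs: "ok gs" "\<forall>h\<in>carrier Q. \<bar>avg gs u h - mean u\<bar> \<le> e / (\<bar>c\<bar> + 1)"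
      using is_mean_mean[OF u] unfolding is_mean_def by blast
    have "\<bar>avg gs (\<lambda>x. c * u x) h - c * mean u\<bar> \<le> e" if "h \<in> carrier Q" for h
    proof -
      have "\<bar>avg gs (\<lambda>x. c * u x) h - c * mean u\<bar> = \<bar>c\<bar> * \<bar>avg gs u h - mean u\<bar>"
        unfolding avg_scale by (simp add: abs_mult flip: right_diff_distrib)
      also have "\<dots> \<le> (\<bar>c\<bar> + 1) * (e / (\<bar>c\<bar> + 1))" using gs(2) that by (intro mult_mono) auto
      also have "\<dots> = e" by (simp add: add_nonneg_eq_0_iff)
      finally show ?thesis .
    qed
    then show "\<exists>gs. ok gs \<and> (\<forall>h\<in>carrier Q. \<bar>avg gs (\<lambda>x. c * u x) h - c * mean u\<bar> \<le> e)"
      using gs(1) by blast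
  qed
qed

lemma mean_diff: "Lip u \<Longrightarrow> Lip v \<Longrightarrow> mean (\<lambda>x. u x - v x) = mean u - mean v"
  using mean_add[OF _ Lip_scale[of v "-1"], of u] mean_scale[of v "-1"] by simp

lemma mean_mono:
  assumes "Lip u" "Lip v" "\<And>x. x \<in> carrier Q \<Longrightarrow> u x \<le> v x"
  shows "mean u \<le> mean v"
  using mean_le[OF Lip_diff[OF assms(1,2)], of 0] assms by (simp add: mean_diff)

lemma mean_nonneg: "Lip u \<Longrightarrow> (\<And>x. x \<in> carrier Q \<Longrightarrow> 0 \<le> u x) \<Longrightarrow> 0 \<le> mean u"
  using mean_mono[OF Lip_const, of u 0] by (simp add: mean_const)

lemma mean_cong:
  assumes "Lip u" "Lip v" "\<And>x. x \<in> carrier Q \<Longrightarrow> u x = v x"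
  shows "mean u = mean v"
  using mean_mono[of u v] mean_mono[of v u] assms by force

lemma mean_sum: "(\<And>i. i \<in> I \<Longrightarrow> Lip (u i)) \<Longrightarrow> mean (\<lambda>x. \<Sum>i\<in>I. u i x) = (\<Sum>i\<in>I. mean (u i))"
  by (induction I rule: infinite_finite_induct) (auto simp: mean_const mean_add Lip_sum)

text \<open>Finitely many translates of the set where \<open>u\<close> is large cover the group.\<close>
lemma mean_pos:
  assumes u: "Lip u" and nonneg: "\<And>x. x \<in> carrier Q \<Longrightarrow> 0 \<le> u x" and pos: "y \<in> carrier Q" "0 < u y"
  shows "0 < mean u"
proof -
  obtain L where L: "L \<ge> 0" "lip L u" using u by (auto simp: Lip_def)
  define d where "d = u y / (2 * (L + 1))"
  have d: "d > 0" using pos L by (simp add: d_def)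
  have "L / (2 * (L + 1)) \<le> 1 / 2" using L(1) by (simp add: field_simps)
  then have "L / (2 * (L + 1)) * u y \<le> 1 / 2 * u y" using pos by (intro mult_right_mono) auto
  then have Ld: "L * d \<le> u y / 2" by (simp add: d_def)
  obtain T where T: "T \<noteq> []" "set T \<subseteq> carrier Q" "\<And>g. g \<in> carrier Q \<Longrightarrow> \<exists>t\<in>set T. D g t < d"
    using net[OF d] by blast
  define c where "c = (u y / 2) / length T"
  have c: "c > 0" using pos T(1) by (simp add: c_def)
  have "c \<le> avg T u h" if h: "h \<in> carrier Q" for h
  proof -
    obtain t where t: "t \<in> set T" "D (y \<otimes> inv h) t < d" using T(3)[of "y \<otimes> inv h"] h pos by auto
    have tQ: "t \<in> carrier Q" using t T(2) by blast
    have "D (y \<otimes> inv h) t = D (y \<otimes> inv h \<otimes> h) (t \<otimes> h)" using h pos tQ by (simp add: D_right)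
    then have Dh: "D y (t \<otimes> h) < d" using t h pos by (simp add: m_assoc)
    have "\<bar>u y - u (t \<otimes> h)\<bar> \<le> L * D y (t \<otimes> h)" using lipD[OF L(2)] pos h tQ by simp
    also have "\<dots> \<le> L * d" using Dh L(1) by (intro mult_left_mono) auto
    finally have "- u (t \<otimes> h) \<le> 0 - u y / 2" using Ld by linarith
    then have "avg T (\<lambda>x. (-1) * u x) h \<le> 0 - (u y / 2) / length T"
      by (intro avg_le_strict[OF t(1)]) (use nonneg h T(2) in \<open>auto simp: subset_iff\<close>)
    then show ?thesis unfolding avg_scale c_def by linarith
  qed
  then have "c \<le> mean (avg T u)"
    using mean_mono[OF Lip_const Lip_avg[OF u], of T c] T by (simp add: mean_const)
  then show ?thesis using c mean_avg[OF u] T by simp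
qed

end

section \<open>A compact symmetric operator\<close>

context precompact_group
begin

definition ip :: "('g \<Rightarrow> real) \<Rightarrow> ('g \<Rightarrow> real) \<Rightarrow> real" where
  "ip u v = mean (\<lambda>x. u x * v x)"

lemma ip_commute: "ip u v = ip v u"
  by (simp add: ip_def mult.commute)

lemma ip_cong:
  assumes "Lip u" "Lip v" "Lip u'" "Lip v'"
    and "\<And>x. x \<in> carrier Q \<Longrightarrow> u x = u' x" "\<And>x. x \<in> carrier Q \<Longrightarrow> v x = v' x"
  shows "ip u v = ip u' v'"
  unfolding ip_def by (rule mean_cong) (use assms in \<open>auto intro: Lip_mult\<close>)

lemma ip_diff_left: "Lip u \<Longrightarrow> Lip v \<Longrightarrow> Lip w \<Longrightarrow> ip (\<lambda>x. u x - v x) w = ip u w - ip v w"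
  unfolding ip_def left_diff_distrib by (rule mean_diff) (auto intro: Lip_mult)

lemma ip_scale_left: "Lip u \<Longrightarrow> Lip w \<Longrightarrow> ip (\<lambda>x. c * u x) w = c * ip u w"
  unfolding ip_def mult.assoc by (rule mean_scale) (auto intro: Lip_mult)

lemma ip_diff_right: "Lip u \<Longrightarrow> Lip v \<Longrightarrow> Lip w \<Longrightarrow> ip w (\<lambda>x. u x - v x) = ip w u - ip w v"
  by (simp add: ip_commute[of w] ip_diff_left)

lemma ip_scale_right: "Lip u \<Longrightarrow> Lip w \<Longrightarrow> ip w (\<lambda>x. c * u x) = c * ip w u"
  by (simp add: ip_commute[of w] ip_scale_left)

lemma ip_sum_left:
  assumes "\<And>i. i \<in> I \<Longrightarrow> Lip (u i)" "Lip w"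
  shows "ip (\<lambda>x. \<Sum>i\<in>I. u i x) w = (\<Sum>i\<in>I. ip (u i) w)"
  unfolding ip_def sum_distrib_right by (rule mean_sum) (use assms in \<open>auto intro: Lip_mult\<close>)

lemma ip_nonneg: "Lip u \<Longrightarrow> 0 \<le> ip u u"
  unfolding ip_def by (rule mean_nonneg) (auto intro: Lip_mult)

lemma ip_pos: "Lip u \<Longrightarrow> x \<in> carrier Q \<Longrightarrow> u x \<noteq> 0 \<Longrightarrow> 0 < ip u u"
  unfolding ip_def by (rule mean_pos[of _ x]) (auto intro: Lip_mult simp: zero_less_mult_iff)

lemma ip_zero:
  assumes "Lip u" "ip u u = 0" "x \<in> carrier Q"
  shows "u x = 0"
  using ip_pos[OF assms(1,3)] assms(2) by force

lemma ip_diff_sq: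
  assumes u: "Lip u" and v: "Lip v"
  shows "ip (\<lambda>x. u x - v x) (\<lambda>x. u x - v x) = ip u u - 2 * ip u v + ip v v"
  using u v by (simp add: ip_diff_left ip_diff_right Lip_diff ip_commute[of v u])

lemma cauchy_schwarz:
  assumes u: "Lip u" and v: "Lip v"
  shows "(ip u v)\<^sup>2 \<le> ip u u * ip v v"
proof (cases "ip v v = 0")
  case True
  have "ip u v = ip u (\<lambda>_. 0)" by (rule ip_cong) (use u v ip_zero[OF v True] Lip_const in auto)
  then show ?thesis using True by (simp add: ip_def mean_const)
next
  case False
  then have pos: "ip v v > 0" using ip_nonneg[OF v] by simp
  define b c where "b = ip v v" and "c = ip u v"
  have "0 \<le> ip (\<lambda>x. b * u x - c * v x) (\<lambda>x. b * u x - c * v x)"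
    by (intro ip_nonneg Lip_diff Lip_scale u v)
  also have "\<dots> = b * (ip u u * b - c\<^sup>2)"
    using u v by (simp add: ip_diff_sq Lip_scale ip_scale_left ip_scale_right b_def[symmetric] c_def[symmetric])
      (simp add: power2_eq_square algebra_simps)
  finally show ?thesis using pos by (simp add: b_def c_def zero_le_mult_iff)
qed

lemma abs_mean_le:
  assumes u: "Lip u" and le: "\<And>x. x \<in> carrier Q \<Longrightarrow> \<bar>u x\<bar> \<le> b"
  shows "\<bar>mean u\<bar> \<le> b"
proof -
  have "mean u \<le> b" by (rule mean_le[OF u]) (use le in \<open>force simp: abs_le_iff\<close>)
  moreover have "mean (\<lambda>x. (-1) * u x) \<le> b"
    by (rule mean_le[OF Lip_scale[OF u]]) (use le in \<open>force simp: abs_le_iff\<close>)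
  ultimately show ?thesis using mean_scale[OF u, of "-1"] by linarith
qed

lemma abs_ip_le:
  assumes f: "Lip f" and u: "Lip u" and b: "\<And>x. x \<in> carrier Q \<Longrightarrow> \<bar>f x\<bar> \<le> b" "0 \<le> b"
  shows "\<bar>ip f u\<bar> \<le> b * sqrt (ip u u)"
proof -
  have "\<bar>ip f f\<bar> \<le> b * b"
    unfolding ip_def
  proof (rule abs_mean_le[OF Lip_mult[OF f f]])
    fix x assume "x \<in> carrier Q"
    then show "\<bar>f x * f x\<bar> \<le> b * b" using b unfolding abs_mult by (intro mult_mono) auto
  qed
  then have "ip f f \<le> b\<^sup>2" unfolding power2_eq_square by linarith
  then have "ip f f * ip u u \<le> b\<^sup>2 * ip u u" using ip_nonneg[OF u] by (rule mult_right_mono)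
  then have "(ip f u)\<^sup>2 \<le> b\<^sup>2 * ip u u" using cauchy_schwarz[OF f u] by linarith
  then have "sqrt ((ip f u)\<^sup>2) \<le> sqrt (b\<^sup>2 * ip u u)" by (rule real_sqrt_le_mono)
  then show ?thesis using b(2) by (simp add: real_sqrt_mult)
qed

definition mean_distance :: real where
  "mean_distance = mean (D \<one>)"

text \<open>Subtracting the mean makes the operator \<open>conv\<close> vanish on constants, so that its
  eigenfunctions with nonzero eigenvalue are not constant.\<close>
definition kern :: "'g \<Rightarrow> 'g \<Rightarrow> real" where
  "kern x h = D x h - mean_distance"

text \<open>The integral operator with the kernel \<open>kern\<close>. Since \<open>D\<close> is invariant,
  it commutes with right translations, and its values inherit the Lipschitz property from
  \<open>D\<close>.\<close>
definition conv :: "('g \<Rightarrow> real) \<Rightarrow> 'g \<Rightarrow> real" where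
  "conv u x = ip (kern x) u"

lemma kern_commute: "kern x h = kern h x"
  by (simp add: kern_def D_commute)

lemma Lip_kern: "x \<in> carrier Q \<Longrightarrow> Lip (kern x)"
  unfolding kern_def by (intro Lip_diff Lip_D Lip_const)

lemma D_shift:
  assumes "x \<in> carrier Q" "h \<in> carrier Q"
  shows "D x h = D \<one> (inv x \<otimes> h)"
  using D_left[of "inv x" x h] assms by simp

lemma kern_bounded: "\<exists>K\<ge>0. \<forall>x\<in>carrier Q. \<forall>h\<in>carrier Q. \<bar>kern x h\<bar> \<le> K"
proof -
  obtain K where "K \<ge> 0" and K: "\<forall>h\<in>carrier Q. \<bar>kern \<one> h\<bar> \<le> K" using Lip_bounded[OF Lip_kern[OF one_closed]] by blast
  show ?thesis
  proof (intro exI[of _ K] conjI ballI \<open>K \<ge> 0\<close>)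
    fix x h assume xh: "x \<in> carrier Q" "h \<in> carrier Q"
    have "kern x h = kern \<one> (inv x \<otimes> h)" by (simp only: kern_def D_shift[OF xh])
    moreover have "\<bar>kern \<one> (inv x \<otimes> h)\<bar> \<le> K" by (rule K[rule_format]) (rule m_closed[OF inv_closed[OF xh(1)] xh(2)])
    ultimately show "\<bar>kern x h\<bar> \<le> K" by (simp only:)
  qed
qed

lemma lip_conv:
  assumes u: "Lip u"
  shows "lip (sqrt (ip u u)) (conv u)"
  unfolding lip_def
proof (intro ballI)
  fix x y assume xy: "x \<in> carrier Q" "y \<in> carrier Q"
  have "conv u x - conv u y = ip (\<lambda>h. kern x h - kern y h) u"
    unfolding conv_def using xy u by (simp add: ip_diff_left Lip_kern)
  moreover have "\<bar>ip (\<lambda>h. kern x h - kern y h) u\<bar> \<le> D x y * sqrt (ip u u)"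
  proof (rule abs_ip_le[OF _ u])
    fix h assume h: "h \<in> carrier Q"
    show "\<bar>kern x h - kern y h\<bar> \<le> D x y"
      using D_triangle[OF xy h] D_triangle[OF xy(2,1) h] D_commute[of x y] unfolding kern_def by linarith
  qed (use xy in \<open>auto intro: Lip_diff Lip_kern D_nonneg\<close>)
  ultimately show "\<bar>conv u x - conv u y\<bar> \<le> sqrt (ip u u) * D x y" by (simp add: mult.commute)
qed

lemma Lip_conv: "Lip u \<Longrightarrow> Lip (conv u)"
  unfolding Lip_def[of "conv u"] using lip_conv[of u] ip_nonneg[of u] by (intro exI[of _ "sqrt (ip u u)"]) simp

lemma conv_diff: "Lip u \<Longrightarrow> Lip v \<Longrightarrow> x \<in> carrier Q \<Longrightarrow> conv (\<lambda>x. u x - v x) x = conv u x - conv v x"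
  by (simp add: conv_def ip_diff_right Lip_kern)

lemma conv_scale: "Lip u \<Longrightarrow> x \<in> carrier Q \<Longrightarrow> conv (\<lambda>x. c * u x) x = c * conv u x"
  by (simp add: conv_def ip_scale_right Lip_kern)

lemma conv_cong:
  assumes "Lip u" "Lip v" "\<And>x. x \<in> carrier Q \<Longrightarrow> u x = v x" "x \<in> carrier Q"
  shows "conv u x = conv v x"
  unfolding conv_def by (rule ip_cong) (use assms Lip_kern in auto)

lemma mean_sum_list:
  "(\<And>h. h \<in> set hs \<Longrightarrow> Lip (f h)) \<Longrightarrow> mean (\<lambda>x. \<Sum>h\<leftarrow>hs. f h x) = (\<Sum>h\<leftarrow>hs. mean (f h)) \<and> Lip (\<lambda>x. \<Sum>h\<leftarrow>hs. f h x)"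
  by (induction hs) (auto simp: mean_const Lip_const mean_add Lip_add)

text \<open>Exchange of the two means: one list of group elements averages all the functions
  \<open>h \<mapsto> kern x h * u h\<close> to within a given error, simultaneously in \<open>x\<close>, because finitely many \<open>x\<close>
  represent all of them.\<close>
lemma conv_symmetric:
  assumes u: "Lip u" and v: "Lip v"
  shows "ip v (conv u) = ip u (conv v)"
proof -
  obtain Bu Bv where B: "Bu \<ge> 0" "\<forall>g\<in>carrier Q. \<bar>u g\<bar> \<le> Bu" "Bv \<ge> 0" "\<forall>g\<in>carrier Q. \<bar>v g\<bar> \<le> Bv"
    using Lip_bounded[OF u] Lip_bounded[OF v] by blast
  define L where "L = sqrt (ip u u)"
  have L: "L \<ge> 0" "lip L (conv u)" using lip_conv[OF u] ip_nonneg[OF u] by (auto simp: L_def)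
  have close: "\<bar>ip v (conv u) - ip u (conv v)\<bar> \<le> e * (Bv + 1)" if e: "e > 0" for e
  proof -
    define d where "d = e / (2 * (Bu + L + 1))"
    have d: "d > 0" using e B L by (simp add: d_def)
    have "d * (Bu + L + 1) = e / 2" using B(1) L(1) by (simp add: d_def field_simps)
    then have dB: "d * Bu + L * d \<le> e / 2" using d by (simp add: algebra_simps)
    obtain T where T: "T \<noteq> []" "set T \<subseteq> carrier Q" "\<And>g. g \<in> carrier Q \<Longrightarrow> \<exists>t\<in>set T. D g t < d"
      using net[OF d] by blast
    define F where "F x h = kern x h * u h" for x h
    have LF: "Lip (F x)" if "x \<in> carrier Q" for x
      unfolding F_def by (rule Lip_mult[OF Lip_kern[OF that] u])
    have convF: "conv u x = mean (F x)" for x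
    proof -
      have "F x = (\<lambda>h. kern x h * u h)" by (rule ext) (rule F_def)
      then show ?thesis by (simp add: conv_def ip_def)
    qed
    have "\<exists>gs. ok gs \<and> (\<forall>w\<in>insert (\<lambda>h. u h * conv v h) (F ` set T). \<forall>h\<in>carrier Q. \<bar>avg gs w h - mean w\<bar> \<le> e / 2)"
      by (rule simultaneous_average) (use LF T(2) e u v in \<open>auto intro: Lip_mult Lip_conv\<close>)
    then obtain hs where hs: "ok hs"
      "\<forall>w\<in>insert (\<lambda>h. u h * conv v h) (F ` set T). \<forall>h\<in>carrier Q. \<bar>avg hs w h - mean w\<bar> \<le> e / 2" by blast
    have avg1: "avg hs w \<one> = (\<Sum>h\<leftarrow>hs. w h) / length hs" for w
    proof -
      have "map (\<lambda>g. w (g \<otimes> \<one>)) hs = map w hs" using hs(1) by (intro map_cong) (auto simp: subset_iff)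
      then show ?thesis by (simp only: avg_def)
    qed
    have unif: "\<bar>avg hs (F x) \<one> - conv u x\<bar> \<le> e" if x: "x \<in> carrier Q" for x
    proof -
      obtain t where t: "t \<in> set T" "D x t < d" using T(3)[OF x] by blast
      have tQ: "t \<in> carrier Q" using t T(2) by blast
      have "\<bar>avg hs (\<lambda>h. F x h - F t h) \<one> - 0\<bar> \<le> d * Bu"
      proof (rule avg_abs_le)
        fix g assume "g \<in> set hs"
        then have g: "g \<otimes> \<one> \<in> carrier Q" using hs(1) by auto
        have "\<bar>kern x (g \<otimes> \<one>) - kern t (g \<otimes> \<one>)\<bar> \<le> D x t"
          using D_triangle[OF x tQ g] D_triangle[OF tQ x g] D_commute[of x t] unfolding kern_def by linarith
        then have "\<bar>kern x (g \<otimes> \<one>) - kern t (g \<otimes> \<one>)\<bar> * \<bar>u (g \<otimes> \<one>)\<bar> \<le> d * Bu"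
          using t(2) B g by (intro mult_mono) auto
        then show "\<bar>F x (g \<otimes> \<one>) - F t (g \<otimes> \<one>) - 0\<bar> \<le> d * Bu"
          by (simp add: F_def flip: abs_mult left_diff_distrib)
      qed (use hs in auto)
      moreover have "avg hs (\<lambda>h. F x h - F t h) \<one> = avg hs (F x) \<one> - avg hs (F t) \<one>"
        using avg_add[of hs "F x" "\<lambda>h. (-1) * F t h" \<one>] avg_scale[of hs "-1" "F t" \<one>] by simp
      moreover have "\<bar>avg hs (F t) \<one> - conv u t\<bar> \<le> e / 2" using hs(2) t(1) by (simp add: convF)
      moreover have "\<bar>conv u x - conv u t\<bar> \<le> L * d"
        using lipD[OF L(2) x tQ] mult_left_mono[OF less_imp_le[OF t(2)] L(1)] by linarith
      ultimately show ?thesis using dB by linarith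
    qed
    define W where "W x = v x * avg hs (F x) \<one>" for x
    have Wsum: "W x = (1 / length hs) * (\<Sum>h\<leftarrow>hs. u h * (kern h x * v x))" for x
    proof -
      have "v x * (\<Sum>h\<leftarrow>hs. F x h) = (\<Sum>h\<leftarrow>hs. u h * (kern h x * v x))"
        unfolding F_def kern_commute[of x] by (induction hs) (simp_all add: algebra_simps)
      then show ?thesis unfolding W_def avg1 by simp
    qed
    have Lsum: "mean (\<lambda>x. \<Sum>h\<leftarrow>hs. u h * (kern h x * v x)) = (\<Sum>h\<leftarrow>hs. mean (\<lambda>x. u h * (kern h x * v x)))
        \<and> Lip (\<lambda>x. \<Sum>h\<leftarrow>hs. u h * (kern h x * v x))"
      by (rule mean_sum_list) (use hs(1) v in \<open>auto intro!: Lip_scale Lip_mult Lip_kern\<close>)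
    have LW: "Lip W" unfolding Wsum using Lsum by (intro Lip_scale) simp
    have "W = (\<lambda>x. (1 / length hs) * (\<Sum>h\<leftarrow>hs. u h * (kern h x * v x)))" by (rule ext) (rule Wsum)
    then have "mean W = mean (\<lambda>x. (1 / length hs) * (\<Sum>h\<leftarrow>hs. u h * (kern h x * v x)))" by (rule arg_cong)
    also have "\<dots> = (1 / length hs) * mean (\<lambda>x. \<Sum>h\<leftarrow>hs. u h * (kern h x * v x))"
      by (rule mean_scale[OF conjunct2[OF Lsum]])
    also note conjunct1[OF Lsum]
    also have "map (\<lambda>h. mean (\<lambda>x. u h * (kern h x * v x))) hs = map (\<lambda>h. u h * conv v h) hs"
      using hs(1) v by (intro map_cong refl) (auto simp: mean_scale Lip_mult Lip_kern conv_def ip_def subset_iff)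
    finally have meanW: "mean W = avg hs (\<lambda>h. u h * conv v h) \<one>" unfolding avg1 by simp
    have 1: "\<bar>mean W - ip u (conv v)\<bar> \<le> e / 2" unfolding meanW ip_def using hs(2) by blast
    have "\<bar>mean (\<lambda>x. v x * conv u x - W x)\<bar> \<le> Bv * e"
    proof (rule abs_mean_le)
      fix x assume x: "x \<in> carrier Q"
      have "\<bar>v x * conv u x - W x\<bar> = \<bar>v x\<bar> * \<bar>avg hs (F x) \<one> - conv u x\<bar>"
        unfolding W_def by (simp add: abs_minus_commute flip: abs_mult right_diff_distrib)
      also have "\<dots> \<le> Bv * e" using unif[OF x] B x by (intro mult_mono) auto
      finally show "\<bar>v x * conv u x - W x\<bar> \<le> Bv * e" .
    qed (intro Lip_diff Lip_mult Lip_conv u v LW)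
    moreover have "mean (\<lambda>x. v x * conv u x - W x) = ip v (conv u) - mean W"
      unfolding ip_def by (intro mean_diff Lip_mult Lip_conv u v LW)
    moreover have "e * (Bv + 1) = Bv * e + e" by (simp add: algebra_simps)
    ultimately show ?thesis using 1 e by linarith
  qed
  show ?thesis
  proof (rule ccontr)
    assume "ip v (conv u) \<noteq> ip u (conv v)"
    define X where "X = \<bar>ip v (conv u) - ip u (conv v)\<bar>"
    have X: "X > 0" using \<open>ip v (conv u) \<noteq> ip u (conv v)\<close> by (simp add: X_def)
    have Bv1: "Bv + 1 > 0" using B by simp
    have "X \<le> X / (2 * (Bv + 1)) * (Bv + 1)"
      unfolding X_def by (rule close) (use X Bv1 in \<open>simp add: X_def\<close>)
    also have "\<dots> = X / 2"
    proof -
      have half: "X / (2 * c) * c = X / 2" if "c > 0" for c :: real using that by simp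
      show ?thesis by (rule half[OF Bv1])
    qed
    finally show False using X by simp
  qed
qed

lemma conv_right_translate:
  assumes u: "Lip u" and g: "g \<in> carrier Q" and x: "x \<in> carrier Q"
  shows "conv (\<lambda>h. u (h \<otimes> g)) x = conv u (x \<otimes> g)"
proof -
  have xg: "x \<otimes> g \<in> carrier Q" using g x by simp
  have "conv u (x \<otimes> g) = mean (\<lambda>h. kern (x \<otimes> g) (h \<otimes> g) * u (h \<otimes> g))"
    unfolding conv_def ip_def
    by (rule mean_right_translate[symmetric, OF Lip_mult[OF Lip_kern[OF xg] u] g])
  also have "\<dots> = mean (\<lambda>h. kern x h * u (h \<otimes> g))"
  proof (rule mean_cong)
    show "Lip (\<lambda>h. kern (x \<otimes> g) (h \<otimes> g) * u (h \<otimes> g))"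
      by (rule Lip_right[OF Lip_mult[OF Lip_kern[OF xg] u] g])
    show "Lip (\<lambda>h. kern x h * u (h \<otimes> g))" by (rule Lip_mult[OF Lip_kern[OF x] Lip_right[OF u g]])
  qed (use g x in \<open>simp add: kern_def D_right\<close>)
  finally show ?thesis by (simp add: conv_def ip_def)
qed

lemma conv_const:
  assumes x: "x \<in> carrier Q"
  shows "conv (\<lambda>_. c) x = 0"
proof -
  have "mean (D x) = mean (\<lambda>h. D \<one> (inv x \<otimes> h))"
    by (rule mean_cong) (use x in \<open>auto simp: D_shift[symmetric] intro: Lip_D Lip_left\<close>)
  also have "\<dots> = mean_distance" unfolding mean_distance_def by (rule mean_left_translate) (use x in \<open>auto intro: Lip_D\<close>)
  finally have "mean (kern x) = 0" unfolding kern_def using x by (simp add: mean_diff Lip_D Lip_const mean_const)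
  moreover have "conv (\<lambda>_. c) x = c * mean (kern x)"
    unfolding conv_def ip_def using mean_scale[OF Lip_kern[OF x], of c] by (simp add: mult.commute)
  ultimately show ?thesis by simp
qed

text \<open>A function is recorded, up to a uniform error, by its rounded values on a finite net.\<close>
lemma finite_patterns:
  assumes "0 < e" "0 \<le> L" "0 \<le> B"
  obtains P :: "int list set" and pat where "finite P"
    "\<And>u. lip L u \<Longrightarrow> (\<And>x. x \<in> carrier Q \<Longrightarrow> \<bar>u x\<bar> \<le> B) \<Longrightarrow> pat u \<in> P"
    "\<And>u v x. lip L u \<Longrightarrow> lip L v \<Longrightarrow> pat u = pat v \<Longrightarrow> x \<in> carrier Q \<Longrightarrow> \<bar>u x - v x\<bar> \<le> e"
proof -
  define d where "d = e / (3 * (L + 1))"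
  have d: "d > 0" using assms by (simp add: d_def)
  have "L / (3 * (L + 1)) \<le> 1 / 3" using assms by (simp add: field_simps)
  then have "L / (3 * (L + 1)) * e \<le> 1 / 3 * e" using assms by (intro mult_right_mono) auto
  then have Ld: "L * d \<le> e / 3" by (simp add: d_def)
  obtain T where T: "T \<noteq> []" "set T \<subseteq> carrier Q" "\<And>g. g \<in> carrier Q \<Longrightarrow> \<exists>t\<in>set T. D g t < d"
    using net[OF d] by blast
  define c where "c = e / 3"
  have c: "c > 0" using assms(1) by (simp add: c_def)
  define pat where "pat u = map (\<lambda>t. \<lfloor>u t / c\<rfloor>) T" for u :: "'g \<Rightarrow> real"
  define P where "P = {xs. set xs \<subseteq> {\<lfloor>- B / c\<rfloor>..\<lfloor>B / c\<rfloor>} \<and> length xs = length T}"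
  show ?thesis
  proof (rule that[of P pat])
    show "finite P" unfolding P_def by (rule finite_lists_length_eq) simp
    show "pat u \<in> P" if "lip L u" "\<And>x. x \<in> carrier Q \<Longrightarrow> \<bar>u x\<bar> \<le> B" for u
    proof -
      have "- B / c \<le> u t / c" "u t / c \<le> B / c" if "t \<in> set T" for t
      proof -
        have "\<bar>u t\<bar> \<le> B" using \<open>\<And>x. x \<in> carrier Q \<Longrightarrow> \<bar>u x\<bar> \<le> B\<close>[of t] that T(2) by blast
        then have b: "- B \<le> u t" "u t \<le> B" by linarith+
        have e3: "0 \<le> c" using c by simp
        show "- B / c \<le> u t / c" "u t / c \<le> B / c"
          by (rule divide_right_mono[OF b(1) e3], rule divide_right_mono[OF b(2) e3])
      qed
      then show ?thesis unfolding P_def pat_def by (auto intro!: floor_mono)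
    qed
    fix u v x assume u: "lip L u" and v: "lip L v" and eq: "pat u = pat v" and x: "x \<in> carrier Q"
    obtain t where t: "t \<in> set T" "D x t < d" using T(3)[OF x] by blast
    have tQ: "t \<in> carrier Q" using t T(2) by blast
    have "\<lfloor>u t / c\<rfloor> = \<lfloor>v t / c\<rfloor>" using eq t(1) by (simp add: pat_def)
    then have "\<bar>u t / c - v t / c\<bar> < 1" by linarith
    moreover have "u t / c - v t / c = (u t - v t) / c" by (simp add: diff_divide_distrib)
    ultimately have "\<bar>u t - v t\<bar> < c" using c by (simp add: abs_divide)
    moreover have "\<bar>u x - u t\<bar> \<le> L * d" "\<bar>v x - v t\<bar> \<le> L * d"
      using lipD[OF u x tQ] lipD[OF v x tQ] mult_left_mono[OF less_imp_le[OF t(2)] assms(2)] by linarith+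
    ultimately show "\<bar>u x - v x\<bar> \<le> e" using Ld unfolding c_def by linarith
  qed
qed

end

context precompact_group
begin

text \<open>The theorem of Arzela and Ascoli: for each precision \<open>finite_patterns\<close> yields a
  subsequence whose members agree to that precision, and the diagonal sequence converges uniformly.\<close>
lemma convergent_subsequence:
  assumes L: "0 \<le> L" and B: "0 \<le> B"
    and w: "\<And>n. lip L (w n)" "\<And>n. \<forall>x\<in>carrier Q. \<bar>w n x\<bar> \<le> B"
  shows "\<exists>(r :: nat \<Rightarrow> nat) v. strict_mono r \<and> lip L v \<and> (\<forall>x\<in>carrier Q. \<bar>v x\<bar> \<le> B) \<and>
    (\<forall>e>0. \<exists>N. \<forall>n\<ge>N. \<forall>x\<in>carrier Q. \<bar>w (r n) x - v x\<bar> \<le> e)"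
proof -
  define P where "P n r \<longleftrightarrow> (\<forall>i j. \<forall>x\<in>carrier Q. \<bar>w (r i) x - w (r j) x\<bar> \<le> 1 / real (Suc n))"
    for n and r :: "nat \<Rightarrow> nat"
  interpret subseqs P
  proof
    fix n and s :: "nat \<Rightarrow> nat" assume "strict_mono s"
    obtain R :: "int list set" and pat where R: "finite R"
      "\<And>u. lip L u \<Longrightarrow> (\<And>x. x \<in> carrier Q \<Longrightarrow> \<bar>u x\<bar> \<le> B) \<Longrightarrow> pat u \<in> R"
      "\<And>u v x. lip L u \<Longrightarrow> lip L v \<Longrightarrow> pat u = pat v \<Longrightarrow> x \<in> carrier Q \<Longrightarrow> \<bar>u x - v x\<bar> \<le> 1 / real (Suc n)"
      by (rule finite_patterns[of "1 / real (Suc n)" L B]) (use L B in auto)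
    have "range (\<lambda>i. pat (w (s i))) \<subseteq> R" using R(2) w by blast
    then have "finite (range (\<lambda>i. pat (w (s i))))" using R(1) finite_subset by blast
    then obtain i0 where i0: "infinite {i \<in> UNIV. pat (w (s i)) = pat (w (s i0))}"
      using pigeonhole_infinite[of "UNIV :: nat set" "\<lambda>i. pat (w (s i))"] by auto
    define I where "I = {i. pat (w (s i)) = pat (w (s i0))}"
    have I: "infinite I" using i0 by (simp add: I_def)
    have inI: "enumerate I k \<in> I" for k by (rule enumerate_in_set[OF I])
    have "pat (w (s (enumerate I i))) = pat (w (s (enumerate I j)))" for i j
      using inI[of i] inI[of j] by (simp add: I_def)
    then have "P n (s \<circ> enumerate I)" unfolding P_def using R(3) w(1) by simp
    then show "\<exists>r'. strict_mono r' \<and> P n (s \<circ> r')" using strict_mono_enumerate[OF I] by blast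
  qed
  define r where "r = diagseq"
  have mono: "strict_mono r" unfolding r_def by (rule subseq_diagseq)
  have "P k (r \<circ> (+) (Suc k))" for k
    unfolding r_def by (rule diagseq_holds) (auto simp: P_def)
  then have cau: "\<bar>w (r i) x - w (r j) x\<bar> \<le> 1 / real (Suc k)" if ij: "i > k" "j > k" "x \<in> carrier Q" for i j k x
  proof -
    obtain i' where i': "i = Suc k + i'" using le_Suc_ex[of "Suc k" i] ij(1) by auto
    obtain j' where j': "j = Suc k + j'" using le_Suc_ex[of "Suc k" j] ij(2) by auto
    show ?thesis using \<open>P k (r \<circ> (+) (Suc k))\<close> ij(3) unfolding P_def i' j' o_def by blast
  qed
  have "Cauchy (\<lambda>n. w (r n) x)" if x: "x \<in> carrier Q" for x
  proof (rule metric_CauchyI)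
    fix e :: real assume "0 < e"
    then obtain k where k: "1 / real (Suc k) < e" using nat_approx_posE by blast
    show "\<exists>M. \<forall>m\<ge>M. \<forall>n\<ge>M. dist (w (r m) x) (w (r n) x) < e"
    proof (intro exI[of _ "Suc k"] allI impI)
      fix m n assume "Suc k \<le> m" "Suc k \<le> n"
      then have "\<bar>w (r m) x - w (r n) x\<bar> \<le> 1 / real (Suc k)" using cau[of k m n x] x by simp
      then show "dist (w (r m) x) (w (r n) x) < e" unfolding dist_real_def using k by linarith
    qed
  qed
  then have "\<exists>l. (\<lambda>n. w (r n) x) \<longlonglongrightarrow> l" if "x \<in> carrier Q" for x
    using that Cauchy_convergent_iff convergent_def by blast
  then obtain v where v: "\<And>x. x \<in> carrier Q \<Longrightarrow> (\<lambda>n. w (r n) x) \<longlonglongrightarrow> v x" by metis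
  have unif: "\<bar>w (r i) x - v x\<bar> \<le> 1 / real (Suc k)" if i: "i > k" and x: "x \<in> carrier Q" for i k x
  proof (rule tendsto_upperbound)
    show "(\<lambda>j. \<bar>w (r i) x - w (r j) x\<bar>) \<longlonglongrightarrow> \<bar>w (r i) x - v x\<bar>"
      by (intro tendsto_intros v x)
    show "\<forall>\<^sub>F j in sequentially. \<bar>w (r i) x - w (r j) x\<bar> \<le> 1 / real (Suc k)"
      using eventually_gt_at_top[of k] by eventually_elim (use cau i x in auto)
  qed simp
  show ?thesis
  proof (intro exI[of _ r] exI[of _ v] conjI ballI allI impI mono)
    show "lip L v" unfolding lip_def
    proof (intro ballI)
      fix x y assume xy: "x \<in> carrier Q" "y \<in> carrier Q"
      show "\<bar>v x - v y\<bar> \<le> L * D x y"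
      proof (rule tendsto_upperbound)
        show "(\<lambda>j. \<bar>w (r j) x - w (r j) y\<bar>) \<longlonglongrightarrow> \<bar>v x - v y\<bar>" by (intro tendsto_intros v xy)
        show "\<forall>\<^sub>F j in sequentially. \<bar>w (r j) x - w (r j) y\<bar> \<le> L * D x y"
          by (rule always_eventually) (intro allI lipD[OF w(1) xy])
      qed simp
    qed
    show "\<bar>v x\<bar> \<le> B" if x: "x \<in> carrier Q" for x
    proof (rule tendsto_upperbound)
      show "(\<lambda>j. \<bar>w (r j) x\<bar>) \<longlonglongrightarrow> \<bar>v x\<bar>" by (intro tendsto_intros v x)
      show "\<forall>\<^sub>F j in sequentially. \<bar>w (r j) x\<bar> \<le> B"
        by (rule always_eventually) (intro allI w(2)[THEN bspec, OF x])
    qed simp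
    fix e :: real assume "0 < e"
    then obtain k where k: "1 / real (Suc k) < e" using nat_approx_posE by blast
    show "\<exists>N. \<forall>n\<ge>N. \<forall>x\<in>carrier Q. \<bar>w (r n) x - v x\<bar> \<le> e"
    proof (intro exI[of _ "Suc k"] allI impI ballI)
      fix n x assume "Suc k \<le> n" "x \<in> carrier Q"
      then have "\<bar>w (r n) x - v x\<bar> \<le> 1 / real (Suc k)" using unif[of k n x] by simp
      then show "\<bar>w (r n) x - v x\<bar> \<le> e" using k by linarith
    qed
  qed
qed

definition conv_bound :: real where
  "conv_bound = (SOME K. K \<ge> 0 \<and> (\<forall>x\<in>carrier Q. \<forall>h\<in>carrier Q. \<bar>kern x h\<bar> \<le> K))"

lemma conv_bound: "conv_bound \<ge> 0" "x \<in> carrier Q \<Longrightarrow> h \<in> carrier Q \<Longrightarrow> \<bar>kern x h\<bar> \<le> conv_bound"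
proof -
  have *: "conv_bound \<ge> 0 \<and> (\<forall>x\<in>carrier Q. \<forall>h\<in>carrier Q. \<bar>kern x h\<bar> \<le> conv_bound)"
    unfolding conv_bound_def by (rule someI_ex[OF kern_bounded])
  show "conv_bound \<ge> 0" by (rule conjunct1[OF *])
  show "x \<in> carrier Q \<Longrightarrow> h \<in> carrier Q \<Longrightarrow> \<bar>kern x h\<bar> \<le> conv_bound" using conjunct2[OF *] by blast
qed

lemma abs_conv_le:
  assumes "Lip u" "x \<in> carrier Q"
  shows "\<bar>conv u x\<bar> \<le> conv_bound * sqrt (ip u u)"
  unfolding conv_def
  by (rule abs_ip_le[OF Lip_kern[OF assms(2)] assms(1) conv_bound(2)[OF assms(2)] conv_bound(1)])

lemma ip_conv_le:
  assumes u: "Lip u"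
  shows "ip (conv u) (conv u) \<le> conv_bound\<^sup>2 * ip u u"
  unfolding ip_def[of "conv u"]
proof (rule mean_le[OF Lip_mult[OF Lip_conv[OF u] Lip_conv[OF u]]])
  fix x assume "x \<in> carrier Q"
  then have "\<bar>conv u x\<bar> \<le> conv_bound * sqrt (ip u u)" by (rule abs_conv_le[OF u])
  then have "\<bar>conv u x\<bar>\<^sup>2 \<le> (conv_bound * sqrt (ip u u))\<^sup>2" by (rule power_mono) simp
  also have "(conv_bound * sqrt (ip u u))\<^sup>2 = conv_bound\<^sup>2 * ip u u"
    using ip_nonneg[OF u] by (simp only: power_mult_distrib real_sqrt_pow2)
  finally show "conv u x * conv u x \<le> conv_bound\<^sup>2 * ip u u" by (simp only: power2_abs power2_eq_square)
qed

text \<open>The square of the operator norm of \<open>conv\<close>.\<close>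
definition top_value :: real where
  "top_value = Sup {ip (conv u) (conv u) | u. Lip u \<and> ip u u \<le> 1}"

lemma top_value_bdd: "bdd_above {ip (conv u) (conv u) | u. Lip u \<and> ip u u \<le> 1}"
proof (rule bdd_aboveI[of _ "conv_bound\<^sup>2"])
  fix y assume "y \<in> {ip (conv u) (conv u) | u. Lip u \<and> ip u u \<le> 1}"
  then obtain u where u: "y = ip (conv u) (conv u)" "Lip u" "ip u u \<le> 1" by blast
  have "conv_bound\<^sup>2 * ip u u \<le> conv_bound\<^sup>2 * 1" using u(3) by (intro mult_left_mono) auto
  then show "y \<le> conv_bound\<^sup>2" using ip_conv_le[OF u(2)] u(1) by simp
qed

lemma ip_conv_le_top:
  assumes u: "Lip u"
  shows "ip (conv u) (conv u) \<le> top_value * ip u u"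
proof (cases "ip u u = 0")
  case True
  then show ?thesis using ip_conv_le[OF u] by simp
next
  case False
  then have pos: "ip u u > 0" using ip_nonneg[OF u] by simp
  define c where "c = 1 / sqrt (ip u u)"
  have c2: "c * c = 1 / ip u u" using pos by (simp add: c_def)
  define v where "v x = c * u x" for x
  have v: "Lip v" unfolding v_def by (rule Lip_scale[OF u])
  have "ip v v = c * c * ip u u" unfolding v_def using u by (simp add: ip_scale_left ip_scale_right Lip_scale)
  then have "ip v v \<le> 1" using pos c2 by simp
  then have "ip (conv v) (conv v) \<le> top_value"
    unfolding top_value_def by (intro cSup_upper top_value_bdd) (use v in blast)
  moreover have "ip (conv v) (conv v) = ip (\<lambda>x. c * conv u x) (\<lambda>x. c * conv u x)"
  proof (rule ip_cong)
    have v_eq: "v = (\<lambda>x. c * u x)" by (rule ext) (rule v_def)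
    show "conv v x = c * conv u x" "conv v x = c * conv u x" if "x \<in> carrier Q" for x
      unfolding v_eq by (rule conv_scale[OF u that])+
  qed (intro Lip_conv Lip_scale u v)+
  then have "ip (conv v) (conv v) = c * c * ip (conv u) (conv u)"
    using u by (simp add: ip_scale_left ip_scale_right Lip_scale Lip_conv)
  ultimately show ?thesis using pos by (simp add: c2 field_simps)
qed

lemma top_value_pos:
  assumes g: "g \<in> carrier Q" "0 < D \<one> g"
  shows "0 < top_value"
proof -
  have "\<exists>h\<in>carrier Q. kern \<one> h \<noteq> 0"
  proof (rule ccontr)
    assume "\<not> ?thesis"
    then have "kern \<one> \<one> = 0" "kern \<one> g = 0" using g by auto
    then show False using g(2) by (simp add: kern_def D_refl)
  qed
  then obtain h where h: "h \<in> carrier Q" "kern \<one> h \<noteq> 0" by blast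
  have k: "Lip (kern \<one>)" by (rule Lip_kern) simp
  have "0 < conv (kern \<one>) \<one>" unfolding conv_def by (rule ip_pos[OF k h])
  then have "0 < ip (conv (kern \<one>)) (conv (kern \<one>))"
    by (intro ip_pos[OF Lip_conv[OF k], of \<one>]) auto
  also have "\<dots> \<le> top_value * ip (kern \<one>) (kern \<one>)" by (rule ip_conv_le_top[OF k])
  finally show ?thesis using ip_nonneg[OF k] by (simp add: zero_less_mult_iff)
qed

text \<open>The square of \<open>conv\<close> is positive, so its norm is an eigenvalue; for
  \<open>conv\<close> itself the sign would be unknown.\<close>
definition eigenspace :: "('g \<Rightarrow> real) set" where
  "eigenspace = {v. Lip v \<and> (\<forall>x\<in>carrier Q. conv (conv v) x = top_value * v x)}"

lemma ip_tendsto_uniform: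
  assumes w: "\<And>n. Lip (w n)" "Lip v" "\<And>n x. x \<in> carrier Q \<Longrightarrow> \<bar>w n x\<bar> \<le> B" "\<And>x. x \<in> carrier Q \<Longrightarrow> \<bar>v x\<bar> \<le> B"
    and unif: "\<And>e. 0 < e \<Longrightarrow> \<exists>N. \<forall>n\<ge>N. \<forall>x\<in>carrier Q. \<bar>w n x - v x\<bar> \<le> e"
  shows "(\<lambda>n. ip (w n) (w n)) \<longlonglongrightarrow> ip v v"
proof (rule LIMSEQ_I)
  fix e :: real assume e: "0 < e"
  have B: "B \<ge> 0" using w(4)[OF one_closed] by simp
  define d where "d = e / (2 * B + 1) / 2"
  have d: "d > 0" using e B by (simp add: d_def)
  obtain N where N: "\<forall>n\<ge>N. \<forall>x\<in>carrier Q. \<bar>w n x - v x\<bar> \<le> d" using unif[OF d] by blast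
  have "\<bar>ip (w n) (w n) - ip v v\<bar> < e" if n: "n \<ge> N" for n
  proof -
    have "ip (w n) (w n) - ip v v = mean (\<lambda>x. w n x * w n x - v x * v x)"
      unfolding ip_def using w by (simp add: mean_diff Lip_mult)
    moreover have "\<bar>mean (\<lambda>x. w n x * w n x - v x * v x)\<bar> \<le> d * (2 * B)"
    proof (rule abs_mean_le)
      fix x assume x: "x \<in> carrier Q"
      have "\<bar>w n x * w n x - v x * v x\<bar> = \<bar>w n x - v x\<bar> * \<bar>w n x + v x\<bar>"
        by (simp add: algebra_simps flip: abs_mult)
      also have "\<dots> \<le> d * (2 * B)"
        using N n x w(3)[OF x, of n] w(4)[OF x] d by (intro mult_mono) auto
      finally show "\<bar>w n x * w n x - v x * v x\<bar> \<le> d * (2 * B)" .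
    qed (intro Lip_diff Lip_mult w)
    moreover have "d * (2 * B + 1) = e / 2" using B unfolding d_def by (simp add: field_simps)
    then have "d * (2 * B) < e" using d e by (simp add: algebra_simps)
    ultimately show ?thesis by linarith
  qed
  then show "\<exists>N. \<forall>n\<ge>N. norm (ip (w n) (w n) - ip v v) < e" by auto
qed

text \<open>A maximising sequence for \<open>ip (conv u) (conv u)\<close> has images that converge uniformly along a
  subsequence. The limit \<open>v\<close> is a top eigenvector of the square of the operator, since
  \<open>conv (conv u) - top_value * u\<close> tends to zero in mean square along the sequence, and applying
  \<open>conv\<close> turns this into uniform convergence.\<close>
lemma eigenvector_exists:
  assumes pos: "0 < top_value"
  shows "\<exists>v\<in>eigenspace. 0 < ip v v"
proof -
  have "\<exists>u. Lip u \<and> ip u u \<le> 1 \<and> top_value - 1 / real (Suc n) < ip (conv u) (conv u)" for n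
  proof -
    have "\<exists>y\<in>{ip (conv u) (conv u) | u. Lip u \<and> ip u u \<le> 1}. top_value - 1 / real (Suc n) < y"
      unfolding top_value_def
    proof (rule less_cSupD)
      have "ip (\<lambda>_. 0) (\<lambda>_. 0) \<le> 1" by (simp add: ip_def mean_const)
      then show "{ip (conv u) (conv u) | u. Lip u \<and> ip u u \<le> 1} \<noteq> {}" using Lip_const[of 0] by blast
    qed simp
    then show ?thesis by blast
  qed
  then obtain u where u: "\<And>n. Lip (u n)" "\<And>n. ip (u n) (u n) \<le> 1"
    "\<And>n. top_value - 1 / real (Suc n) < ip (conv (u n)) (conv (u n))" by metis
  have sq: "sqrt (ip (u n) (u n)) \<le> 1" for n using u(2) by simp
  have lip1: "lip 1 (conv (u n))" for n
    unfolding lip_def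
  proof (intro ballI)
    fix x y assume xy: "x \<in> carrier Q" "y \<in> carrier Q"
    show "\<bar>conv (u n) x - conv (u n) y\<bar> \<le> 1 * D x y"
      using lipD[OF lip_conv[OF u(1)] xy, of n] mult_right_mono[OF sq D_nonneg, of n x y] by linarith
  qed
  have bd: "\<forall>x\<in>carrier Q. \<bar>conv (u n) x\<bar> \<le> conv_bound" for n
  proof
    fix x assume "x \<in> carrier Q"
    then show "\<bar>conv (u n) x\<bar> \<le> conv_bound"
      using abs_conv_le[OF u(1), of x n] mult_left_mono[OF sq conv_bound(1), of n] by linarith
  qed
  obtain r :: "nat \<Rightarrow> nat" and v where rv: "strict_mono r \<and> lip 1 v \<and> (\<forall>x\<in>carrier Q. \<bar>v x\<bar> \<le> conv_bound) \<and>
      (\<forall>e>0. \<exists>N. \<forall>n\<ge>N. \<forall>x\<in>carrier Q. \<bar>conv (u (r n)) x - v x\<bar> \<le> e)"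
    using convergent_subsequence[where w = "\<lambda>n. conv (u n)", OF zero_le_one conv_bound(1) lip1 bd] by blast
  then have r: "strict_mono r" and v: "lip 1 v" "\<And>x. x \<in> carrier Q \<Longrightarrow> \<bar>v x\<bar> \<le> conv_bound"
    and unif: "\<And>e. 0 < e \<Longrightarrow> \<exists>N. \<forall>n\<ge>N. \<forall>x\<in>carrier Q. \<bar>conv (u (r n)) x - v x\<bar> \<le> e" by blast+
  have Lv: "Lip v" using v(1) unfolding Lip_def by (intro exI[of _ 1]) simp
  define y where "y n = u (r n)" for n
  define w where "w n = conv (y n)" for n
  have y: "Lip (y n)" "ip (y n) (y n) \<le> 1" for n using u by (auto simp: y_def)
  have w: "Lip (w n)" for n unfolding w_def by (rule Lip_conv[OF y(1)])
  have lim1: "(\<lambda>n. ip (w n) (w n)) \<longlonglongrightarrow> ip v v"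
    by (rule ip_tendsto_uniform[of w v conv_bound]) (use w Lv bd v unif in \<open>auto simp: w_def y_def\<close>)
  have lim2: "(\<lambda>n. ip (w n) (w n)) \<longlonglongrightarrow> top_value"
  proof (rule tendsto_sandwich)
    show "\<forall>\<^sub>F n in sequentially. top_value - 1 / real (Suc (r n)) \<le> ip (w n) (w n)"
      using u(3) by (auto simp: w_def y_def less_imp_le)
    have "ip (w n) (w n) \<le> top_value" for n
    proof -
      have "top_value * ip (y n) (y n) \<le> top_value * 1" by (rule mult_left_mono[OF y(2)]) (use pos in simp)
      then show ?thesis using ip_conv_le_top[OF y(1), of n] unfolding w_def by linarith
    qed
    then show "\<forall>\<^sub>F n in sequentially. ip (w n) (w n) \<le> top_value" by simp
    have "(\<lambda>n. 1 / real (Suc (r n))) \<longlonglongrightarrow> 0"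
      using LIMSEQ_subseq_LIMSEQ[OF lim_1_over_n[THEN LIMSEQ_Suc] r] by (simp add: o_def)
    then show "(\<lambda>n. top_value - 1 / real (Suc (r n))) \<longlonglongrightarrow> top_value"
      using tendsto_diff[OF tendsto_const] by fastforce
  qed simp
  have vv: "ip v v = top_value" by (rule LIMSEQ_unique[OF lim1 lim2])
  have "conv (conv v) x = top_value * v x" if x: "x \<in> carrier Q" for x
  proof -
    define z where "z n = (\<lambda>h. conv (w n) h - top_value * y n h)" for n
    have z: "Lip (z n)" for n unfolding z_def by (intro Lip_diff Lip_conv Lip_scale w y)
    have zz: "ip (z n) (z n) \<le> top_value * (top_value - ip (w n) (w n))" for n
    proof -
      have "ip (z n) (z n) = ip (conv (w n)) (conv (w n)) - 2 * (top_value * ip (conv (w n)) (y n))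
          + top_value * (top_value * ip (y n) (y n))"
        unfolding z_def using w y by (simp add: ip_diff_sq ip_scale_right ip_scale_left Lip_scale Lip_conv)
      also have "ip (conv (w n)) (y n) = ip (w n) (w n)"
        using conv_symmetric[OF w y(1), of n n] by (simp add: w_def ip_commute)
      also have "ip (conv (w n)) (conv (w n)) \<le> top_value * ip (w n) (w n)" by (rule ip_conv_le_top[OF w])
      also have "top_value * (top_value * ip (y n) (y n)) \<le> top_value * (top_value * 1)"
        using y(2) pos by (intro mult_left_mono) auto
      finally show ?thesis by (simp add: algebra_simps)
    qed
    have "(\<lambda>n. conv (z n) x) \<longlonglongrightarrow> 0"
    proof (rule Lim_null_comparison)
      show "\<forall>\<^sub>F n in sequentially. norm (conv (z n) x) \<le> conv_bound * sqrt (top_value * (top_value - ip (w n) (w n)))"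
      proof (intro always_eventually allI)
        fix n
        have "\<bar>conv (z n) x\<bar> \<le> conv_bound * sqrt (ip (z n) (z n))" by (rule abs_conv_le[OF z x])
        also have "\<dots> \<le> conv_bound * sqrt (top_value * (top_value - ip (w n) (w n)))"
          using zz conv_bound(1) by (intro mult_left_mono real_sqrt_le_mono) auto
        finally show "norm (conv (z n) x) \<le> conv_bound * sqrt (top_value * (top_value - ip (w n) (w n)))" by simp
      qed
      have "(\<lambda>n. conv_bound * sqrt (top_value * (top_value - ip (w n) (w n))))
          \<longlonglongrightarrow> conv_bound * sqrt (top_value * (top_value - top_value))"
        by (intro tendsto_intros lim2)
      then show "(\<lambda>n. conv_bound * sqrt (top_value * (top_value - ip (w n) (w n)))) \<longlonglongrightarrow> 0" by simp
    qed
    moreover have "conv (z n) x = conv (conv (w n)) x - top_value * w n x" for n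
      unfolding z_def using w y x by (simp add: conv_diff conv_scale Lip_conv Lip_scale w_def)
    moreover have wx: "(\<lambda>n. w n x) \<longlonglongrightarrow> v x"
    proof (rule LIMSEQ_I)
      fix e :: real assume "0 < e"
      then obtain N where "\<forall>n\<ge>N. \<bar>w n x - v x\<bar> \<le> e / 2" using unif[of "e / 2"] x by (auto simp: w_def y_def)
      then show "\<exists>N. \<forall>n\<ge>N. norm (w n x - v x) < e" using \<open>0 < e\<close> by (intro exI[of _ N]) force
    qed
    moreover have "(\<lambda>n. conv (conv (w n)) x) \<longlonglongrightarrow> conv (conv v) x"
    proof (rule LIMSEQ_I)
      fix e :: real assume e: "0 < e"
      define c where "c = conv_bound * conv_bound + 1"
      have c: "c > 0" unfolding c_def by (simp add: add_nonneg_pos)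
      obtain N where N: "\<forall>n\<ge>N. \<forall>h\<in>carrier Q. \<bar>w n h - v h\<bar> \<le> e / (2 * c)"
        using unif[of "e / (2 * c)"] e c by (auto simp: w_def y_def)
      have "\<bar>conv (conv (w n)) x - conv (conv v) x\<bar> < e" if n: "n \<ge> N" for n
      proof -
        define f where "f = (\<lambda>h. w n h - v h)"
        have f: "Lip f" unfolding f_def by (rule Lip_diff[OF w Lv])
        define b where "b = e / (2 * c)"
        have b: "b > 0" using e c by (simp add: b_def)
        have "\<bar>ip f f\<bar> \<le> b * b"
          unfolding ip_def
        proof (rule abs_mean_le[OF Lip_mult[OF f f]])
          fix h assume "h \<in> carrier Q"
          then show "\<bar>f h * f h\<bar> \<le> b * b" using N n b unfolding abs_mult f_def b_def by (intro mult_mono) auto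
        qed
        then have "sqrt (ip f f) \<le> sqrt (b * b)" by (intro real_sqrt_le_mono) linarith
        then have fb: "sqrt (ip f f) \<le> b" using b by simp
        have "conv (conv (w n)) x - conv (conv v) x = conv (conv f) x"
        proof -
          have "conv (conv f) x = conv (\<lambda>h. conv (w n) h - conv v h) x"
            by (rule conv_cong) (use w Lv x f in \<open>auto simp: f_def conv_diff intro: Lip_conv Lip_diff\<close>)
          then show ?thesis using w Lv x by (simp add: conv_diff Lip_conv)
        qed
        moreover have "\<bar>conv (conv f) x\<bar> \<le> conv_bound * sqrt (ip (conv f) (conv f))"
          by (rule abs_conv_le[OF Lip_conv[OF f] x])
        moreover have "sqrt (ip (conv f) (conv f)) \<le> sqrt (conv_bound\<^sup>2 * ip f f)"
          by (intro real_sqrt_le_mono ip_conv_le f)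
        then have "sqrt (ip (conv f) (conv f)) \<le> conv_bound * b"
          using fb conv_bound(1) mult_left_mono[OF fb conv_bound(1)] by (simp add: real_sqrt_mult)
        then have "conv_bound * sqrt (ip (conv f) (conv f)) \<le> conv_bound * (conv_bound * b)"
          using conv_bound(1) by (intro mult_left_mono)
        moreover have "conv_bound * (conv_bound * b) < c * b" using b by (simp add: c_def algebra_simps)
        moreover have "c * b = e / 2" using c by (simp add: b_def)
        ultimately show ?thesis using e by linarith
      qed
      then show "\<exists>N. \<forall>n\<ge>N. norm (conv (conv (w n)) x - conv (conv v) x) < e" by auto
    qed
    ultimately have "(\<lambda>n. conv (conv (w n)) x - top_value * w n x) \<longlonglongrightarrow> 0"
      "(\<lambda>n. conv (conv (w n)) x - top_value * w n x) \<longlonglongrightarrow> conv (conv v) x - top_value * v x"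
      by (simp, intro tendsto_intros)
    then show ?thesis using LIMSEQ_unique by fastforce
  qed
  then show ?thesis using vv pos Lv by (intro bexI[of _ v]) (auto simp: eigenspace_def)
qed

end

section \<open>A finite-dimensional representation\<close>

context precompact_group
begin

lemma eigenspace_Lip: "v \<in> eigenspace \<Longrightarrow> Lip v"
  by (simp add: eigenspace_def)

lemma eigenspace_diff:
  assumes "u \<in> eigenspace" "v \<in> eigenspace"
  shows "(\<lambda>x. u x - v x) \<in> eigenspace"
proof -
  have L: "Lip u" "Lip v" using assms eigenspace_Lip by auto
  have "conv (conv (\<lambda>x. u x - v x)) x = top_value * (u x - v x)" if x: "x \<in> carrier Q" for x
  proof -
    have "conv (conv (\<lambda>x. u x - v x)) x = conv (\<lambda>x. conv u x - conv v x) x"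
      by (rule conv_cong) (use L x in \<open>auto simp: conv_diff intro: Lip_conv Lip_diff\<close>)
    also have "\<dots> = conv (conv u) x - conv (conv v) x" using L x by (simp add: conv_diff Lip_conv)
    also have "\<dots> = top_value * (u x - v x)" using assms x by (simp add: eigenspace_def right_diff_distrib)
    finally show ?thesis .
  qed
  then show ?thesis using L by (simp add: eigenspace_def Lip_diff)
qed

lemma eigenspace_scale:
  assumes "u \<in> eigenspace"
  shows "(\<lambda>x. c * u x) \<in> eigenspace"
proof -
  have L: "Lip u" using assms eigenspace_Lip by auto
  have "conv (conv (\<lambda>x. c * u x)) x = top_value * (c * u x)" if x: "x \<in> carrier Q" for x
  proof -
    have "conv (conv (\<lambda>x. c * u x)) x = conv (\<lambda>x. c * conv u x) x"
      by (rule conv_cong) (use L x in \<open>auto simp: conv_scale intro: Lip_conv Lip_scale\<close>)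
    also have "\<dots> = c * conv (conv u) x" using L x by (simp add: conv_scale Lip_conv)
    also have "\<dots> = top_value * (c * u x)" using assms x by (simp add: eigenspace_def)
    finally show ?thesis .
  qed
  then show ?thesis using L by (simp add: eigenspace_def Lip_scale)
qed

lemma eigenspace_combination:
  fixes n :: nat
  assumes "\<And>i. i < n \<Longrightarrow> e i \<in> eigenspace" "v \<in> eigenspace"
  shows "(\<lambda>x. v x - (\<Sum>i<n. c i * e i x)) \<in> eigenspace"
proof -
  have "\<forall>i<n. e i \<in> eigenspace" using assms(1) by blast
  then show ?thesis
  proof (induction n)
    case 0
    then show ?case using assms(2) by simp
  next
    case (Suc n)
  have "(\<lambda>x. (v x - (\<Sum>i<n. c i * e i x)) - c n * e n x) \<in> eigenspace"
      by (rule eigenspace_diff) (use Suc in \<open>auto intro: eigenspace_scale\<close>)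
    then show ?case by (simp only: sum.lessThan_Suc diff_diff_add)
  qed
qed

lemma eigenspace_right:
  assumes u: "u \<in> eigenspace" and g: "g \<in> carrier Q"
  shows "(\<lambda>h. u (h \<otimes> g)) \<in> eigenspace"
proof -
  have L: "Lip u" by (rule eigenspace_Lip[OF u])
  have "conv (conv (\<lambda>h. u (h \<otimes> g))) x = top_value * u (x \<otimes> g)" if x: "x \<in> carrier Q" for x
  proof -
    have "conv (conv (\<lambda>h. u (h \<otimes> g))) x = conv (\<lambda>h. conv u (h \<otimes> g)) x"
      by (rule conv_cong[OF Lip_conv[OF Lip_right[OF L g]] Lip_right[OF Lip_conv[OF L] g] _ x])
        (rule conv_right_translate[OF L g])
    also have "\<dots> = conv (conv u) (x \<otimes> g)" by (rule conv_right_translate[OF Lip_conv[OF L] g x])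
    also have "\<dots> = top_value * u (x \<otimes> g)" using u g x by (simp add: eigenspace_def)
    finally show ?thesis .
  qed
  then show ?thesis using Lip_right[OF L g] by (simp add: eigenspace_def)
qed

text \<open>An eigenvector is a multiple of an image under \<open>conv\<close>, and \<open>conv\<close> maps
  the unit ball of the mean square norm into a bounded equicontinuous set.\<close>
lemma eigenvector_regular:
  assumes pos: "0 < top_value"
  obtains L B where "0 \<le> L" "0 \<le> B"
    "\<And>v. v \<in> eigenspace \<Longrightarrow> ip v v = 1 \<Longrightarrow> lip L v"
    "\<And>v x. v \<in> eigenspace \<Longrightarrow> ip v v = 1 \<Longrightarrow> x \<in> carrier Q \<Longrightarrow> \<bar>v x\<bar> \<le> B"
proof
  let ?s = "sqrt top_value"
  show "0 \<le> ?s / top_value" "0 \<le> conv_bound * ?s / top_value" using pos conv_bound(1) by auto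
  fix v assume v: "v \<in> eigenspace" "ip v v = 1"
  have L: "Lip v" by (rule eigenspace_Lip[OF v(1)])
  have s: "sqrt (ip (conv v) (conv v)) \<le> ?s" using ip_conv_le_top[OF L] v(2) by simp
  have eq: "v x = conv (conv v) x / top_value" if "x \<in> carrier Q" for x
    using v(1) that pos by (simp add: eigenspace_def)
  show "lip (?s / top_value) v"
    unfolding lip_def
  proof (intro ballI)
    fix x y assume xy: "x \<in> carrier Q" "y \<in> carrier Q"
    have "\<bar>conv (conv v) x - conv (conv v) y\<bar> \<le> sqrt (ip (conv v) (conv v)) * D x y"
      by (rule lipD[OF lip_conv[OF Lip_conv[OF L]] xy])
    also have "\<dots> \<le> ?s * D x y" by (rule mult_right_mono[OF s D_nonneg])
    finally have "\<bar>conv (conv v) x - conv (conv v) y\<bar> / top_value \<le> ?s * D x y / top_value"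
      using pos by (intro divide_right_mono) auto
    then show "\<bar>v x - v y\<bar> \<le> ?s / top_value * D x y"
      unfolding eq[OF xy(1)] eq[OF xy(2)] using pos by (simp add: abs_divide flip: diff_divide_distrib)
  qed
  fix x assume x: "x \<in> carrier Q"
  have "\<bar>conv (conv v) x\<bar> \<le> conv_bound * sqrt (ip (conv v) (conv v))"
    by (rule abs_conv_le[OF Lip_conv[OF L] x])
  also have "\<dots> \<le> conv_bound * ?s" by (rule mult_left_mono[OF s conv_bound(1)])
  finally have "\<bar>conv (conv v) x\<bar> / top_value \<le> conv_bound * ?s / top_value"
    using pos by (intro divide_right_mono) auto
  then show "\<bar>v x\<bar> \<le> conv_bound * ?s / top_value"
    unfolding eq[OF x] using pos by (simp add: abs_divide)
qed

definition orthonormal :: "nat \<Rightarrow> (nat \<Rightarrow> 'g \<Rightarrow> real) \<Rightarrow> bool" where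
  "orthonormal n e \<longleftrightarrow> (\<forall>i<n. e i \<in> eigenspace) \<and> (\<forall>i<n. \<forall>j<n. ip (e i) (e j) = of_bool (i = j))"

text \<open>Two members of an orthonormal family have squared distance two, so no two of them can agree to
  within one; but there are only finitely many patterns.\<close>
lemma orthonormal_size_bounded:
  assumes pos: "0 < top_value"
  shows "\<exists>N. \<forall>n e. orthonormal n e \<longrightarrow> n \<le> N"
proof -
  obtain L B where LB: "0 \<le> L" "0 \<le> B"
    "\<And>v. v \<in> eigenspace \<Longrightarrow> ip v v = 1 \<Longrightarrow> lip L v"
    "\<And>v x. v \<in> eigenspace \<Longrightarrow> ip v v = 1 \<Longrightarrow> x \<in> carrier Q \<Longrightarrow> \<bar>v x\<bar> \<le> B"
    by (rule eigenvector_regular[OF pos]) blast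
  obtain R :: "int list set" and pat where R: "finite R"
      "\<And>u. lip L u \<Longrightarrow> (\<And>x. x \<in> carrier Q \<Longrightarrow> \<bar>u x\<bar> \<le> B) \<Longrightarrow> pat u \<in> R"
      "\<And>u v x. lip L u \<Longrightarrow> lip L v \<Longrightarrow> pat u = pat v \<Longrightarrow> x \<in> carrier Q \<Longrightarrow> \<bar>u x - v x\<bar> \<le> 1"
    by (rule finite_patterns[of 1 L B]) (use LB in auto)
  have "n \<le> card R" if o: "orthonormal n e" for n e
  proof -
    have e: "e i \<in> eigenspace" "ip (e i) (e i) = 1" if "i < n" for i using o that by (auto simp: orthonormal_def)
    have "inj_on (\<lambda>i. pat (e i)) {..<n}"
    proof (rule inj_onI, rule ccontr)
      fix i j assume ij: "i \<in> {..<n}" "j \<in> {..<n}" "pat (e i) = pat (e j)" "i \<noteq> j"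
      let ?d = "\<lambda>x. e i x - e j x"
      have L: "Lip (e i)" "Lip (e j)" using ij e eigenspace_Lip by auto
      have "ip ?d ?d = 2" using o ij L by (simp add: ip_diff_sq orthonormal_def)
      moreover have "ip ?d ?d \<le> 1"
        unfolding ip_def
      proof (rule mean_le)
        show "Lip (\<lambda>x. ?d x * ?d x)" by (intro Lip_mult Lip_diff L)
        fix x assume x: "x \<in> carrier Q"
        have "\<bar>?d x\<bar> \<le> 1" using R(3)[OF LB(3) LB(3) ij(3) x] e ij by auto
        then have "\<bar>?d x\<bar> * \<bar>?d x\<bar> \<le> 1 * 1" by (intro mult_mono) auto
        then show "?d x * ?d x \<le> 1" by simp
      qed
      ultimately show False by simp
    qed
    moreover have "(\<lambda>i. pat (e i)) ` {..<n} \<subseteq> R" using R(2) LB(3,4) e by auto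
    ultimately show ?thesis using card_inj_on_le[OF _ _ R(1)] by fastforce
  qed
  then show ?thesis by blast
qed

text \<open>A maximal orthonormal family spans, since a normalised remainder would enlarge it.\<close>
lemma orthonormal_basis:
  assumes pos: "0 < top_value"
  obtains n e where "0 < n" "orthonormal n e"
    "\<And>v x. v \<in> eigenspace \<Longrightarrow> x \<in> carrier Q \<Longrightarrow> v x = (\<Sum>i<n. ip v (e i) * e i x)"
proof -
  have unit: "(\<lambda>x. (1 / sqrt (ip v v)) * v x) \<in> eigenspace"
      "ip (\<lambda>x. (1 / sqrt (ip v v)) * v x) (\<lambda>x. (1 / sqrt (ip v v)) * v x) = 1"
    if v: "v \<in> eigenspace" "0 < ip v v" for v
  proof -
    show "(\<lambda>x. (1 / sqrt (ip v v)) * v x) \<in> eigenspace" by (rule eigenspace_scale[OF v(1)])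
    have L: "Lip v" by (rule eigenspace_Lip[OF v(1)])
    have "ip (\<lambda>x. (1 / sqrt (ip v v)) * v x) (\<lambda>x. (1 / sqrt (ip v v)) * v x)
        = (1 / sqrt (ip v v)) * ((1 / sqrt (ip v v)) * ip v v)"
      using L by (simp only: ip_scale_left ip_scale_right Lip_scale)
    also have "\<dots> = 1" using v(2) by (simp add: field_simps)
    finally show "ip (\<lambda>x. (1 / sqrt (ip v v)) * v x) (\<lambda>x. (1 / sqrt (ip v v)) * v x) = 1" .
  qed
  obtain v0 where v0: "v0 \<in> eigenspace" "0 < ip v0 v0" using eigenvector_exists[OF pos] by blast
  have one: "\<exists>e. orthonormal 1 e"
    using unit[OF v0] by (intro exI[of _ "\<lambda>_. (\<lambda>x. (1 / sqrt (ip v0 v0)) * v0 x)"]) (simp add: orthonormal_def)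
  obtain N where N: "\<forall>n e. orthonormal n e \<longrightarrow> n \<le> N" using orthonormal_size_bounded[OF pos] by blast
  have "\<exists>n. (\<exists>e. orthonormal n e) \<and> (\<forall>m. (\<exists>e. orthonormal m e) \<longrightarrow> m \<le> n)"
    by (rule ex_has_greatest_nat[of _ 1 "\<lambda>n. n" "Suc N"]) (use one N in \<open>auto simp: less_Suc_eq_le\<close>)
  then obtain n e where e: "orthonormal n e" and max: "\<And>m e. orthonormal m e \<Longrightarrow> m \<le> n" by blast
  have n: "0 < n" using one max by fastforce
  have eE: "e i \<in> eigenspace" if "i < n" for i using e that by (auto simp: orthonormal_def)
  have eL: "Lip (e i)" if "i < n" for i using eE[OF that] by (rule eigenspace_Lip)
  have eo: "ip (e i) (e j) = of_bool (i = j)" if "i < n" "j < n" for i j using e that by (auto simp: orthonormal_def)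
  show ?thesis
  proof (rule that[OF n e])
    fix v x assume v: "v \<in> eigenspace" and x: "x \<in> carrier Q"
    have vL: "Lip v" by (rule eigenspace_Lip[OF v])
    define w where "w = (\<lambda>x. v x - (\<Sum>i<n. ip v (e i) * e i x))"
    have w: "w \<in> eigenspace" unfolding w_def by (rule eigenspace_combination[OF eE v])
    have wL: "Lip w" by (rule eigenspace_Lip[OF w])
    have we: "ip w (e j) = 0" if j: "j < n" for j
    proof -
      have sL: "Lip (\<lambda>x. \<Sum>i<n. ip v (e i) * e i x)" by (intro Lip_sum Lip_scale eL) auto
      have "ip w (e j) = ip v (e j) - ip (\<lambda>x. \<Sum>i<n. ip v (e i) * e i x) (e j)"
        unfolding w_def by (rule ip_diff_left[OF vL sL eL[OF j]])
      also have "ip (\<lambda>x. \<Sum>i<n. ip v (e i) * e i x) (e j) = (\<Sum>i<n. ip (\<lambda>x. ip v (e i) * e i x) (e j))"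
        by (rule ip_sum_left) (auto intro: Lip_scale eL j)
      also have "\<dots> = (\<Sum>i<n. if i = j then ip v (e i) else 0)"
        by (rule sum.cong) (auto simp: ip_scale_left eL j eo)
      also have "\<dots> = ip v (e j)" using j by simp
      finally show ?thesis by simp
    qed
    have "ip w w = 0"
    proof (rule ccontr)
      assume "ip w w \<noteq> 0"
      then have pos_w: "0 < ip w w" using ip_nonneg[OF wL] by simp
      define f where "f = (\<lambda>x. (1 / sqrt (ip w w)) * w x)"
      have f: "f \<in> eigenspace" "ip f f = 1" unfolding f_def by (rule unit[OF w pos_w])+
      have fe: "ip f (e j) = 0" if "j < n" for j
        unfolding f_def using we that by (simp only: ip_scale_left wL eL mult_zero_right)
      have ef: "ip (e j) f = 0" if "j < n" for j using fe[OF that] by (simp only: ip_commute[of "e j"])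
      have "orthonormal (Suc n) (\<lambda>i. if i < n then e i else f)"
        unfolding orthonormal_def
      proof (intro conjI allI impI)
        fix i assume "i < Suc n" show "(if i < n then e i else f) \<in> eigenspace" using f eE by simp
        fix j assume "j < Suc n"
        show "ip (if i < n then e i else f) (if j < n then e j else f) = of_bool (i = j)"
          using \<open>i < Suc n\<close> \<open>j < Suc n\<close> f(2) fe ef eo by (cases "i < n"; cases "j < n") auto
      qed
      then show False using max by force
    qed
    then have "w x = 0" by (rule ip_zero[OF wL _ x])
    then show "v x = (\<Sum>i<n. ip v (e i) * e i x)" by (simp add: w_def)
  qed
qed

text \<open>Right translations act on the eigenspace. If they acted trivially, the eigenvectors would be
  constant on the group and hence killed by \<open>conv\<close>.\<close>
theorem nontrivial_matrix_representation:
  assumes "h \<in> carrier Q" "0 < D \<one> h"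
  shows "\<exists>(n :: nat) \<rho> :: 'g \<Rightarrow> nat \<Rightarrow> nat \<Rightarrow> real.
    (\<forall>g\<in>carrier Q. \<forall>k\<in>carrier Q. \<forall>i<n. \<forall>j<n. \<rho> (g \<otimes> k) i j = (\<Sum>l<n. \<rho> g i l * \<rho> k l j)) \<and>
    (\<forall>i<n. \<forall>j<n. \<rho> \<one> i j = of_bool (i = j)) \<and>
    (\<exists>g\<in>carrier Q. \<exists>i<n. \<exists>j<n. \<rho> g i j \<noteq> of_bool (i = j))"
proof -
  have pos: "0 < top_value" by (rule top_value_pos[OF assms])
  obtain n e where n: "0 < n" and e: "orthonormal n e"
    and exp: "\<And>v x. v \<in> eigenspace \<Longrightarrow> x \<in> carrier Q \<Longrightarrow> v x = (\<Sum>i<n. ip v (e i) * e i x)"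
    by (rule orthonormal_basis[OF pos]) blast
  have eE: "e i \<in> eigenspace" if "i < n" for i using e that by (auto simp: orthonormal_def)
  have eL: "Lip (e i)" if "i < n" for i using eE[OF that] by (rule eigenspace_Lip)
  have eo: "ip (e i) (e j) = of_bool (i = j)" if "i < n" "j < n" for i j using e that by (auto simp: orthonormal_def)
  define \<rho> where "\<rho> g i j = ip (\<lambda>h. e j (h \<otimes> g)) (e i)" for g i j
  have right: "e j (x \<otimes> g) = (\<Sum>i<n. \<rho> g i j * e i x)" if "g \<in> carrier Q" "x \<in> carrier Q" "j < n" for g j x
    unfolding \<rho>_def by (rule exp[OF eigenspace_right[OF eE[OF that(3)] that(1)] that(2)])
  have mult: "\<rho> (g \<otimes> k) i j = (\<Sum>l<n. \<rho> g i l * \<rho> k l j)"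
    if gk: "g \<in> carrier Q" "k \<in> carrier Q" and ij: "i < n" "j < n" for g k i j
  proof -
    have "\<rho> (g \<otimes> k) i j = ip (\<lambda>h. \<Sum>l<n. \<rho> k l j * e l (h \<otimes> g)) (e i)"
      unfolding \<rho>_def[of "g \<otimes> k"]
    proof (rule ip_cong)
      show "Lip (\<lambda>h. e j (h \<otimes> (g \<otimes> k)))" by (rule Lip_right) (use eL gk ij in auto)
      show "Lip (\<lambda>h. \<Sum>l<n. \<rho> k l j * e l (h \<otimes> g))" by (intro Lip_sum Lip_scale Lip_right eL gk) auto
      fix x assume x: "x \<in> carrier Q"
      have "e j (x \<otimes> (g \<otimes> k)) = e j ((x \<otimes> g) \<otimes> k)" using gk x by (simp add: m_assoc)
      also have "\<dots> = (\<Sum>l<n. \<rho> k l j * e l (x \<otimes> g))" using right[OF gk(2) _ ij(2)] gk x by simp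
      finally show "e j (x \<otimes> (g \<otimes> k)) = (\<Sum>l<n. \<rho> k l j * e l (x \<otimes> g))" .
    qed (use eL ij in auto)
    also have "\<dots> = (\<Sum>l<n. ip (\<lambda>h. \<rho> k l j * e l (h \<otimes> g)) (e i))"
    proof (rule ip_sum_left)
      show "Lip (\<lambda>h. \<rho> k l j * e l (h \<otimes> g))" if "l \<in> {..<n}" for l
        by (intro Lip_scale Lip_right eL gk) (use that in simp)
    qed (rule eL[OF ij(1)])
    also have "\<dots> = (\<Sum>l<n. \<rho> g i l * \<rho> k l j)"
      unfolding \<rho>_def[of g] by (rule sum.cong) (simp_all add: ip_scale_left Lip_right eL gk ij mult.commute)
    finally show ?thesis .
  qed
  have one: "\<rho> \<one> i j = of_bool (i = j)" if ij: "i < n" "j < n" for i j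
  proof -
    have "\<rho> \<one> i j = ip (e j) (e i)"
      unfolding \<rho>_def by (rule ip_cong) (use eL ij in \<open>auto intro: Lip_right\<close>)
    then show ?thesis using eo[OF ij(2,1)] by auto
  qed
  have "\<exists>g\<in>carrier Q. \<exists>i<n. \<exists>j<n. \<rho> g i j \<noteq> of_bool (i = j)"
  proof (rule ccontr)
    assume "\<not> ?thesis"
    then have triv: "\<rho> g i j = of_bool (i = j)" if "g \<in> carrier Q" "i < n" "j < n" for g i j using that by blast
    have const: "e 0 x = e 0 \<one>" if x: "x \<in> carrier Q" for x
    proof -
      have "e 0 (\<one> \<otimes> x) = (\<Sum>i<n. \<rho> x i 0 * e i \<one>)" by (rule right[OF x _ n]) simp
      also have "\<dots> = (\<Sum>i<n. if i = 0 then e i \<one> else 0)"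
        by (rule sum.cong) (use triv[OF x _ n] in auto)
      also have "\<dots> = e 0 \<one>" using n by simp
      finally show ?thesis using x by simp
    qed
    have c1: "conv (e 0) x = 0" if x: "x \<in> carrier Q" for x
    proof -
      have "conv (e 0) x = conv (\<lambda>_. e 0 \<one>) x" by (rule conv_cong[OF eL[OF n] Lip_const const x])
      then show ?thesis using conv_const[OF x] by simp
    qed
    have "e 0 x = 0" if x: "x \<in> carrier Q" for x
    proof -
      have "conv (conv (e 0)) x = conv (\<lambda>_. 0) x" by (rule conv_cong[OF Lip_conv[OF eL[OF n]] Lip_const c1 x])
      then have "top_value * e 0 x = 0" using conv_const[OF x] eE[OF n] x by (simp add: eigenspace_def)
      then show ?thesis using pos by simp
    qed
    then have "ip (e 0) (e 0) = ip (\<lambda>_. 0) (\<lambda>_. 0)"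
      by (intro ip_cong eL[OF n] Lip_const) auto
    then show False using eo[OF n n] by (simp add: ip_def mean_const)
  qed
  then show ?thesis using mult one by (intro exI[of _ n] exI[of _ \<rho>] conjI ballI allI impI) auto
qed

end

section \<open>Finite quotients of finitely generated linear groups\<close>

definition subring_set :: "real set \<Rightarrow> bool" where
  "subring_set A \<longleftrightarrow> 1 \<in> A \<and> (\<forall>a\<in>A. \<forall>b\<in>A. a - b \<in> A \<and> a * b \<in> A)"

definition ideal_of :: "real set \<Rightarrow> real set \<Rightarrow> bool" where
  "ideal_of I A \<longleftrightarrow> I \<subseteq> A \<and> 0 \<in> I \<and> (\<forall>x\<in>I. \<forall>y\<in>I. x + y \<in> I) \<and> (\<forall>a\<in>A. \<forall>x\<in>I. a * x \<in> I)"

definition finite_index :: "real set \<Rightarrow> real set \<Rightarrow> bool" where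
  "finite_index I A \<longleftrightarrow> (\<exists>T. finite T \<and> T \<subseteq> A \<and> (\<forall>a\<in>A. \<exists>t\<in>T. a - t \<in> I))"

definition polys_over :: "real set \<Rightarrow> real poly set" where
  "polys_over I = {f. \<forall>i. coeff f i \<in> I}"

definition adjoin :: "real set \<Rightarrow> real \<Rightarrow> real set" where
  "adjoin A b = (\<lambda>f. poly f b) ` polys_over A"

text \<open>Asking for units instead of nonzero elements in the finite quotients makes the property pass to
  ring extensions: leading coefficients can be inverted there.\<close>
definition residually_finite_ring :: "real set \<Rightarrow> bool" where
  "residually_finite_ring A \<longleftrightarrow> (\<forall>a\<in>A. a \<noteq> 0 \<longrightarrow>
     (\<exists>I. ideal_of I A \<and> finite_index I A \<and> 1 \<notin> I \<and> (\<exists>a'\<in>A. a * a' - 1 \<in> I)))"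

lemma subring_0: "subring_set A \<Longrightarrow> 0 \<in> A"
  unfolding subring_set_def by (metis diff_self)

lemma subring_1: "subring_set A \<Longrightarrow> 1 \<in> A"
  by (simp add: subring_set_def)

lemma subring_diff: "subring_set A \<Longrightarrow> a \<in> A \<Longrightarrow> b \<in> A \<Longrightarrow> a - b \<in> A"
  by (simp add: subring_set_def)

lemma subring_mult: "subring_set A \<Longrightarrow> a \<in> A \<Longrightarrow> b \<in> A \<Longrightarrow> a * b \<in> A"
  by (simp add: subring_set_def)

lemma subring_minus: "subring_set A \<Longrightarrow> a \<in> A \<Longrightarrow> - a \<in> A"
  using subring_diff[of A 0 a] subring_0 by simp

lemma subring_add: "subring_set A \<Longrightarrow> a \<in> A \<Longrightarrow> b \<in> A \<Longrightarrow> a + b \<in> A"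
  using subring_diff[of A a "- b"] subring_minus by simp

lemma subring_power: "subring_set A \<Longrightarrow> a \<in> A \<Longrightarrow> a ^ k \<in> A"
  by (induction k) (auto simp: subring_1 subring_mult)

lemma subring_sum: "subring_set A \<Longrightarrow> (\<And>i. i \<in> J \<Longrightarrow> f i \<in> A) \<Longrightarrow> sum f J \<in> A"
  by (induction J rule: infinite_finite_induct) (auto simp: subring_0 subring_add)

lemma ideal_refl: "subring_set A \<Longrightarrow> ideal_of A A"
  by (simp add: ideal_of_def subring_0 subring_add subring_mult)

lemma ideal_0: "ideal_of I A \<Longrightarrow> 0 \<in> I"
  by (simp add: ideal_of_def)

lemma ideal_add: "ideal_of I A \<Longrightarrow> x \<in> I \<Longrightarrow> y \<in> I \<Longrightarrow> x + y \<in> I"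
  by (simp add: ideal_of_def)

lemma ideal_mult: "ideal_of I A \<Longrightarrow> a \<in> A \<Longrightarrow> x \<in> I \<Longrightarrow> a * x \<in> I"
  by (simp add: ideal_of_def)

lemma ideal_minus: "subring_set A \<Longrightarrow> ideal_of I A \<Longrightarrow> x \<in> I \<Longrightarrow> - x \<in> I"
  using ideal_mult[of I A "- 1" x] subring_minus subring_1 by simp

lemma ideal_diff: "subring_set A \<Longrightarrow> ideal_of I A \<Longrightarrow> x \<in> I \<Longrightarrow> y \<in> I \<Longrightarrow> x - y \<in> I"
  using ideal_add[of I A x "- y"] ideal_minus by simp

lemma ideal_sum: "ideal_of I A \<Longrightarrow> (\<And>i. i \<in> J \<Longrightarrow> f i \<in> I) \<Longrightarrow> sum f J \<in> I"
  by (induction J rule: infinite_finite_induct) (auto simp: ideal_0 ideal_add)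

lemma polys_over_mono: "I \<subseteq> A \<Longrightarrow> polys_over I \<subseteq> polys_over A"
  by (auto simp: polys_over_def)

lemma polys_over_0: "ideal_of I A \<Longrightarrow> 0 \<in> polys_over I"
  by (simp add: polys_over_def ideal_0)

lemma polys_over_add: "ideal_of I A \<Longrightarrow> f \<in> polys_over I \<Longrightarrow> g \<in> polys_over I \<Longrightarrow> f + g \<in> polys_over I"
  by (simp add: polys_over_def ideal_add)

lemma polys_over_diff:
  "subring_set A \<Longrightarrow> ideal_of I A \<Longrightarrow> f \<in> polys_over I \<Longrightarrow> g \<in> polys_over I \<Longrightarrow> f - g \<in> polys_over I"
  by (simp add: polys_over_def ideal_diff)

lemma polys_over_mult: "ideal_of I A \<Longrightarrow> f \<in> polys_over A \<Longrightarrow> g \<in> polys_over I \<Longrightarrow> f * g \<in> polys_over I"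
  unfolding polys_over_def by (auto simp: coeff_mult intro!: ideal_sum ideal_mult)

lemma polys_over_smult: "ideal_of I A \<Longrightarrow> c \<in> A \<Longrightarrow> g \<in> polys_over I \<Longrightarrow> smult c g \<in> polys_over I"
  by (simp add: polys_over_def ideal_mult)

lemma polys_over_monom: "ideal_of I A \<Longrightarrow> c \<in> I \<Longrightarrow> monom c k \<in> polys_over I"
  by (simp add: polys_over_def ideal_0)

lemma polys_over_const: "ideal_of I A \<Longrightarrow> c \<in> I \<Longrightarrow> [:c:] \<in> polys_over I"
  using polys_over_monom[of I A c 0] by (simp add: monom_0)

lemma adjoin_base: "subring_set A \<Longrightarrow> a \<in> A \<Longrightarrow> a \<in> adjoin A b"
  unfolding adjoin_def using polys_over_const[OF ideal_refl] by (intro image_eqI[of _ _ "[:a:]"]) auto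

lemma adjoin_gen:
  assumes "subring_set A"
  shows "b \<in> adjoin A b"
proof -
  have "monom 1 1 \<in> polys_over A" using polys_over_monom[OF ideal_refl] subring_1 assms by blast
  then show ?thesis unfolding adjoin_def by (intro image_eqI[of _ _ "monom 1 1"]) (auto simp: poly_monom)
qed

lemma subring_adjoin:
  assumes A: "subring_set A"
  shows "subring_set (adjoin A b)"
  unfolding subring_set_def
proof (intro conjI ballI)
  show "1 \<in> adjoin A b" by (rule adjoin_base[OF A subring_1[OF A]])
  fix x y assume "x \<in> adjoin A b" "y \<in> adjoin A b"
  then obtain f g where fg: "f \<in> polys_over A" "g \<in> polys_over A" "x = poly f b" "y = poly g b"
    by (auto simp: adjoin_def)
  show "x - y \<in> adjoin A b" unfolding adjoin_def fg poly_diff[symmetric]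
    by (intro imageI polys_over_diff[OF A ideal_refl[OF A]] fg)
  show "x * y \<in> adjoin A b" unfolding adjoin_def fg poly_mult[symmetric]
    by (intro imageI polys_over_mult[OF ideal_refl[OF A]] fg)
qed

text \<open>The coefficients of the quotient and of the remainder are combinations of those of the dividend,
  so they stay in the ideal \<open>K\<close>.\<close>
lemma pseudo_division:
  assumes A: "subring_set A" and K: "ideal_of K A" and g: "g \<in> polys_over A" "g \<noteq> 0"
    and f: "f \<in> polys_over K"
  shows "\<exists>k s w. s \<in> polys_over K \<and> w \<in> polys_over K \<and> smult (lead_coeff g ^ k) f = g * s + w \<and>
     (w = 0 \<or> degree w < degree g)"
  using f
proof (induction "if f = 0 then 0 else Suc (degree f)" arbitrary: f rule: less_induct)
  case less
  show ?case
  proof (cases "f = 0 \<or> degree f < degree g")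
    case True
    then show ?thesis using less.prems polys_over_0[OF K]
      by (intro exI[of _ 0] exI[of _ 0] exI[of _ f]) auto
  next
    case False
    define c l where "c = lead_coeff g" and "l = lead_coeff f"
    have cA: "c \<in> A" using g(1) by (simp add: c_def polys_over_def)
    have lK: "l \<in> K" using less.prems by (simp add: l_def polys_over_def)
    define m where "m = monom l (degree f - degree g)"
    have mK: "m \<in> polys_over K" unfolding m_def by (rule polys_over_monom[OF K lK])
    define f' where "f' = smult c f - g * m"
    have f'K: "f' \<in> polys_over K" unfolding f'_def
      by (intro polys_over_diff[OF A K] polys_over_smult[OF K cA less.prems] polys_over_mult[OF K g(1) mK])
    have l0: "l \<noteq> 0" using False by (simp add: l_def)
    have c0: "c \<noteq> 0" using g(2) by (simp add: c_def)
    have deg: "degree (g * m) = degree f"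
      using False g(2) l0 by (simp add: m_def degree_mult_eq degree_monom_eq)
    have "coeff f' i = 0" if i: "i \<ge> degree f" for i
    proof (cases "i = degree f")
      case True
      have "lead_coeff (g * m) = c * l" using l0 by (simp add: lead_coeff_mult c_def m_def degree_monom_eq)
      then have "coeff (g * m) (degree f) = c * l" using deg by simp
      then show ?thesis using True by (simp add: f'_def l_def)
    next
      case False
      then show ?thesis using i deg by (simp add: f'_def coeff_eq_0)
    qed
    then have small: "f' = 0 \<or> degree f' < degree f"
      by (metis leading_coeff_0_iff not_le)
    have "\<exists>k s w. s \<in> polys_over K \<and> w \<in> polys_over K \<and> smult (lead_coeff g ^ k) f' = g * s + w \<and>
        (w = 0 \<or> degree w < degree g)"
      by (rule less.hyps[OF _ f'K]) (use small False in auto)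
    then obtain k s w where ksw: "s \<in> polys_over K" "w \<in> polys_over K" "smult (c ^ k) f' = g * s + w"
      "w = 0 \<or> degree w < degree g" unfolding c_def by blast
    have "smult (c ^ Suc k) f = smult (c ^ k) f' + smult (c ^ k) (g * m)"
      by (simp add: f'_def smult_diff_right mult.commute)
    also have "\<dots> = g * (s + smult (c ^ k) m) + w" by (simp add: ksw(3) algebra_simps)
    finally have "smult (c ^ Suc k) f = g * (s + smult (c ^ k) m) + w" .
    moreover have "s + smult (c ^ k) m \<in> polys_over K"
      by (intro polys_over_add[OF K ksw(1)] polys_over_smult[OF K _ mK] subring_power[OF A cA])
    ultimately show ?thesis using ksw(2,4) unfolding c_def by blast
  qed
qed

text \<open>The ideal of \<open>A[b]\<close> generated by \<open>I\<close> and \<open>P(b)\<close>. When the leading coefficient of \<open>P\<close> is a unit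
  modulo \<open>I\<close>, the quotient is spanned by finitely many powers of \<open>b\<close> over \<open>A / I\<close>.\<close>
definition extended_ideal :: "real set \<Rightarrow> real set \<Rightarrow> real poly \<Rightarrow> real \<Rightarrow> real set" where
  "extended_ideal A I P b = {poly (u + P * v) b | u v. u \<in> polys_over I \<and> v \<in> polys_over A}"

lemma extended_ideal_ideal:
  assumes A: "subring_set A" and I: "ideal_of I A" and P: "P \<in> polys_over A"
  shows "ideal_of (extended_ideal A I P b) (adjoin A b)"
  unfolding ideal_of_def
proof (intro conjI ballI subsetI)
  have AA: "ideal_of A A" by (rule ideal_refl[OF A])
  have sub: "polys_over I \<subseteq> polys_over A" using I by (intro polys_over_mono) (auto simp: ideal_of_def)
  show "0 \<in> extended_ideal A I P b"
    unfolding extended_ideal_def using polys_over_0[OF I] polys_over_0[OF AA]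
    by (intro CollectI exI[of _ 0]) auto
  fix x assume "x \<in> extended_ideal A I P b"
  then obtain u v where uv: "u \<in> polys_over I" "v \<in> polys_over A" "x = poly (u + P * v) b"
    by (auto simp: extended_ideal_def)
  show "x \<in> adjoin A b"
    unfolding adjoin_def uv(3) using uv sub
    by (intro imageI polys_over_add[OF AA] polys_over_mult[OF AA P]) auto
  { fix y assume "y \<in> extended_ideal A I P b"
    then obtain u' v' where uv': "u' \<in> polys_over I" "v' \<in> polys_over A" "y = poly (u' + P * v') b"
      by (auto simp: extended_ideal_def)
    have "x + y = poly ((u + u') + P * (v + v')) b" by (simp add: uv uv' algebra_simps)
    then show "x + y \<in> extended_ideal A I P b"
      unfolding extended_ideal_def using polys_over_add[OF I uv(1) uv'(1)] polys_over_add[OF AA uv(2) uv'(2)] by blast }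
  { fix a assume "a \<in> adjoin A b"
    then obtain f where f: "f \<in> polys_over A" "a = poly f b" by (auto simp: adjoin_def)
    have "a * x = poly (f * u + P * (f * v)) b" by (simp add: uv f algebra_simps)
    then show "a * x \<in> extended_ideal A I P b"
      unfolding extended_ideal_def using polys_over_mult[OF I f(1) uv(1)] polys_over_mult[OF AA f(1) uv(2)] by blast }
qed

lemma extended_ideal_finite_index:
  assumes A: "subring_set A" and I: "ideal_of I A" and fin: "finite_index I A" and P: "P \<in> polys_over A"
    and unit: "c' \<in> A" "lead_coeff P * c' - 1 \<in> I"
  shows "finite_index (extended_ideal A I P b) (adjoin A b)"
proof -
  have AA: "ideal_of A A" by (rule ideal_refl[OF A])
  have sub: "polys_over I \<subseteq> polys_over A" using I by (intro polys_over_mono) (auto simp: ideal_of_def)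
  define d where "d = degree P"
  define c where "c = lead_coeff P"
  have cA: "c \<in> A" using P by (simp add: c_def polys_over_def)
  have reduce: "\<exists>g u v. g \<in> polys_over A \<and> u \<in> polys_over I \<and> v \<in> polys_over A \<and> f = g + u + P * v \<and>
      (\<forall>i\<ge>d. coeff g i = 0)" if "f \<in> polys_over A" "\<forall>i\<ge>n. coeff f i = 0" for f n
    using that
  proof (induction n arbitrary: f)
    case 0
    then have "f = 0" by (intro poly_eqI) auto
    then show ?case using polys_over_0[OF AA] polys_over_0[OF I]
      by (intro exI[of _ 0]) auto
  next
    case (Suc n)
    show ?case
    proof (cases "n < d")
      case True
      then show ?thesis using Suc.prems polys_over_0[OF AA] polys_over_0[OF I]
        by (intro exI[of _ f] exI[of _ 0]) auto
    next
      case False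
      define l where "l = coeff f n"
      have lA: "l \<in> A" using Suc.prems by (simp add: l_def polys_over_def)
      define v0 where "v0 = monom (l * c') (n - d)"
      have v0: "v0 \<in> polys_over A" unfolding v0_def
        by (intro polys_over_monom[OF AA] subring_mult[OF A lA unit(1)])
      define u0 where "u0 = monom (- (l * (c * c' - 1))) n"
      have u0: "u0 \<in> polys_over I" unfolding u0_def
        by (intro polys_over_monom[OF I] ideal_minus[OF A I] ideal_mult[OF I lA]) (use unit in \<open>simp add: c_def\<close>)
      define f1 where "f1 = f - P * v0 - u0"
      have f1: "f1 \<in> polys_over A" unfolding f1_def
        using u0 sub by (intro polys_over_diff[OF A AA] Suc.prems(1) polys_over_mult[OF AA P v0]) auto
      have "coeff f1 i = 0" if i: "i \<ge> n" for i
      proof -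
        have co: "coeff (P * v0) i = (if n - d \<le> i then (l * c') * coeff P (i - (n - d)) else 0)"
          unfolding v0_def by (simp add: mult.commute[of P] coeff_monom_mult)
        show ?thesis
        proof (cases "i = n")
          case True
          then have "coeff (P * v0) i = l * c' * c" using co False by (simp add: c_def d_def)
          then show ?thesis using True by (simp add: f1_def u0_def l_def[symmetric] algebra_simps)
        next
          case ne: False
          then have "coeff P (i - (n - d)) = 0" using i False by (intro coeff_eq_0) (auto simp: d_def)
          then show ?thesis using ne i Suc.prems(2) co by (simp add: f1_def u0_def)
        qed
      qed
      then obtain g u v where guv: "g \<in> polys_over A" "u \<in> polys_over I" "v \<in> polys_over A" "f1 = g + u + P * v"
        "\<forall>i\<ge>d. coeff g i = 0" using Suc.IH[OF f1] by blast
      have "f = g + (u + u0) + P * (v + v0)"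
      proof -
        have "f = f1 + P * v0 + u0" by (simp add: f1_def)
        then show ?thesis by (simp add: guv(4) algebra_simps)
      qed
      then show ?thesis using guv polys_over_add[OF I guv(2) u0] polys_over_add[OF AA guv(3) v0] by blast
    qed
  qed
  obtain T where T: "finite T" "T \<subseteq> A" "\<forall>a\<in>A. \<exists>t\<in>T. a - t \<in> I" using fin by (auto simp: finite_index_def)
  define R where "R = (\<lambda>ts. poly (Poly ts) b) ` {ts. set ts \<subseteq> T \<and> length ts = d}"
  have "finite R" unfolding R_def by (intro finite_imageI finite_lists_length_eq T(1))
  moreover have "R \<subseteq> adjoin A b"
  proof
    fix x assume "x \<in> R"
    then obtain ts where ts: "set ts \<subseteq> T" "x = poly (Poly ts) b" by (auto simp: R_def)
    have "Poly ts \<in> polys_over A"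
      using subset_trans[OF ts(1) T(2)] subring_0[OF A] by (auto simp: subset_iff polys_over_def coeff_Poly_eq nth_default_def)
    then show "x \<in> adjoin A b" using ts(2) by (auto simp: adjoin_def)
  qed
  moreover have "\<exists>t\<in>R. x - t \<in> extended_ideal A I P b" if x: "x \<in> adjoin A b" for x
  proof -
    obtain f where f: "f \<in> polys_over A" "x = poly f b" using x by (auto simp: adjoin_def)
    have "\<forall>i\<ge>Suc (degree f). coeff f i = 0" by (simp add: coeff_eq_0)
    then obtain g u v where guv: "g \<in> polys_over A" "u \<in> polys_over I" "v \<in> polys_over A" "f = g + u + P * v"
        "\<forall>i\<ge>d. coeff g i = 0" using reduce[OF f(1)] by blast
    define rep where "rep a = (SOME t. t \<in> T \<and> a - t \<in> I)" for a
    have rep: "rep a \<in> T \<and> a - rep a \<in> I" if "a \<in> A" for a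
      unfolding rep_def by (rule someI_ex) (use T(3) that in blast)
    define ts where "ts = map (\<lambda>i. rep (coeff g i)) [0..<d]"
    have gA: "coeff g i \<in> A" for i using guv(1) by (simp add: polys_over_def)
    have "poly (Poly ts) b \<in> R" unfolding R_def by (intro imageI) (use rep[OF gA] in \<open>auto simp: ts_def\<close>)
    moreover have "g - Poly ts \<in> polys_over I"
      unfolding polys_over_def
    proof (intro CollectI allI)
      fix i
      show "coeff (g - Poly ts) i \<in> I"
        using rep[OF gA, of i] guv(5) ideal_0[OF I]
        by (cases "i < d") (auto simp: coeff_Poly_eq nth_default_def ts_def)
    qed
    then have "x - poly (Poly ts) b \<in> extended_ideal A I P b"
      unfolding extended_ideal_def using polys_over_add[OF I _ guv(2)] guv(3)
      by (intro CollectI exI[of _ "g - Poly ts + u"] exI[of _ v]) (simp add: f(2) guv(4))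
    ultimately show ?thesis by blast
  qed
  ultimately show ?thesis unfolding finite_index_def by blast
qed

lemma unit_cancel:
  assumes A: "subring_set A" and I: "ideal_of I A" and c: "c \<in> A" "c' \<in> A" "c * c' - 1 \<in> I"
    and x: "x \<in> A" "c * x \<in> I"
  shows "x \<in> I"
proof -
  have "c' * (c * x) - x * (c * c' - 1) \<in> I"
    by (rule ideal_diff[OF A I ideal_mult[OF I c(2) x(2)] ideal_mult[OF I x(1) c(3)]])
  then show ?thesis by (simp add: algebra_simps)
qed

lemma unit_power_cancel:
  assumes A: "subring_set A" and I: "ideal_of I A" and c: "c \<in> A" "c' \<in> A" "c * c' - 1 \<in> I"
  shows "c ^ k \<in> I \<Longrightarrow> 1 \<in> I"
proof (induction k)
  case (Suc k)
  have "c ^ k \<in> I"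
    by (rule unit_cancel[OF A I c subring_power[OF A c(1)]]) (use Suc.prems in simp)
  then show ?case by (rule Suc.IH)
qed simp

text \<open>If \<open>k\<close> is the largest index of a coefficient of \<open>v\<close> outside of
  \<open>I\<close>, then modulo \<open>I\<close> the coefficient of \<open>P * v\<close> at \<open>degree P
  + k\<close> is a unit times that coefficient.\<close>
lemma multiple_with_unit_lead:
  assumes A: "subring_set A" and I: "ideal_of I A" and P: "P \<in> polys_over A" and v: "v \<in> polys_over A"
    and unit: "c' \<in> A" "lead_coeff P * c' - 1 \<in> I"
    and small: "\<And>i. i \<ge> degree P \<Longrightarrow> coeff (P * v) i \<in> I"
  shows "v \<in> polys_over I"
proof (rule ccontr)
  assume "v \<notin> polys_over I"
  then obtain k0 where k0: "coeff v k0 \<notin> I" by (auto simp: polys_over_def)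
  have bound: "coeff v k \<notin> I \<Longrightarrow> k \<le> degree v" for k
    using ideal_0[OF I] by (metis coeff_eq_0 not_le)
  define k where "k = Max {k. coeff v k \<notin> I}"
  have fin: "finite {k. coeff v k \<notin> I}" by (rule finite_subset[of _ "{..degree v}"]) (use bound in auto)
  have k: "coeff v k \<notin> I" using Max_in[OF fin] k0 unfolding k_def by blast
  have above: "coeff v m \<in> I" if "m > k" for m
    using Max_ge[OF fin, of m] that unfolding k_def by force
  have PA: "coeff P i \<in> A" "coeff v i \<in> A" for i using P v by (auto simp: polys_over_def)
  let ?n = "degree P"
  have "coeff (P * v) (?n + k) = (\<Sum>i\<le>?n + k. coeff P i * coeff v (?n + k - i))" by (rule coeff_mult)
  also have "\<dots> = coeff P ?n * coeff v (?n + k - ?n) + (\<Sum>i\<in>{..?n + k} - {?n}. coeff P i * coeff v (?n + k - i))"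
    by (rule sum.remove) auto
  finally have "coeff P ?n * coeff v k
      = coeff (P * v) (?n + k) - (\<Sum>i\<in>{..?n + k} - {?n}. coeff P i * coeff v (?n + k - i))" by simp
  moreover have "\<dots> \<in> I"
  proof (intro ideal_diff[OF A I] ideal_sum[OF I])
    show "coeff (P * v) (?n + k) \<in> I" by (rule small) simp
    fix i assume i: "i \<in> {..?n + k} - {?n}"
    show "coeff P i * coeff v (?n + k - i) \<in> I"
    proof (cases "i < ?n")
      case True
      then show ?thesis by (intro ideal_mult[OF I PA(1)] above) auto
    next
      case False
      then have "coeff P i = 0" using i by (intro coeff_eq_0) auto
      then show ?thesis using ideal_0[OF I] by simp
    qed
  qed
  ultimately have "coeff P ?n * coeff v k \<in> I" by simp
  then have "coeff v k \<in> I" by (intro unit_cancel[OF A I PA(1) unit PA(2)])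
  then show False using k by simp
qed

text \<open>A prime larger than \<open>\<bar>a\<bar>\<close> does not divide \<open>a\<close>.\<close>
lemma residually_finite_Ints: "residually_finite_ring \<int>"
  unfolding residually_finite_ring_def
proof (intro ballI impI)
  fix a :: real assume a: "a \<in> \<int>" "a \<noteq> 0"
  then obtain z where z: "a = of_int z" by (auto elim: Ints_cases)
  then have z0: "z \<noteq> 0" using a by simp
  obtain p where p: "prime p" "nat \<bar>z\<bar> < p" using bigger_prime by blast
  define q where "q = int p"
  have q: "q > 1" "\<bar>z\<bar> < q" using p prime_gt_1_nat[OF p(1)] by (auto simp: q_def)
  have "prime q" using p(1) by (simp add: q_def)
  moreover have "\<not> q dvd z" using z0 q zdvd_imp_le[of q "\<bar>z\<bar>"] by auto
  ultimately have "coprime q z" by (rule prime_imp_coprime)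
  then obtain u v where uv: "u * q + v * z = 1" using bezout_int[of q z] by (auto simp: coprime_iff_gcd_eq_1)
  define I where "I = range (\<lambda>k. of_int (q * k) :: real)"
  have in_I: "of_int m \<in> I \<longleftrightarrow> q dvd m" for m
  proof -
    have "of_int m \<in> I \<longleftrightarrow> (\<exists>k. (of_int m :: real) = of_int (q * k))" unfolding I_def by blast
    also have "\<dots> \<longleftrightarrow> q dvd m" unfolding of_int_eq_iff dvd_def ..
    finally show ?thesis .
  qed
  have IZ: "x \<in> I \<longleftrightarrow> (\<exists>m. x = of_int m \<and> q dvd m)" for x
    using in_I unfolding I_def dvd_def by (metis imageE rangeI)
  show "\<exists>I. ideal_of I \<int> \<and> finite_index I \<int> \<and> 1 \<notin> I \<and> (\<exists>a'\<in>\<int>. a * a' - 1 \<in> I)"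
  proof (intro exI[of _ I] conjI)
    show "ideal_of I \<int>"
      unfolding ideal_of_def
    proof (intro conjI ballI)
      show "I \<subseteq> \<int>" by (auto simp: IZ)
      show "0 \<in> I" using in_I[of 0] by simp
      show "x + y \<in> I" if xy: "x \<in> I" "y \<in> I" for x y
      proof -
        obtain m l where "x = of_int m" "q dvd m" "y = of_int l" "q dvd l" using xy IZ by metis
        then show ?thesis using in_I[of "m + l"] by simp
      qed
      show "b * x \<in> I" if bx: "b \<in> \<int>" "x \<in> I" for b x
      proof -
        obtain m l where "x = of_int m" "q dvd m" "b = of_int l" using bx IZ by (metis Ints_cases)
        then show ?thesis using in_I[of "l * m"] by simp
      qed
    qed
    show "finite_index I \<int>"
      unfolding finite_index_def
    proof (intro exI[of _ "of_int ` {0..<q}"] conjI ballI)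
      fix x :: real assume "x \<in> \<int>"
      then obtain m where m: "x = of_int m" by (auto elim: Ints_cases)
      have "of_int (m - m mod q) \<in> I" unfolding in_I by (rule dvd_minus_mod)
      then show "\<exists>t\<in>of_int ` {0..<q}. x - t \<in> I"
        using q by (intro bexI[of _ "of_int (m mod q)"]) (auto simp: m)
    qed auto
    show "1 \<notin> I" using in_I[of 1] q zdvd_imp_le[of q 1] by auto
    show "\<exists>a'\<in>\<int>. a * a' - 1 \<in> I"
    proof (intro bexI[of _ "of_int v"])
      have "z * v - 1 = q * (- u)" using uv by (simp add: algebra_simps)
      then have "q dvd z * v - 1" by simp
      then show "a * of_int v - 1 \<in> I" using in_I[of "z * v - 1"] by (simp add: z)
    qed simp
  qed
qed

text \<open>For \<open>r = f(b)\<close> the relation \<open>b * f(b) = 1\<close> is imposed, which makes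
  \<open>r\<close> a unit with inverse \<open>b\<close>. Modulo an ideal of \<open>A\<close> in which the
  leading coefficient of \<open>f\<close> is a unit, the quotient is finite. It is not zero, because
  \<open>b\<close> behaves as an indeterminate and the imposed polynomial is not constant modulo the
  ideal.\<close>
lemma residually_finite_adjoin_transcendental:
  assumes A: "subring_set A" and rf: "residually_finite_ring A"
    and tr: "\<And>P. P \<in> polys_over A \<Longrightarrow> P \<noteq> 0 \<Longrightarrow> poly P b \<noteq> 0"
  shows "residually_finite_ring (adjoin A b)"
  unfolding residually_finite_ring_def
proof (intro ballI impI)
  fix r assume r: "r \<in> adjoin A b" "r \<noteq> 0"
  have AA: "ideal_of A A" by (rule ideal_refl[OF A])
  obtain f where f: "f \<in> polys_over A" "r = poly f b" using r by (auto simp: adjoin_def)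
  have f0: "f \<noteq> 0" using r f by auto
  have "lead_coeff f \<in> A" "lead_coeff f \<noteq> 0" using f(1) f0 by (auto simp: polys_over_def)
  then obtain I c' where I: "ideal_of I A" "finite_index I A" "1 \<notin> I" "c' \<in> A" "lead_coeff f * c' - 1 \<in> I"
    using rf unfolding residually_finite_ring_def by blast
  define P where "P = pCons (- 1) f"
  have lead: "lead_coeff P = lead_coeff f" and deg: "degree P = Suc (degree f)" using f0 by (auto simp: P_def)
  have P: "P \<in> polys_over A"
    using f(1) subring_minus[OF A subring_1[OF A]] by (auto simp: P_def polys_over_def coeff_pCons split: nat.split)
  have unit: "lead_coeff P * c' - 1 \<in> I" unfolding lead by (rule I(5))
  let ?J = "extended_ideal A I P b"
  show "\<exists>J. ideal_of J (adjoin A b) \<and> finite_index J (adjoin A b) \<and> 1 \<notin> J \<and> (\<exists>r'\<in>adjoin A b. r * r' - 1 \<in> J)"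
  proof (intro exI[of _ ?J] conjI)
    show "ideal_of ?J (adjoin A b)" by (rule extended_ideal_ideal[OF A I(1) P])
    show "finite_index ?J (adjoin A b)" by (rule extended_ideal_finite_index[OF A I(1,2) P I(4) unit])
    show "\<exists>r'\<in>adjoin A b. r * r' - 1 \<in> ?J"
    proof (intro bexI[of _ b] adjoin_gen[OF A])
      have "[:1:] \<in> polys_over A" by (rule polys_over_const[OF AA subring_1[OF A]])
      then show "r * b - 1 \<in> ?J"
        unfolding extended_ideal_def using polys_over_0[OF I(1)]
        by (intro CollectI exI[of _ 0] exI[of _ "[:1:]"]) (simp add: P_def f(2) algebra_simps)
    qed
    show "1 \<notin> ?J"
    proof
      assume "1 \<in> ?J"
      then obtain u v where uv: "u \<in> polys_over I" "v \<in> polys_over A" "poly (u + P * v) b = 1"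
        by (auto simp: extended_ideal_def)
      have u: "u \<in> polys_over A" using uv(1) polys_over_mono[of I A] I(1) by (auto simp: ideal_of_def)
      have "[:1:] - (u + P * v) \<in> polys_over A"
        by (intro polys_over_diff[OF A AA] polys_over_add[OF AA] polys_over_mult[OF AA] polys_over_const[OF AA]
            subring_1[OF A] u P uv(2))
      moreover have "poly ([:1:] - (u + P * v)) b = 0" using uv(3) by simp
      ultimately have "[:1:] - (u + P * v) = 0" using tr by blast
      then have eq: "P * v = [:1:] - u" by (simp add: algebra_simps)
      have "v \<in> polys_over I"
      proof (rule multiple_with_unit_lead[OF A I(1) P uv(2) I(4) unit])
        fix i assume "i \<ge> degree P"
        then have "i > 0" using deg by simp
        then have "coeff [:1 :: real:] i = 0" by (cases i) auto
        then have "coeff (P * v) i = - coeff u i" by (simp add: eq)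
        then show "coeff (P * v) i \<in> I" using uv(1) ideal_minus[OF A I(1)] by (simp add: polys_over_def)
      qed
      then have "u + P * v \<in> polys_over I" by (intro polys_over_add[OF I(1) uv(1)] polys_over_mult[OF I(1) P])
      then have "[:1:] \<in> polys_over I" by (simp add: eq)
      then have "coeff [:1:] 0 \<in> I" unfolding polys_over_def by blast
      then show False using I(3) by simp
    qed
  qed
qed

text \<open>Among the polynomials over \<open>A\<close> whose value at \<open>b\<close> is a nonzero
  multiple of \<open>r\<close>, one of least degree is a constant: otherwise the remainder of
  \<open>P\<close> upon division by it either has smaller degree and the same property, or it has the root
  \<open>b\<close>; in the latter case it is zero by minimality of \<open>P\<close>, and the quotient is a
  polynomial of smaller degree than \<open>P\<close> with root \<open>b\<close>.\<close>
lemma nonzero_multiple_in_base: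
  assumes A: "subring_set A" and P: "P \<in> polys_over A" "P \<noteq> 0" "poly P b = 0"
    and min: "\<And>F. F \<in> polys_over A \<Longrightarrow> F \<noteq> 0 \<Longrightarrow> poly F b = 0 \<Longrightarrow> degree P \<le> degree F"
    and r: "r \<in> adjoin A b" "r \<noteq> 0"
  shows "\<exists>s\<in>adjoin A b. r * s \<in> A \<and> r * s \<noteq> 0"
proof -
  have AA: "ideal_of A A" by (rule ideal_refl[OF A])
  have B: "subring_set (adjoin A b)" by (rule subring_adjoin[OF A])
  have inB: "F \<in> polys_over A \<Longrightarrow> poly F b \<in> adjoin A b" for F by (simp add: adjoin_def)
  have leadA: "F \<in> polys_over A \<Longrightarrow> lead_coeff F ^ k \<in> A" for F k
    by (rule subring_power[OF A]) (simp add: polys_over_def)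
  define good where "good q \<longleftrightarrow> q \<in> polys_over A \<and> poly q b \<noteq> 0 \<and> (\<exists>s\<in>adjoin A b. poly q b = r * s)" for q
  obtain f where f: "f \<in> polys_over A" "r = poly f b" using r by (auto simp: adjoin_def)
  have "good f" unfolding good_def using f r subring_1[OF B] by (auto intro!: bexI[of _ 1])
  then obtain q where q: "good q" "\<And>q'. good q' \<Longrightarrow> degree q \<le> degree q'"
    using ex_has_least_nat[of good f degree] by blast
  obtain s0 where s0: "s0 \<in> adjoin A b" "poly q b = r * s0" using q(1) by (auto simp: good_def)
  have qA: "q \<in> polys_over A" "poly q b \<noteq> 0" using q(1) by (auto simp: good_def)
  have q0: "q \<noteq> 0" using qA by auto
  have P1: "degree P > 0"
  proof (rule ccontr)
    assume "\<not> ?thesis"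
    then obtain c where "P = [:c:]" by (auto elim: degree_eq_zeroE)
    then show False using P by auto
  qed
  have degq: "degree q < degree P"
  proof (rule ccontr)
    assume nl: "\<not> ?thesis"
    obtain k s w where ksw: "s \<in> polys_over A" "w \<in> polys_over A" "smult (lead_coeff P ^ k) q = P * s + w"
      "w = 0 \<or> degree w < degree P" using pseudo_division[OF A AA P(1,2) qA(1)] by blast
    have "poly (smult (lead_coeff P ^ k) q) b = poly (P * s + w) b" using ksw(3) by (rule arg_cong)
    then have wb: "poly w b = lead_coeff P ^ k * poly q b" using P(3) by simp
    have "good w"
      unfolding good_def
    proof (intro conjI bexI[of _ "lead_coeff P ^ k * s0"])
      show "poly w b \<noteq> 0" using wb qA(2) P(2) by simp
      show "poly w b = r * (lead_coeff P ^ k * s0)" using wb s0 by simp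
      show "lead_coeff P ^ k * s0 \<in> adjoin A b"
        by (intro subring_mult[OF B] adjoin_base[OF A] leadA P s0)
    qed (rule ksw(2))
    then have "degree q \<le> degree w" by (rule q(2))
    moreover have "w \<noteq> 0" using \<open>good w\<close> by (auto simp: good_def)
    ultimately show False using ksw(4) nl by simp
  qed
  obtain k s w where ksw: "s \<in> polys_over A" "w \<in> polys_over A" "smult (lead_coeff q ^ k) P = q * s + w"
    "w = 0 \<or> degree w < degree q" using pseudo_division[OF A AA qA(1) q0 P(1)] by blast
  have "poly (smult (lead_coeff q ^ k) P) b = poly (q * s + w) b" using ksw(3) by (rule arg_cong)
  then have wb: "poly w b = - (poly q b * poly s b)" using P(3) by simp
  have "w = 0"
  proof (rule ccontr)
    assume w0: "w \<noteq> 0"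
    then have small: "degree w < degree q" using ksw(4) by simp
    have "poly w b \<noteq> 0" using min[OF ksw(2) w0] small degq by linarith
    moreover have "poly w b = r * (s0 * (- poly s b))" using wb s0 by simp
    moreover have "s0 * (- poly s b) \<in> adjoin A b"
      by (intro subring_mult[OF B] subring_minus[OF B] s0 inB ksw(1))
    ultimately have "good w" unfolding good_def using ksw(2) by blast
    then show False using q(2) small by fastforce
  qed
  then have eq: "smult (lead_coeff q ^ k) P = q * s" and sb: "poly s b = 0" using ksw(3) wb qA(2) by auto
  have s00: "s \<noteq> 0" using eq P(2) q0 by auto
  have "degree P = degree q + degree s" using arg_cong[OF eq, of degree] q0 s00 by (simp add: degree_mult_eq)
  moreover have "degree P \<le> degree s" by (rule min[OF ksw(1) s00 sb])
  ultimately have "degree q = 0" by simp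
  then obtain a where a: "q = [:a:]" by (auto elim: degree_eq_zeroE)
  have "coeff q 0 \<in> A" using qA(1) by (simp add: polys_over_def)
  then have "r * s0 \<in> A" "r * s0 \<noteq> 0" using s0 qA(2) a by auto
  then show ?thesis using s0(1) by blast
qed

text \<open>Let \<open>P\<close> have least degree among the polynomials with root \<open>b\<close>, and let
  \<open>r * s\<close> be a nonzero multiple of \<open>r\<close> in \<open>A\<close>. An ideal
  \<open>I\<close> of \<open>A\<close> modulo which both \<open>r * s\<close> and the leading coefficient
  \<open>c\<close> of \<open>P\<close> are units generates an ideal of \<open>A[b]\<close> with finite
  quotient, in which \<open>r\<close> is a unit. It is proper: a relation \<open>1 = u(b)\<close> with
  \<open>u\<close> over \<open>I\<close> becomes, after division by \<open>P\<close>, a relation \<open>c ^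
  k = w(b)\<close> with \<open>w\<close> over \<open>I\<close> of degree less than that of \<open>P\<close>,
  so \<open>w\<close> is the constant \<open>c ^ k\<close>.\<close>
lemma residually_finite_adjoin_algebraic:
  assumes A: "subring_set A" and rf: "residually_finite_ring A"
    and F: "F \<in> polys_over A" "F \<noteq> 0" "poly F b = 0"
  shows "residually_finite_ring (adjoin A b)"
  unfolding residually_finite_ring_def
proof (intro ballI impI)
  fix r assume r: "r \<in> adjoin A b" "r \<noteq> 0"
  have AA: "ideal_of A A" by (rule ideal_refl[OF A])
  have B: "subring_set (adjoin A b)" by (rule subring_adjoin[OF A])
  obtain P where P: "P \<in> polys_over A" "P \<noteq> 0" "poly P b = 0"
    and min: "\<And>F. F \<in> polys_over A \<Longrightarrow> F \<noteq> 0 \<Longrightarrow> poly F b = 0 \<Longrightarrow> degree P \<le> degree F"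
    using ex_has_least_nat[of "\<lambda>F. F \<in> polys_over A \<and> F \<noteq> 0 \<and> poly F b = 0" F degree] F by blast
  obtain s where s: "s \<in> adjoin A b" "r * s \<in> A" "r * s \<noteq> 0"
    using nonzero_multiple_in_base[OF A P min r] by blast
  define c where "c = lead_coeff P"
  have cA: "c \<in> A" and c0: "c \<noteq> 0" using P by (auto simp: c_def polys_over_def)
  have "(r * s) * c \<in> A" "(r * s) * c \<noteq> 0" using s cA c0 subring_mult[OF A] by auto
  then obtain I x where I: "ideal_of I A" "finite_index I A" "1 \<notin> I" "x \<in> A" "(r * s) * c * x - 1 \<in> I"
    using rf unfolding residually_finite_ring_def by blast
  have c': "(r * s) * x \<in> A" by (rule subring_mult[OF A s(2) I(4)])
  have unit: "c * ((r * s) * x) - 1 \<in> I" using I(5) by (simp add: ac_simps)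
  let ?J = "extended_ideal A I P b"
  show "\<exists>J. ideal_of J (adjoin A b) \<and> finite_index J (adjoin A b) \<and> 1 \<notin> J \<and> (\<exists>r'\<in>adjoin A b. r * r' - 1 \<in> J)"
  proof (intro exI[of _ ?J] conjI)
    show "ideal_of ?J (adjoin A b)" by (rule extended_ideal_ideal[OF A I(1) P(1)])
    show "finite_index ?J (adjoin A b)"
      by (rule extended_ideal_finite_index[OF A I(1,2) P(1) c' unit[unfolded c_def]])
    show "\<exists>r'\<in>adjoin A b. r * r' - 1 \<in> ?J"
    proof (intro bexI[of _ "s * (c * x)"])
      show "s * (c * x) \<in> adjoin A b"
        by (intro subring_mult[OF B s(1)] adjoin_base[OF A] subring_mult[OF A] cA I(4))
      have "[:(r * s) * c * x - 1:] \<in> polys_over I" by (rule polys_over_const[OF I(1,5)])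
      then show "r * (s * (c * x)) - 1 \<in> ?J"
        unfolding extended_ideal_def using polys_over_0[OF AA]
        by (intro CollectI exI[of _ "[:(r * s) * c * x - 1:]"] exI[of _ 0]) (simp add: ac_simps)
    qed
    show "1 \<notin> ?J"
    proof
      assume "1 \<in> ?J"
      then obtain u v where uv: "u \<in> polys_over I" "poly (u + P * v) b = 1" by (auto simp: extended_ideal_def)
      then have ub: "poly u b = 1" using P(3) by simp
      obtain k t w where ktw: "w \<in> polys_over I" "smult (c ^ k) u = P * t + w" "w = 0 \<or> degree w < degree P"
        using pseudo_division[OF A I(1) P(1,2) uv(1)] unfolding c_def by blast
      have "poly (smult (c ^ k) u) b = poly (P * t + w) b" using ktw(2) by (rule arg_cong)
      then have wb: "poly w b = c ^ k" using P(3) ub by simp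
      have ck: "c ^ k \<in> A" by (rule subring_power[OF A cA])
      have w0: "w \<noteq> 0" using wb c0 by auto
      then have "degree w < degree P" using ktw(3) by simp
      then have "degree (w - [:c ^ k:]) < degree P" by (intro degree_diff_less) auto
      moreover have "w - [:c ^ k:] \<in> polys_over A"
        using ktw(1) polys_over_mono[of I A] I(1)
        by (intro polys_over_diff[OF A AA] polys_over_const[OF AA ck]) (auto simp: ideal_of_def)
      moreover have "poly (w - [:c ^ k:]) b = 0" using wb by simp
      ultimately have "w - [:c ^ k:] = 0" using min not_le by blast
      then have "w = [:c ^ k:]" by simp
      then have "c ^ k \<in> I" using ktw(1) unfolding polys_over_def by (auto dest: spec[of _ 0])
      then show False using unit_power_cancel[OF A I(1) cA c' unit] I(3) by blast
    qed
  qed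
qed

lemma finite_set_in_residually_finite_ring:
  assumes "finite F"
  shows "\<exists>B. subring_set B \<and> residually_finite_ring B \<and> F \<subseteq> B"
  using assms
proof (induction F rule: finite_induct)
  case empty
  have "subring_set \<int>" by (auto simp: subring_set_def)
  then show ?case using residually_finite_Ints by blast
next
  case (insert b F)
  then obtain A where A: "subring_set A" "residually_finite_ring A" "F \<subseteq> A" by blast
  have "residually_finite_ring (adjoin A b)"
  proof (cases "\<exists>P\<in>polys_over A. P \<noteq> 0 \<and> poly P b = 0")
    case True
    then show ?thesis using residually_finite_adjoin_algebraic[OF A(1,2)] by blast
  next
    case False
    then show ?thesis by (intro residually_finite_adjoin_transcendental[OF A(1,2)]) blast
  qed
  moreover have "insert b F \<subseteq> adjoin A b" using adjoin_gen[OF A(1)] adjoin_base[OF A(1)] A(3) by blast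
  ultimately show ?case using subring_adjoin[OF A(1)] by blast
qed

text \<open>The subgroup consists of the elements whose matrices are congruent to the identity modulo an
  ideal of finite index in a ring that contains all entries. The ideal is chosen such that some entry that
  distinguishes an element from the identity stays nonzero in the quotient.\<close>
theorem linear_group_finite_quotient:
  fixes Q :: "('g, 'h) monoid_scheme" (structure) and \<rho> :: "'g \<Rightarrow> nat \<Rightarrow> nat \<Rightarrow> real"
  assumes "group Q" and fg: "finitely_generated_group Q"
    and mult: "\<And>g k i j. g \<in> carrier Q \<Longrightarrow> k \<in> carrier Q \<Longrightarrow> i < n \<Longrightarrow> j < n \<Longrightarrow> \<rho> (g \<otimes> k) i j = (\<Sum>l<n. \<rho> g i l * \<rho> k l j)"
    and one: "\<And>i j. i < n \<Longrightarrow> j < n \<Longrightarrow> \<rho> \<one> i j = of_bool (i = j)"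
    and nontrivial: "\<exists>g\<in>carrier Q. \<exists>i<n. \<exists>j<n. \<rho> g i j \<noteq> of_bool (i = j)"
  shows "\<exists>H. H \<lhd> Q \<and> finite (carrier (Q Mod H)) \<and> H \<noteq> carrier Q"
proof -
  interpret group Q by fact
  obtain S where S: "finite S" "S \<subseteq> carrier Q" "generate Q S = carrier Q"
    using fg by (auto simp: finitely_generated_group_def)
  define F where "F = (\<lambda>(s, i, j). \<rho> s i j) ` ((S \<union> (\<lambda>s. inv s) ` S) \<times> {..<n} \<times> {..<n})"
  have "finite F" unfolding F_def using S(1) by auto
  then obtain B where B: "subring_set B" "residually_finite_ring B" "F \<subseteq> B"
    using finite_set_in_residually_finite_ring by blast
  have FB: "\<rho> s i j \<in> B" if "s \<in> S \<union> (\<lambda>s. inv s) ` S" "i < n" "j < n" for s i j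
    using that by (intro subsetD[OF B(3)]) (auto simp: F_def intro!: image_eqI[of _ _ "(s, i, j)"])
  have delta: "of_bool b \<in> B" for b using subring_0[OF B(1)] subring_1[OF B(1)] by (cases b) auto
  have entries': "g \<in> generate Q S \<Longrightarrow> \<forall>i<n. \<forall>j<n. \<rho> g i j \<in> B" for g
  proof (induction rule: generate.induct)
    case one
    then show ?case using assms(4) delta by simp
  next
    case (eng h1 h2)
    have "h1 \<in> carrier Q" "h2 \<in> carrier Q" using eng.hyps S(3) by auto
    then show ?case using eng.IH by (auto simp: mult intro!: subring_sum[OF B(1)] subring_mult[OF B(1)])
  qed (use FB in auto)
  have entries: "\<rho> g i j \<in> B" if "g \<in> carrier Q" "i < n" "j < n" for g i j
    using entries'[of g] that S(3) by simp
  obtain g0 i0 j0 where g0: "g0 \<in> carrier Q" "i0 < n" "j0 < n" "\<rho> g0 i0 j0 \<noteq> of_bool (i0 = j0)"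
    using nontrivial by blast
  define r where "r = \<rho> g0 i0 j0 - of_bool (i0 = j0)"
  have r: "r \<in> B" "r \<noteq> 0"
    unfolding r_def by (intro subring_diff[OF B(1)] entries delta g0) (metis g0(4) right_minus_eq)
  then obtain I r' where I: "ideal_of I B" "finite_index I B" "1 \<notin> I" "r' \<in> B" "r * r' - 1 \<in> I"
    using B(2) unfolding residually_finite_ring_def by blast
  define eqv where "eqv g h \<longleftrightarrow> (\<forall>i<n. \<forall>j<n. \<rho> g i j - \<rho> h i j \<in> I)" for g h
  have eqv_sym: "eqv g h \<Longrightarrow> eqv h g" for g h
    unfolding eqv_def using ideal_minus[OF B(1) I(1)] by (metis minus_diff_eq)
  have eqv_trans: "eqv g k" if "eqv g h" "eqv h k" for g h k
    unfolding eqv_def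
  proof (intro allI impI)
    fix i j assume "i < n" "j < n"
    then have "(\<rho> g i j - \<rho> h i j) + (\<rho> h i j - \<rho> k i j) \<in> I"
      using that unfolding eqv_def by (intro ideal_add[OF I(1)]) auto
    then show "\<rho> g i j - \<rho> k i j \<in> I" by simp
  qed
  have eqv_right: "eqv (g \<otimes> k) (h \<otimes> k)"
    if e: "eqv g h" and Q: "g \<in> carrier Q" "h \<in> carrier Q" "k \<in> carrier Q" for g h k
    unfolding eqv_def
  proof (intro allI impI)
    fix i j assume ij: "i < n" "j < n"
    have "\<rho> (g \<otimes> k) i j - \<rho> (h \<otimes> k) i j = (\<Sum>l<n. \<rho> k l j * (\<rho> g i l - \<rho> h i l))"
      using Q ij by (simp add: mult algebra_simps flip: sum_subtractf)
    also have "\<dots> \<in> I" using e ij Q unfolding eqv_def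
      by (intro ideal_sum[OF I(1)] ideal_mult[OF I(1)] entries) auto
    finally show "\<rho> (g \<otimes> k) i j - \<rho> (h \<otimes> k) i j \<in> I" .
  qed
  have eqv_left: "eqv (k \<otimes> g) (k \<otimes> h)"
    if e: "eqv g h" and Q: "g \<in> carrier Q" "h \<in> carrier Q" "k \<in> carrier Q" for g h k
    unfolding eqv_def
  proof (intro allI impI)
    fix i j assume ij: "i < n" "j < n"
    have "\<rho> (k \<otimes> g) i j - \<rho> (k \<otimes> h) i j = (\<Sum>l<n. \<rho> k i l * (\<rho> g l j - \<rho> h l j))"
      using Q ij by (simp add: mult algebra_simps flip: sum_subtractf)
    also have "\<dots> \<in> I" using e ij Q unfolding eqv_def
      by (intro ideal_sum[OF I(1)] ideal_mult[OF I(1)] entries) auto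
    finally show "\<rho> (k \<otimes> g) i j - \<rho> (k \<otimes> h) i j \<in> I" .
  qed
  define H where "H = {g \<in> carrier Q. eqv g \<one>}"
  have H: "subgroup H Q"
  proof (rule subgroupI)
    show "H \<subseteq> carrier Q" by (auto simp: H_def)
    have "\<one> \<in> H" using ideal_0[OF I(1)] by (simp add: H_def eqv_def)
    then show "H \<noteq> {}" by blast
    fix g assume "g \<in> H"
    then have g: "g \<in> carrier Q" "eqv g \<one>" by (auto simp: H_def)
    have "eqv (inv g \<otimes> g) (inv g \<otimes> \<one>)" by (rule eqv_left) (use g in auto)
    then show "inv g \<in> H" using g eqv_sym by (simp add: H_def)
    fix h assume "h \<in> H"
    then have h: "h \<in> carrier Q" "eqv h \<one>" by (auto simp: H_def)
    have "eqv (g \<otimes> h) (\<one> \<otimes> h)" by (rule eqv_right) (use g h in auto)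
    then have "eqv (g \<otimes> h) h" using h by simp
    then show "g \<otimes> h \<in> H" using g h eqv_trans[OF _ h(2)] by (simp add: H_def)
  qed
  have normal: "H \<lhd> Q"
    unfolding normal_inv_iff
  proof (intro conjI ballI H)
    fix x h assume x: "x \<in> carrier Q" and "h \<in> H"
    then have h: "h \<in> carrier Q" "eqv h \<one>" by (auto simp: H_def)
    have "eqv (x \<otimes> h \<otimes> inv x) (x \<otimes> \<one> \<otimes> inv x)" by (intro eqv_right eqv_left) (use x h in auto)
    then show "x \<otimes> h \<otimes> inv x \<in> H" using x h by (simp add: H_def)
  qed
  obtain T where T: "finite T" "T \<subseteq> B" "\<forall>a\<in>B. \<exists>t\<in>T. a - t \<in> I" using I(2) by (auto simp: finite_index_def)
  define rep where "rep a = (SOME t. t \<in> T \<and> a - t \<in> I)" for a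
  have rep: "rep a \<in> T \<and> a - rep a \<in> I" if "a \<in> B" for a
    unfolding rep_def by (rule someI_ex) (use T(3) that in blast)
  define code where "code g = map (\<lambda>(i, j). rep (\<rho> g i j)) (List.product [0..<n] [0..<n])" for g
  define codes where "codes = {xs. set xs \<subseteq> T \<and> length xs = n * n}"
  have fin: "finite codes" unfolding codes_def by (rule finite_lists_length_eq[OF T(1)])
  have code_in: "code g \<in> codes" if "g \<in> carrier Q" for g
    using rep[OF entries[OF that]] by (auto simp: code_def codes_def)
  have code_eq: "eqv g h" if gh: "g \<in> carrier Q" "h \<in> carrier Q" "code g = code h" for g h
    unfolding eqv_def
  proof (intro allI impI)
    fix i j assume ij: "i < n" "j < n"
    have "rep (\<rho> g i j) = rep (\<rho> h i j)" using gh(3) ij unfolding code_def map_eq_conv by auto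
    then have "(\<rho> g i j - rep (\<rho> g i j)) - (\<rho> h i j - rep (\<rho> g i j)) \<in> I"
      using rep[OF entries[OF gh(1) ij]] rep[OF entries[OF gh(2) ij]]
      by (metis ideal_diff[OF B(1) I(1)])
    then show "\<rho> g i j - \<rho> h i j \<in> I" by simp
  qed
  have "carrier (Q Mod H) \<subseteq> (\<lambda>c. H #> (SOME g. g \<in> carrier Q \<and> code g = c)) ` codes"
  proof
    fix C assume "C \<in> carrier (Q Mod H)"
    then obtain g where g: "g \<in> carrier Q" "C = H #> g" by (auto simp: FactGroup_def RCOSETS_def)
    define h where "h = (SOME h. h \<in> carrier Q \<and> code h = code g)"
    have h: "h \<in> carrier Q \<and> code h = code g" unfolding h_def by (rule someI_ex) (use g in blast)
    have "eqv (g \<otimes> inv h) (h \<otimes> inv h)" by (rule eqv_right[OF code_eq]) (use g h in auto)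
    then have gh: "g \<otimes> inv h \<in> H" using g h by (simp add: H_def)
    have "g = (g \<otimes> inv h) \<otimes> h" using g h by (simp add: m_assoc)
    then have "g \<in> H #> h" using gh unfolding r_coset_def by blast
    then have "C = H #> h" using repr_independence[OF _ _ H, of g h] g h by simp
    then show "C \<in> (\<lambda>c. H #> (SOME g. g \<in> carrier Q \<and> code g = c)) ` codes"
      unfolding h_def using code_in[OF g(1)] by blast
  qed
  then have "finite (carrier (Q Mod H))" using fin finite_surj by blast
  moreover have "g0 \<notin> H"
  proof
    assume "g0 \<in> H"
    then have "r \<in> I" using g0 by (simp add: H_def eqv_def r_def one)
    then have "r' * r - (r * r' - 1) \<in> I" by (intro ideal_diff[OF B(1) I(1)] ideal_mult[OF I(1,4)] I(5))
    then show False using I(3) by (simp add: mult.commute)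
  qed
  ultimately show ?thesis using normal g0(1) by blast
qed

section \<open>Isometric actions on proper metric spaces\<close>

lemma isometry_continuous:
  assumes M: "Metric_space M d" and f: "f \<in> M \<rightarrow> M"
    and iso: "\<And>x y. x \<in> M \<Longrightarrow> y \<in> M \<Longrightarrow> d (f x) (f y) = d x y"
  shows "continuous_map (Metric_space.mtopology M d) (Metric_space.mtopology M d) f"
proof -
  interpret Metric_space M d by (rule M)
  have "openin mtopology {x \<in> M. f x \<in> U}" if U: "openin mtopology U" for U
    unfolding openin_mtopology
  proof (intro conjI ballI subsetI allI impI)
    fix x assume x: "x \<in> {x \<in> M. f x \<in> U}"
    then obtain r where r: "r > 0" "mball (f x) r \<subseteq> U" using U unfolding openin_mtopology by blast
    have "mball x r \<subseteq> {x \<in> M. f x \<in> U}"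
    proof
      fix y assume y: "y \<in> mball x r"
      then have "f y \<in> mball (f x) r" using x iso[of x y] f by auto
      then show "y \<in> {x \<in> M. f x \<in> U}" using r(2) y by auto
    qed
    then show "\<exists>r>0. mball x r \<subseteq> {x \<in> M. f x \<in> U}" using r(1) by blast
  qed auto
  then show ?thesis using f by (auto simp: continuous_map_def)
qed

lemma isometric_action_top_action:
  assumes M: "Metric_space M d" and act: "isometric_action Q M d \<phi>"
  shows "top_action Q (Metric_space.mtopology M d) \<phi>"
proof -
  interpret Metric_space M d by (rule M)
  have ga: "group_action Q M \<phi>" and iso: "\<And>g x y. g \<in> carrier Q \<Longrightarrow> x \<in> M \<Longrightarrow> y \<in> M \<Longrightarrow> d (\<phi> g x) (\<phi> g y) = d x y"
    using act by (auto simp: isometric_action_def)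
  interpret act: group_action Q M \<phi> by (rule ga)
  interpret group Q using act.group_hom by (simp add: group_hom_def)
  have cont: "continuous_map mtopology mtopology (\<phi> g)" if g: "g \<in> carrier Q" for g
  proof (rule isometry_continuous[OF M])
    show "\<phi> g \<in> M \<rightarrow> M" using act.element_image[OF g] by blast
    show "d (\<phi> g x) (\<phi> g y) = d x y" if "x \<in> M" "y \<in> M" for x y by (rule iso[OF g that])
  qed
  have "homeomorphic_map mtopology mtopology (\<phi> g)" if g: "g \<in> carrier Q" for g
  proof -
    have ig: "inv\<^bsub>Q\<^esub> g \<in> carrier Q" using g by simp
    have 1: "\<phi> (inv\<^bsub>Q\<^esub> g) (\<phi> g x) = x" if "x \<in> M" for x
      by (rule act.orbit_sym_aux[OF g that refl])
    have 2: "\<phi> g (\<phi> (inv\<^bsub>Q\<^esub> g) x) = x" if "x \<in> M" for x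
      using act.orbit_sym_aux[OF ig that refl] g by simp
    have "homeomorphic_maps mtopology mtopology (\<phi> g) (\<phi> (inv\<^bsub>Q\<^esub> g))"
      unfolding homeomorphic_maps_def using cont[OF g] cont[OF ig] 1 2 by simp
    then show ?thesis by (rule homeomorphic_maps_imp_map)
  qed
  then show ?thesis using ga by (simp add: top_action_def)
qed

text \<open>The pseudometric is the largest displacement on \<open>K\<close>. It is totally bounded, because
  an isometry is determined up to a small error by the approximate images of finitely many points.
  Invariance under right translations holds because each group element permutes \<open>K\<close>.\<close>
lemma isometric_action_precompact:
  assumes M: "Metric_space M d" and act: "isometric_action Q M d \<phi>"
    and K: "Metric_space.mtotally_bounded M d K"
    and inv: "\<And>g y. g \<in> carrier Q \<Longrightarrow> y \<in> K \<Longrightarrow> \<phi> g y \<in> K"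
    and moved: "g \<in> carrier Q" "x \<in> K" "\<phi> g x \<noteq> x"
  shows "\<exists>D. precompact_group Q D \<and> 0 < D \<one>\<^bsub>Q\<^esub> g"
proof -
  interpret Metric_space M d by (rule M)
  have ga: "group_action Q M \<phi>" and iso: "\<And>g x y. g \<in> carrier Q \<Longrightarrow> x \<in> M \<Longrightarrow> y \<in> M \<Longrightarrow> d (\<phi> g x) (\<phi> g y) = d x y"
    using act by (auto simp: isometric_action_def)
  interpret act: group_action Q M \<phi> by (rule ga)
  interpret group Q using act.group_hom by (simp add: group_hom_def)
  have KM: "K \<subseteq> M" by (rule mtotally_bounded_imp_subset[OF K])
  have KM': "y \<in> M" if "y \<in> K" for y using KM that by blast
  obtain B where B: "\<And>x y. x \<in> K \<Longrightarrow> y \<in> K \<Longrightarrow> d x y \<le> B"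
    using mtotally_bounded_imp_mbounded[OF K] unfolding mbounded_alt by blast
  define D where "D g h = (if g \<in> carrier Q \<and> h \<in> carrier Q then SUP y\<in>K. d (\<phi> g y) (\<phi> h y) else 0)" for g h
  have bdd: "bdd_above ((\<lambda>y. d (\<phi> g y) (\<phi> h y)) ` K)" if "g \<in> carrier Q" "h \<in> carrier Q" for g h
    by (rule bdd_aboveI[of _ B]) (use B inv that in auto)
  have ge: "d (\<phi> g y) (\<phi> h y) \<le> D g h" if "g \<in> carrier Q" "h \<in> carrier Q" "y \<in> K" for g h y
    using cSUP_upper[OF that(3) bdd[OF that(1,2)]] that by (simp add: D_def)
  have le: "D g h \<le> c" if "g \<in> carrier Q" "h \<in> carrier Q" "\<And>y. y \<in> K \<Longrightarrow> d (\<phi> g y) (\<phi> h y) \<le> c" for g h c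
    unfolding D_def using that moved(2) by (auto intro!: cSUP_least)
  have le_right: "D (g \<otimes>\<^bsub>Q\<^esub> k) (h \<otimes>\<^bsub>Q\<^esub> k) \<le> D g h"
    if Q: "k \<in> carrier Q" "g \<in> carrier Q" "h \<in> carrier Q" for k g h
  proof (rule le)
    fix y assume y: "y \<in> K"
    have "d (\<phi> g (\<phi> k y)) (\<phi> h (\<phi> k y)) \<le> D g h" by (rule ge[OF Q(2,3) inv[OF Q(1) y]])
    then show "d (\<phi> (g \<otimes>\<^bsub>Q\<^esub> k) y) (\<phi> (h \<otimes>\<^bsub>Q\<^esub> k) y) \<le> D g h"
      using Q KM'[OF y] by (simp add: act.composition_rule)
  qed (use Q in auto)
  have "precompact_group Q D"
  proof (intro precompact_group.intro precompact_group_axioms.intro)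
    show "group Q" by (rule is_group)
    show "0 \<le> D g h" for g h
    proof (cases "g \<in> carrier Q \<and> h \<in> carrier Q")
      case True
      then show ?thesis using ge[of g h x] moved(2) nonneg[of "\<phi> g x" "\<phi> h x"] by linarith
    qed (auto simp: D_def)
    show "D g g = 0" for g
    proof (cases "g \<in> carrier Q")
      case True
      have "d (\<phi> g y) (\<phi> g y) = 0" if "y \<in> K" for y using KM'[OF inv[OF True that]] by simp
      then have "D g g = (SUP y\<in>K. 0)" using True by (simp add: D_def cong: SUP_cong)
      moreover have "K \<noteq> {}" using moved(2) by blast
      ultimately show ?thesis by simp
    qed (simp add: D_def)
    show "D g h = D h g" for g h unfolding D_def by (simp add: commute conj_commute)
    show "D g k \<le> D g h + D h k" if Q: "g \<in> carrier Q" "h \<in> carrier Q" "k \<in> carrier Q" for g h k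
    proof (rule le[OF Q(1,3)])
      fix y assume y: "y \<in> K"
      have "d (\<phi> g y) (\<phi> k y) \<le> d (\<phi> g y) (\<phi> h y) + d (\<phi> h y) (\<phi> k y)"
        by (rule triangle) (use inv KM' Q y in auto)
      then show "d (\<phi> g y) (\<phi> k y) \<le> D g h + D h k" using ge[OF Q(1,2) y] ge[OF Q(2,3) y] by linarith
    qed
    show "D (k \<otimes>\<^bsub>Q\<^esub> g) (k \<otimes>\<^bsub>Q\<^esub> h) = D g h" if Q: "k \<in> carrier Q" "g \<in> carrier Q" "h \<in> carrier Q" for k g h
    proof -
      have "d (\<phi> (k \<otimes>\<^bsub>Q\<^esub> g) y) (\<phi> (k \<otimes>\<^bsub>Q\<^esub> h) y) = d (\<phi> g y) (\<phi> h y)" if y: "y \<in> K" for y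
        using Q KM'[OF y] KM'[OF inv[OF _ y]] by (simp add: act.composition_rule iso)
      then show ?thesis using Q by (simp add: D_def cong: SUP_cong)
    qed
    show "D (g \<otimes>\<^bsub>Q\<^esub> k) (h \<otimes>\<^bsub>Q\<^esub> k) = D g h" if Q: "k \<in> carrier Q" "g \<in> carrier Q" "h \<in> carrier Q" for k g h
    proof (rule antisym[OF le_right[OF Q]])
      have "D ((g \<otimes>\<^bsub>Q\<^esub> k) \<otimes>\<^bsub>Q\<^esub> inv\<^bsub>Q\<^esub> k) ((h \<otimes>\<^bsub>Q\<^esub> k) \<otimes>\<^bsub>Q\<^esub> inv\<^bsub>Q\<^esub> k) \<le> D (g \<otimes>\<^bsub>Q\<^esub> k) (h \<otimes>\<^bsub>Q\<^esub> k)"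
        by (rule le_right) (use Q in auto)
      then show "D g h \<le> D (g \<otimes>\<^bsub>Q\<^esub> k) (h \<otimes>\<^bsub>Q\<^esub> k)" using Q by (simp add: m_assoc)
    qed
    fix e :: real assume e: "e > 0"
    then obtain T where T: "finite T" "T \<subseteq> K" "K \<subseteq> (\<Union>t\<in>T. mball t (e / 8))"
      using K unfolding mtotally_bounded_def by (meson divide_pos_pos zero_less_numeral)
    have near: "\<exists>t\<in>T. d t y < e / 8" if "y \<in> K" for y
    proof -
      have "y \<in> (\<Union>t\<in>T. mball t (e / 8))" using T(3) that by (rule subsetD)
      then show ?thesis by (auto simp only: in_mball)
    qed
    define nr where "nr y = (SOME t. t \<in> T \<and> d t y < e / 8)" for y
    have nr: "nr y \<in> T \<and> d (nr y) y < e / 8" if "y \<in> K" for y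
      unfolding nr_def by (rule someI_ex) (use near[OF that] in blast)
    define pat where "pat g = restrict (\<lambda>t. nr (\<phi> g t)) T" for g
    have "pat ` carrier Q \<subseteq> (\<Pi>\<^sub>E t\<in>T. T)" unfolding pat_def using nr inv T(2) by auto
    then have fin: "finite (pat ` carrier Q)" using finite_PiE[OF T(1), of "\<lambda>_. T"] T(1) finite_subset by blast
    have close: "D g h < e" if Q: "g \<in> carrier Q" "h \<in> carrier Q" and eq: "pat g = pat h" for g h
    proof -
      have "D g h \<le> e / 2"
      proof (rule le[OF Q])
        fix y assume y: "y \<in> K"
        then obtain t where t: "t \<in> T" "d t y < e / 8" using near by blast
        have tK: "t \<in> K" using t(1) T(2) by blast
        define p where "p = nr (\<phi> g t)"
        have p2: "p = nr (\<phi> h t)" using fun_cong[OF eq, of t] t(1) by (simp add: p_def pat_def)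
        have pK: "p \<in> K" using nr[OF inv[OF Q(1) tK]] T(2) by (auto simp: p_def)
        have a: "d p (\<phi> g t) < e / 8" using nr[OF inv[OF Q(1) tK]] by (simp add: p_def)
        have b: "d p (\<phi> h t) < e / 8" using nr[OF inv[OF Q(2) tK]] by (simp add: p2)
        have c: "d (\<phi> g t) (\<phi> g y) < e / 8" "d (\<phi> h t) (\<phi> h y) < e / 8" using t(2) iso Q KM' tK y by auto
        have in_M: "\<phi> g y \<in> M" "\<phi> h y \<in> M" "\<phi> g t \<in> M" "\<phi> h t \<in> M" "p \<in> M"
          using KM' inv Q y tK pK by auto
        have "d (\<phi> g y) (\<phi> h y) \<le> d (\<phi> g y) p + d p (\<phi> h y)" by (rule triangle) (use in_M in auto)
        moreover have "d (\<phi> g y) p \<le> d (\<phi> g y) (\<phi> g t) + d (\<phi> g t) p" by (rule triangle) (use in_M in auto)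
        moreover have "d p (\<phi> h y) \<le> d p (\<phi> h t) + d (\<phi> h t) (\<phi> h y)" by (rule triangle) (use in_M in auto)
        ultimately show "d (\<phi> g y) (\<phi> h y) \<le> e / 2"
          using a b c commute[of "\<phi> g y" "\<phi> g t"] commute[of "\<phi> g t" p] by linarith
      qed
      then show ?thesis using e by simp
    qed
    define sel where "sel c = (SOME g. g \<in> carrier Q \<and> pat g = c)" for c
    have sel: "sel (pat g) \<in> carrier Q \<and> pat (sel (pat g)) = pat g" if "g \<in> carrier Q" for g
      unfolding sel_def by (rule someI_ex) (use that in blast)
    show "\<exists>T. finite T \<and> T \<subseteq> carrier Q \<and> (\<forall>g\<in>carrier Q. \<exists>t\<in>T. D g t < e)"
    proof (intro exI[of _ "sel ` pat ` carrier Q"] conjI ballI)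
      show "sel ` pat ` carrier Q \<subseteq> carrier Q" using sel by blast
      fix g assume "g \<in> carrier Q"
      then show "\<exists>t\<in>sel ` pat ` carrier Q. D g t < e" using sel close[of g "sel (pat g)"] by auto
    qed (use fin in simp)
  qed
  moreover have "0 < D \<one>\<^bsub>Q\<^esub> g"
  proof -
    have x: "x \<in> M" "\<phi> g x \<in> M" using KM' moved inv by auto
    have one: "\<phi> \<one>\<^bsub>Q\<^esub> x = x" using x(1) fun_cong[OF act.id_eq_one, of x] by simp
    have "0 \<noteq> d x (\<phi> g x)" using zero[OF x] moved(3) by metis
    then have "0 < d x (\<phi> g x)" using nonneg[of x "\<phi> g x"] by linarith
    then have "0 < d (\<phi> \<one>\<^bsub>Q\<^esub> x) (\<phi> g x)" by (simp only: one)
    then show ?thesis using ge[OF one_closed moved(1,2)] by linarith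
  qed
  ultimately show ?thesis by blast
qed

theorem corollary1p3:
  fixes Q :: "('g, 'h) monoid_scheme"
  assumes "group Q"
    and "infinite (carrier Q)"
    and "finitely_generated_group Q"
    and fixed_point: "\<And>(X :: 'a topology) \<phi>.
          X_ac X \<Longrightarrow> top_action Q X \<phi> \<Longrightarrow> fixed_points Q (topspace X) \<phi> \<noteq> {}"
    and fixed_set_acyclic: "\<And>p (X :: 'a topology) \<phi>.
          prime p \<Longrightarrow> X_ac X \<Longrightarrow> mod_acyclic p X \<Longrightarrow> top_action Q X \<phi> \<Longrightarrow>
          mod_acyclic p (subtopology X (fixed_points Q (topspace X) \<phi>))"
  shows "\<forall>(M :: 'a set) d.
           proper_metric M d \<and> X_ac (Metric_space.mtopology M d) \<longrightarrow>
           \<not> (\<exists>\<phi>. isometric_action Q M d \<phi> \<and> nontrivial_action Q M \<phi>)"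
proof (intro allI impI notI)
  fix M :: "'a set" and d
  assume Md: "proper_metric M d \<and> X_ac (Metric_space.mtopology M d)"
    and "\<exists>\<phi>. isometric_action Q M d \<phi> \<and> nontrivial_action Q M \<phi>"
  then obtain \<phi> where act: "isometric_action Q M d \<phi>" and nt: "nontrivial_action Q M \<phi>" by blast
  have M: "Metric_space M d" using Md by (simp add: proper_metric_def)
  interpret Metric_space M d by (rule M)
  have ac: "X_ac mtopology" using Md by simp
  have proper: "compactin mtopology (mcball y r)" if "y \<in> M" for y r using Md that by (simp add: proper_metric_def)
  have ga: "group_action Q M \<phi>" and iso: "\<And>g x y. g \<in> carrier Q \<Longrightarrow> x \<in> M \<Longrightarrow> y \<in> M \<Longrightarrow> d (\<phi> g x) (\<phi> g y) = d x y"
    using act by (auto simp: isometric_action_def)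
  obtain g x where gx: "g \<in> carrier Q" "x \<in> M" "\<phi> g x \<noteq> x" using nt by (auto simp: nontrivial_action_def)
  have gM: "\<phi> h y \<in> M" if "h \<in> carrier Q" "y \<in> M" for h y
    using group_action.element_image[OF ga that] by simp
  obtain x0 where x0: "x0 \<in> M" "\<And>h. h \<in> carrier Q \<Longrightarrow> \<phi> h x0 = x0"
    using fixed_point[OF ac isometric_action_top_action[OF M act]] by (auto simp: fixed_points_def)
  obtain p where p: "prime p" "mod_acyclic p mtopology" using ac by (auto simp: X_ac_def)
  interpret mod_p_coefficients p by unfold_locales (rule p(1))
  \<comment> \<open>The carrier type is large enough to hold the spaces built from finite quotients.\<close>
  have "connected_space mtopology" by (rule mod_acyclic_imp_connected[OF p(2)])
  moreover have "\<not> (\<exists>a. topspace mtopology \<subseteq> {a})"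
  proof
    assume "\<exists>a. topspace mtopology \<subseteq> {a}"
    then obtain a where "M \<subseteq> {a}" by auto
    then show False using gx(2,3) gM[OF gx(1,2)] by blast
  qed
  ultimately have "(UNIV :: real set) \<lesssim> topspace mtopology"
    using normal_space_mtopology Hausdorff_imp_t1_space[OF Hausdorff_space_mtopology]
    by (intro connected_space_imp_card_ge)
  then have big: "(UNIV :: real set) \<lesssim> (UNIV :: 'a set)"
    using lepoll_trans subset_imp_lepoll[of "topspace mtopology" UNIV] by blast
  \<comment> \<open>The smallest ball about the fixed point that contains a moved point.\<close>
  define K where "K = mcball x0 (d x0 x)"
  have K: "mtotally_bounded K" unfolding K_def by (rule compactin_imp_mtotally_bounded[OF proper[OF x0(1)]])
  have inv: "\<phi> h y \<in> K" if h: "h \<in> carrier Q" and y: "y \<in> K" for h y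
    using y iso[OF h x0(1), of y] x0(2)[OF h] gM[OF h, of y] by (auto simp: K_def)
  have xK: "x \<in> K" using x0(1) gx(2) by (simp add: K_def)
  have "\<exists>D. precompact_group Q D \<and> 0 < D \<one>\<^bsub>Q\<^esub> g"
    by (rule isometric_action_precompact[OF M act K inv gx(1) xK gx(3)])
  then obtain D where D: "precompact_group Q D" "0 < D \<one>\<^bsub>Q\<^esub> g" by blast
  obtain n :: nat and \<rho> :: "'g \<Rightarrow> nat \<Rightarrow> nat \<Rightarrow> real" where
    \<rho>: "\<forall>g\<in>carrier Q. \<forall>k\<in>carrier Q. \<forall>i<n. \<forall>j<n. \<rho> (g \<otimes>\<^bsub>Q\<^esub> k) i j = (\<Sum>l<n. \<rho> g i l * \<rho> k l j)"
    "\<forall>i<n. \<forall>j<n. \<rho> \<one>\<^bsub>Q\<^esub> i j = of_bool (i = j)"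
    "\<exists>g\<in>carrier Q. \<exists>i<n. \<exists>j<n. \<rho> g i j \<noteq> of_bool (i = j)"
    using precompact_group.nontrivial_matrix_representation[OF D(1) gx(1) D(2)] by blast
  have "\<exists>H. H \<lhd> Q \<and> finite (carrier (Q Mod H)) \<and> H \<noteq> carrier Q"
    by (rule linear_group_finite_quotient[OF assms(1,3) \<rho>(1)[rule_format] \<rho>(2)[rule_format] \<rho>(3)])
  then obtain H where H: "H \<lhd> Q" "finite (carrier (Q Mod H))" "H \<noteq> carrier Q" by blast
  obtain q and X :: "'a topology" and \<psi> where X: "prime q" "X_ac X" "mod_acyclic q X" "top_action Q X \<psi>"
    "\<not> mod_acyclic q (subtopology X (fixed_points Q (topspace X) \<psi>))"
    using finite_quotient_moves_acyclic_space[OF big H] by blast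
  show False using fixed_set_acyclic[OF X(1-4)] X(5) by blast
qed

end
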